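(* Let $\lambda$ be a nonzero dominant minuscule weight of a simply laced complex simple Lie algebra $\mathfrak g$, $\Omega=W\lambda$, and $Q$ an orientation of the Dynkin diagram. Let $\mu,\nu\in\Omega$ with $\mu\ge\nu$. The generic representation of $Q$ of dimension vector $\delta=\mu-\nu$ is a direct sum of pairwise nonisomorphic indecomposables, each occurring once. For distinct summands $M_\beta$ and $M_\gamma$, \[ \mathrm{Hom}(M_\beta,M_\gamma)=0,\qquad \mathrm{Ext}^1(M_\beta,M_\gamma)=0. \] The set $R_Q(\delta)$ of their dimension vectors satisfies \[ \delta=\sum_{\beta\in R_Q(\delta)}\beta,\qquad E_Q(\beta,\gamma)=\begin{cases}1&\beta=\gamma,\\0&\beta\neq\gamma\end{cases}\qquad(\beta,\gamma\in R_Q(\delta)). \] In particular, distinct roots in $R_Q(\delta)$ are orthogonal.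
   Context: $\{\alpha_i\}_{i\in I}$ are the simple roots of $\mathfrak g$, $W$ its Weyl group, and the invariant inner product is normalized by $(\alpha,\alpha)=2$ for all roots. A nonzero dominant weight $\lambda$ is minuscule if the weights of the irreducible representation $V^\lambda$ form the single orbit $\Omega=W\lambda$. Root order: $\mu\ge\nu$ iff $\mu-\nu$ is a nonnegative integer combination of simple roots. A representation $M$ of $Q$ assigns a finite-dimensional complex vector space $M_i$ to each vertex $i$ and a linear map $M_i\to M_j$ to each arrow $i\to j$; its dimension vector is $\sum_i(\dim M_i)\alpha_i$. By Gabriel's theorem the indecomposable representations are indexed by positive roots; $M_\beta$ denotes the indecomposable of dimension vector $\beta$. For $d=\sum d_i\alpha_i$, the group $\prod_iGL_{d_i}(\mathbb C)$ acts with finitely many orbits on $\prod_{i\to j}\mathrm{Hom}(\mathbb C^{d_i},\mathbb C^{d_j})$; exactly one orbit is Zariski-open, and a representation in it is called generic (it is unique up to isomorphism). The Euler form of $Q$ is $E_Q(x,y)=\sum_ix_iy_i-\sum_{i\to j}x_iy_j$ for $x=\sum x_i\alpha_i$, $y=\sum y_i\alpha_i$, the second sum over arrows of $Q$. *)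

theory Defs
  imports
    Complex_Main
    "HOL-Library.FuncSet"
    "Jordan_Normal_Form.Matrix"
begin

section \<open>Complex Lie algebras\<close>

class complex_lie_algebra = ab_group_add +
  fixes scaleL :: "complex \<Rightarrow> 'a \<Rightarrow> 'a"
    and bracket :: "'a \<Rightarrow> 'a \<Rightarrow> 'a"
  assumes scaleL_add_right: "scaleL c (x + y) = scaleL c x + scaleL c y"
    and scaleL_add_left: "scaleL (c + d) x = scaleL c x + scaleL d x"
    and scaleL_scaleL: "scaleL c (scaleL d x) = scaleL (c * d) x"
    and scaleL_one: "scaleL 1 x = x"
    and bracket_add_left: "bracket (x + y) z = bracket x z + bracket y z"
    and bracket_add_right: "bracket x (y + z) = bracket x y + bracket x z"
    and bracket_scaleL_left: "bracket (scaleL c x) y = scaleL c (bracket x y)"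
    and bracket_scaleL_right: "bracket x (scaleL c y) = scaleL c (bracket x y)"
    and bracket_self: "bracket x x = 0"
    and jacobi: "bracket x (bracket y z) + bracket y (bracket z x) + bracket z (bracket x y) = 0"

definition lie_subspace :: "'g::complex_lie_algebra set \<Rightarrow> bool" where
  "lie_subspace S \<longleftrightarrow> 0 \<in> S \<and> (\<forall>x\<in>S. \<forall>y\<in>S. x + y \<in> S) \<and> (\<forall>c. \<forall>x\<in>S. scaleL c x \<in> S)"

definition lie_span :: "'g::complex_lie_algebra set \<Rightarrow> 'g set" where
  "lie_span B = \<Inter>{S. lie_subspace S \<and> B \<subseteq> S}"

definition lie_ideal :: "'g::complex_lie_algebra set \<Rightarrow> bool" where
  "lie_ideal J \<longleftrightarrow> lie_subspace J \<and> (\<forall>x. \<forall>y\<in>J. bracket x y \<in> J)"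

definition simple_lie_algebra :: "'g::complex_lie_algebra itself \<Rightarrow> bool" where
  "simple_lie_algebra _ \<longleftrightarrow>
     (\<exists>B :: 'g set. finite B \<and> lie_span B = UNIV) \<and>
     (\<exists>x y :: 'g. bracket x y \<noteq> 0) \<and>
     (\<forall>J :: 'g set. lie_ideal J \<longrightarrow> J = {0} \<or> J = UNIV)"

text \<open>For semisimple Lie algebras a Cartan subalgebra is a toral subalgebra (commutative, with
  \<open>ad\<close>-diagonalizable elements) that equals its own centralizer.\<close>

definition cartan_subalgebra :: "'g::complex_lie_algebra set \<Rightarrow> bool" where
  "cartan_subalgebra H \<longleftrightarrow>
     lie_subspace H \<and>
     (\<forall>h\<in>H. lie_span {x. \<exists>c. bracket h x = scaleL c x} = UNIV) \<and>
     {x. \<forall>h\<in>H. bracket h x = 0} = H"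

text \<open>Elements of the dual of the Cartan subalgebra \<open>H\<close> are represented by functions on the whole
  Lie algebra that are linear on \<open>H\<close> and vanish outside \<open>H\<close>, so that equality of functionals
  is equality of functions.\<close>

definition cartan_dual :: "'g::complex_lie_algebra set \<Rightarrow> ('g \<Rightarrow> complex) set" where
  "cartan_dual H = {\<phi>.
     (\<forall>x\<in>H. \<forall>y\<in>H. \<phi> (x + y) = \<phi> x + \<phi> y) \<and>
     (\<forall>c. \<forall>x\<in>H. \<phi> (scaleL c x) = c * \<phi> x) \<and>
     (\<forall>x. x \<notin> H \<longrightarrow> \<phi> x = 0)}"

definition root_space :: "'g::complex_lie_algebra set \<Rightarrow> ('g \<Rightarrow> complex) \<Rightarrow> 'g set" where
  "root_space H \<phi> = {x. \<forall>h\<in>H. bracket h x = scaleL (\<phi> h) x}"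

definition roots :: "'g::complex_lie_algebra set \<Rightarrow> ('g \<Rightarrow> complex) set" where
  "roots H = {\<phi> \<in> cartan_dual H. \<phi> \<noteq> (\<lambda>_. 0) \<and> root_space H \<phi> \<noteq> {0}}"

definition invariant_form :: "('g::complex_lie_algebra \<Rightarrow> 'g \<Rightarrow> complex) \<Rightarrow> bool" where
  "invariant_form \<kappa> \<longleftrightarrow>
     (\<forall>x y z. \<kappa> (x + y) z = \<kappa> x z + \<kappa> y z) \<and>
     (\<forall>c x y. \<kappa> (scaleL c x) y = c * \<kappa> x y) \<and>
     (\<forall>x y. \<kappa> x y = \<kappa> y x) \<and>
     (\<forall>x y z. \<kappa> (bracket x y) z = \<kappa> x (bracket y z)) \<and>
     (\<forall>x. (\<forall>y. \<kappa> x y = 0) \<longrightarrow> x = 0)"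

definition dual_vector ::
    "'g::complex_lie_algebra set \<Rightarrow> ('g \<Rightarrow> 'g \<Rightarrow> complex) \<Rightarrow> ('g \<Rightarrow> complex) \<Rightarrow> 'g" where
  "dual_vector H \<kappa> \<phi> = (THE t. t \<in> H \<and> (\<forall>h\<in>H. \<kappa> t h = \<phi> h))"

text \<open>The form induced by \<open>\<kappa>\<close> on the dual of \<open>H\<close>; \<open>\<kappa>\<close> is nondegenerate on \<open>H\<close>.\<close>

definition dual_form ::
    "'g::complex_lie_algebra set \<Rightarrow> ('g \<Rightarrow> 'g \<Rightarrow> complex)
      \<Rightarrow> ('g \<Rightarrow> complex) \<Rightarrow> ('g \<Rightarrow> complex) \<Rightarrow> complex" where
  "dual_form H \<kappa> \<phi> \<psi> = \<kappa> (dual_vector H \<kappa> \<phi>) (dual_vector H \<kappa> \<psi>)"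

definition root_sum :: "('i::finite \<Rightarrow> 'g \<Rightarrow> complex) \<Rightarrow> ('i \<Rightarrow> nat) \<Rightarrow> 'g \<Rightarrow> complex" where
  "root_sum \<alpha> c = (\<lambda>x. \<Sum>i\<in>UNIV. of_nat (c i) * \<alpha> i x)"

definition simple_roots ::
    "'g::complex_lie_algebra set \<Rightarrow> ('i::finite \<Rightarrow> 'g \<Rightarrow> complex) \<Rightarrow> bool" where
  "simple_roots H \<alpha> \<longleftrightarrow>
     (\<forall>i. \<alpha> i \<in> roots H) \<and>
     (\<forall>c :: 'i \<Rightarrow> complex. (\<forall>x. (\<Sum>i\<in>UNIV. c i * \<alpha> i x) = 0) \<longrightarrow> (\<forall>i. c i = 0)) \<and>
     (\<forall>\<beta>\<in>roots H. \<exists>c. \<beta> = root_sum \<alpha> c \<or> \<beta> = (\<lambda>x. - root_sum \<alpha> c x))"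

text \<open>A simply laced simple Lie algebra with Cartan subalgebra \<open>H\<close>, simple roots \<open>\<alpha>\<close> and
  invariant form \<open>\<kappa>\<close>. Simply laced means that all roots have the same length; the last conjunct
  says this and fixes the normalization of \<open>\<kappa>\<close>.\<close>

definition simply_laced_simple ::
    "'g::complex_lie_algebra set \<Rightarrow> ('g \<Rightarrow> 'g \<Rightarrow> complex) \<Rightarrow> ('i::finite \<Rightarrow> 'g \<Rightarrow> complex) \<Rightarrow> bool" where
  "simply_laced_simple H \<kappa> \<alpha> \<longleftrightarrow>
     simple_lie_algebra TYPE('g) \<and> cartan_subalgebra H \<and> simple_roots H \<alpha> \<and>
     invariant_form \<kappa> \<and> (\<forall>\<beta>\<in>roots H. dual_form H \<kappa> \<beta> \<beta> = 2)"

definition root_ge ::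
    "('i::finite \<Rightarrow> 'g \<Rightarrow> complex) \<Rightarrow> ('g \<Rightarrow> complex) \<Rightarrow> ('g \<Rightarrow> complex) \<Rightarrow> bool" where
  "root_ge \<alpha> \<mu> \<nu> \<longleftrightarrow> (\<exists>c. (\<lambda>x. \<mu> x - \<nu> x) = root_sum \<alpha> c)"

definition root_reflection ::
    "'g::complex_lie_algebra set \<Rightarrow> ('g \<Rightarrow> 'g \<Rightarrow> complex)
      \<Rightarrow> ('g \<Rightarrow> complex) \<Rightarrow> ('g \<Rightarrow> complex) \<Rightarrow> 'g \<Rightarrow> complex" where
  "root_reflection H \<kappa> \<beta> \<mu> =
     (\<lambda>x. \<mu> x - 2 * dual_form H \<kappa> \<mu> \<beta> / dual_form H \<kappa> \<beta> \<beta> * \<beta> x)"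

inductive_set weyl_group ::
    "'g::complex_lie_algebra set \<Rightarrow> ('g \<Rightarrow> 'g \<Rightarrow> complex)
      \<Rightarrow> (('g \<Rightarrow> complex) \<Rightarrow> 'g \<Rightarrow> complex) set"
  for H \<kappa> where
    weyl_id: "id \<in> weyl_group H \<kappa>"
  | weyl_step: "w \<in> weyl_group H \<kappa> \<Longrightarrow> \<beta> \<in> roots H \<Longrightarrow> root_reflection H \<kappa> \<beta> \<circ> w \<in> weyl_group H \<kappa>"

definition weyl_orbit ::
    "'g::complex_lie_algebra set \<Rightarrow> ('g \<Rightarrow> 'g \<Rightarrow> complex)
      \<Rightarrow> ('g \<Rightarrow> complex) \<Rightarrow> ('g \<Rightarrow> complex) set" where
  "weyl_orbit H \<kappa> \<phi> = (\<lambda>w. w \<phi>) ` weyl_group H \<kappa>"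

definition dominant_weight ::
    "'g::complex_lie_algebra set \<Rightarrow> ('g \<Rightarrow> 'g \<Rightarrow> complex) \<Rightarrow> ('i::finite \<Rightarrow> 'g \<Rightarrow> complex)
      \<Rightarrow> ('g \<Rightarrow> complex) \<Rightarrow> bool" where
  "dominant_weight H \<kappa> \<alpha> \<phi> \<longleftrightarrow> \<phi> \<in> cartan_dual H \<and>
     (\<forall>i. 2 * dual_form H \<kappa> \<phi> (\<alpha> i) / dual_form H \<kappa> (\<alpha> i) (\<alpha> i) \<in> \<nat>)"

section \<open>Finite-dimensional representations and minuscule weights\<close>

definition lie_representation :: "nat \<Rightarrow> ('g::complex_lie_algebra \<Rightarrow> complex mat) \<Rightarrow> bool" where
  "lie_representation n \<rho> \<longleftrightarrow>
     (\<forall>x. \<rho> x \<in> carrier_mat n n) \<and>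
     (\<forall>x y. \<rho> (x + y) = \<rho> x + \<rho> y) \<and>
     (\<forall>c x. \<rho> (scaleL c x) = c \<cdot>\<^sub>m \<rho> x) \<and>
     (\<forall>x y. \<rho> (bracket x y) = \<rho> x * \<rho> y - \<rho> y * \<rho> x)"

definition irreducible_representation ::
    "nat \<Rightarrow> ('g::complex_lie_algebra \<Rightarrow> complex mat) \<Rightarrow> bool" where
  "irreducible_representation n \<rho> \<longleftrightarrow>
     lie_representation n \<rho> \<and> n > 0 \<and>
     (\<forall>U. U \<subseteq> carrier_vec n \<and> 0\<^sub>v n \<in> U \<and>
          (\<forall>u\<in>U. \<forall>v\<in>U. u + v \<in> U) \<and> (\<forall>c. \<forall>u\<in>U. c \<cdot>\<^sub>v u \<in> U) \<and>
          (\<forall>x. \<forall>u\<in>U. \<rho> x *\<^sub>v u \<in> U)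
        \<longrightarrow> U = {0\<^sub>v n} \<or> U = carrier_vec n)"

definition rep_weights ::
    "'g::complex_lie_algebra set \<Rightarrow> nat \<Rightarrow> ('g \<Rightarrow> complex mat) \<Rightarrow> ('g \<Rightarrow> complex) set" where
  "rep_weights H n \<rho> = {\<mu> \<in> cartan_dual H.
     \<exists>v\<in>carrier_vec n. v \<noteq> 0\<^sub>v n \<and> (\<forall>h\<in>H. \<rho> h *\<^sub>v v = \<mu> h \<cdot>\<^sub>v v)}"

definition has_highest_weight ::
    "'g::complex_lie_algebra set \<Rightarrow> ('i::finite \<Rightarrow> 'g \<Rightarrow> complex)
      \<Rightarrow> nat \<Rightarrow> ('g \<Rightarrow> complex mat) \<Rightarrow> ('g \<Rightarrow> complex) \<Rightarrow> bool" where
  "has_highest_weight H \<alpha> n \<rho> \<phi> \<longleftrightarrow>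
     \<phi> \<in> rep_weights H n \<rho> \<and> (\<forall>\<mu>\<in>rep_weights H n \<rho>. root_ge \<alpha> \<phi> \<mu>)"

text \<open>The irreducible representation of highest weight \<open>\<phi>\<close> exists and is unique up to isomorphism
  for dominant \<open>\<phi>\<close>, and isomorphic representations have the same weights; so the existential
  quantifier below speaks about that representation.\<close>

definition minuscule ::
    "'g::complex_lie_algebra set \<Rightarrow> ('g \<Rightarrow> 'g \<Rightarrow> complex) \<Rightarrow> ('i::finite \<Rightarrow> 'g \<Rightarrow> complex)
      \<Rightarrow> ('g \<Rightarrow> complex) \<Rightarrow> bool" where
  "minuscule H \<kappa> \<alpha> \<phi> \<longleftrightarrow>
     dominant_weight H \<kappa> \<alpha> \<phi> \<and> \<phi> \<noteq> (\<lambda>_. 0) \<and>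
     (\<exists>n \<rho>. irreducible_representation n \<rho> \<and> has_highest_weight H \<alpha> n \<rho> \<phi> \<and>
        rep_weights H n \<rho> = weyl_orbit H \<kappa> \<phi>)"

section \<open>Quiver representations\<close>

text \<open>A quiver without parallel arrows on the vertex type \<open>'i\<close> is a set of pairs \<open>(i, j)\<close>, one for
  each arrow from \<open>i\<close> to \<open>j\<close>. A representation has the coordinate spaces of dimensions
  \<open>dimv M i\<close> at the vertices, and \<open>maps M (i, j)\<close> is the matrix of the map from vertex \<open>i\<close> to
  vertex \<open>j\<close>, acting on column vectors; \<open>maps M\<close> is \<open>undefined\<close> off the arrows.\<close>

record 'i quiver_rep =
  dimv :: "'i \<Rightarrow> nat"
  maps :: "'i \<times> 'i \<Rightarrow> complex mat"

definition dynkin_orientation ::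
    "'g::complex_lie_algebra set \<Rightarrow> ('g \<Rightarrow> 'g \<Rightarrow> complex) \<Rightarrow> ('i::finite \<Rightarrow> 'g \<Rightarrow> complex)
      \<Rightarrow> ('i \<times> 'i) set \<Rightarrow> bool" where
  "dynkin_orientation H \<kappa> \<alpha> Q \<longleftrightarrow>
     (\<forall>i j. (i, j) \<in> Q \<or> (j, i) \<in> Q \<longleftrightarrow> i \<noteq> j \<and> dual_form H \<kappa> (\<alpha> i) (\<alpha> j) \<noteq> 0) \<and>
     (\<forall>i j. (i, j) \<in> Q \<longrightarrow> (j, i) \<notin> Q)"

definition euler_form :: "('i::finite \<times> 'i) set \<Rightarrow> ('i \<Rightarrow> int) \<Rightarrow> ('i \<Rightarrow> int) \<Rightarrow> int" where
  "euler_form Q x y = (\<Sum>i\<in>UNIV. x i * y i) - (\<Sum>(i, j)\<in>Q. x i * y j)"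

definition rep_space :: "('i \<times> 'i) set \<Rightarrow> ('i \<Rightarrow> nat) \<Rightarrow> ('i \<times> 'i \<Rightarrow> complex mat) set" where
  "rep_space Q d = (\<Pi>\<^sub>E (i, j)\<in>Q. carrier_mat (d j) (d i))"

definition is_rep :: "('i \<times> 'i) set \<Rightarrow> 'i quiver_rep \<Rightarrow> bool" where
  "is_rep Q M \<longleftrightarrow> maps M \<in> rep_space Q (dimv M)"

definition rep_hom ::
    "('i \<times> 'i) set \<Rightarrow> 'i quiver_rep \<Rightarrow> 'i quiver_rep \<Rightarrow> ('i \<Rightarrow> complex mat) set" where
  "rep_hom Q M N = {f.
     (\<forall>i. f i \<in> carrier_mat (dimv N i) (dimv M i)) \<and>
     (\<forall>(i, j)\<in>Q. f j * maps M (i, j) = maps N (i, j) * f i)}"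

definition hom_zero :: "('i \<times> 'i) set \<Rightarrow> 'i quiver_rep \<Rightarrow> 'i quiver_rep \<Rightarrow> bool" where
  "hom_zero Q M N \<longleftrightarrow> rep_hom Q M N = {\<lambda>i. 0\<^sub>m (dimv N i) (dimv M i)}"

definition rep_iso :: "('i \<times> 'i) set \<Rightarrow> 'i quiver_rep \<Rightarrow> 'i quiver_rep \<Rightarrow> bool" where
  "rep_iso Q M N \<longleftrightarrow> (\<exists>f\<in>rep_hom Q M N. \<forall>i. invertible_mat (f i))"

text \<open>\<open>0 \<rightarrow> N \<rightarrow> E \<rightarrow> M \<rightarrow> 0\<close> with maps \<open>f\<close> and \<open>g\<close>.\<close>

definition short_exact ::
    "('i \<times> 'i) set \<Rightarrow> 'i quiver_rep \<Rightarrow> 'i quiver_rep \<Rightarrow> 'i quiver_rep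
      \<Rightarrow> ('i \<Rightarrow> complex mat) \<Rightarrow> ('i \<Rightarrow> complex mat) \<Rightarrow> bool" where
  "short_exact Q N E M f g \<longleftrightarrow>
     f \<in> rep_hom Q N E \<and> g \<in> rep_hom Q E M \<and>
     (\<forall>i. inj_on (\<lambda>v. f i *\<^sub>v v) (carrier_vec (dimv N i)) \<and>
          (\<lambda>v. f i *\<^sub>v v) ` carrier_vec (dimv N i)
            = {v \<in> carrier_vec (dimv E i). g i *\<^sub>v v = 0\<^sub>v (dimv M i)} \<and>
          (\<lambda>v. g i *\<^sub>v v) ` carrier_vec (dimv E i) = carrier_vec (dimv M i))"

text \<open>Vanishing of the Yoneda group \<open>Ext\<^sup>1(M, N)\<close>: its elements are the classes of extensions
  of \<open>M\<close> by \<open>N\<close>, and its zero is the class of split extensions.\<close>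

definition ext1_zero :: "('i \<times> 'i) set \<Rightarrow> 'i quiver_rep \<Rightarrow> 'i quiver_rep \<Rightarrow> bool" where
  "ext1_zero Q M N \<longleftrightarrow>
     (\<forall>E f g. is_rep Q E \<and> short_exact Q N E M f g \<longrightarrow>
        (\<exists>s\<in>rep_hom Q M E. \<forall>i. g i * s i = 1\<^sub>m (dimv M i)))"

definition direct_sum :: "('i \<times> 'i) set \<Rightarrow> 'i quiver_rep list \<Rightarrow> 'i quiver_rep" where
  "direct_sum Q Ms = \<lparr>
     dimv = (\<lambda>i. \<Sum>M\<leftarrow>Ms. dimv M i),
     maps = (\<lambda>a\<in>Q. diag_block_mat (map (\<lambda>M. maps M a) Ms))\<rparr>"

definition zero_rep :: "'i quiver_rep \<Rightarrow> bool" where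
  "zero_rep M \<longleftrightarrow> (\<forall>i. dimv M i = 0)"

definition indecomposable :: "('i \<times> 'i) set \<Rightarrow> 'i quiver_rep \<Rightarrow> bool" where
  "indecomposable Q M \<longleftrightarrow> is_rep Q M \<and> \<not> zero_rep M \<and>
     (\<forall>X Y. is_rep Q X \<and> is_rep Q Y \<and> rep_iso Q M (direct_sum Q [X, Y]) \<longrightarrow> zero_rep X \<or> zero_rep Y)"

definition decomposition :: "('i \<times> 'i) set \<Rightarrow> 'i quiver_rep \<Rightarrow> 'i quiver_rep list \<Rightarrow> bool" where
  "decomposition Q M Ms \<longleftrightarrow> (\<forall>N\<in>set Ms. indecomposable Q N) \<and> rep_iso Q M (direct_sum Q Ms)"

section \<open>Generic representations\<close>

definition gl_orbit ::
    "('i \<times> 'i) set \<Rightarrow> ('i \<Rightarrow> nat) \<Rightarrow> ('i \<times> 'i \<Rightarrow> complex mat) \<Rightarrow> ('i \<times> 'i \<Rightarrow> complex mat) set" where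
  "gl_orbit Q d m = {(\<lambda>(i, j)\<in>Q. g j * m (i, j) * g' i) | g g'.
     \<forall>i. g i \<in> carrier_mat (d i) (d i) \<and> g' i \<in> carrier_mat (d i) (d i) \<and>
         g i * g' i = 1\<^sub>m (d i) \<and> g' i * g i = 1\<^sub>m (d i)}"

text \<open>The polynomial functions in the matrix entries.\<close>

inductive_set rep_polynomials ::
    "('i \<times> 'i) set \<Rightarrow> ('i \<Rightarrow> nat) \<Rightarrow> (('i \<times> 'i \<Rightarrow> complex mat) \<Rightarrow> complex) set"
  for Q d where
    poly_const: "(\<lambda>_. c) \<in> rep_polynomials Q d"
  | poly_entry: "(i, j) \<in> Q \<Longrightarrow> r < d j \<Longrightarrow> s < d i \<Longrightarrow> (\<lambda>m. m (i, j) $$ (r, s)) \<in> rep_polynomials Q d"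
  | poly_add: "p \<in> rep_polynomials Q d \<Longrightarrow> q \<in> rep_polynomials Q d
      \<Longrightarrow> (\<lambda>m. p m + q m) \<in> rep_polynomials Q d"
  | poly_mult: "p \<in> rep_polynomials Q d \<Longrightarrow> q \<in> rep_polynomials Q d
      \<Longrightarrow> (\<lambda>m. p m * q m) \<in> rep_polynomials Q d"

definition zariski_closed ::
    "('i \<times> 'i) set \<Rightarrow> ('i \<Rightarrow> nat) \<Rightarrow> ('i \<times> 'i \<Rightarrow> complex mat) set \<Rightarrow> bool" where
  "zariski_closed Q d Z \<longleftrightarrow>
     (\<exists>P \<subseteq> rep_polynomials Q d. Z = {m \<in> rep_space Q d. \<forall>p\<in>P. p m = 0})"

definition zariski_open ::
    "('i \<times> 'i) set \<Rightarrow> ('i \<Rightarrow> nat) \<Rightarrow> ('i \<times> 'i \<Rightarrow> complex mat) set \<Rightarrow> bool" where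
  "zariski_open Q d U \<longleftrightarrow> U \<subseteq> rep_space Q d \<and> zariski_closed Q d (rep_space Q d - U)"

definition generic_rep :: "('i \<times> 'i) set \<Rightarrow> ('i \<Rightarrow> nat) \<Rightarrow> 'i quiver_rep \<Rightarrow> bool" where
  "generic_rep Q d M \<longleftrightarrow> is_rep Q M \<and> dimv M = d \<and> zariski_open Q d (gl_orbit Q d (maps M))"

text \<open>The dimension vectors of the indecomposable summands of the generic representation.\<close>

definition generic_roots :: "('i \<times> 'i) set \<Rightarrow> ('i \<Rightarrow> nat) \<Rightarrow> ('i \<Rightarrow> nat) set" where
  "generic_roots Q d = {dimv N | M Ms N. generic_rep Q d M \<and> decomposition Q M Ms \<and> N \<in> set Ms}"

end

theory Submission
  imports Defs "Jordan_Normal_Form.Char_Poly"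
begin

text \<open>The Euler form is half of the Weyl group invariant form, hence positive definite. By Ringel's
  lemma every indecomposable representation is then a brick whose dimension vector \<open>\<beta>\<close> satisfies
  \<open>E(\<beta>, \<beta>) = 1\<close>, and vectors with this property are roots. A representation with the smallest
  possible endomorphism algebra has no self-extensions, so its orbit is open. If \<open>\<beta>\<^sub>1, \<dots>, \<beta>\<^sub>n\<close> are the
  dimension vectors of the summands of the generic representation, then \<open>E(\<beta>\<^sub>k, \<beta>\<^sub>l) = dim Hom \<ge> 0\<close>
  because \<open>Ext\<^sup>1\<close> vanishes. On the other hand \<open>(\<mu>, \<beta>\<^sub>k) \<le> 1\<close> and \<open>(\<nu>, \<beta>\<^sub>k) \<ge> -1\<close>, as all weights of a
  minuscule representation have the same length, and therefore
  \<open>2 \<ge> (\<delta>, \<beta>\<^sub>k) = 2 + (\<Sum>l\<noteq>k. E(\<beta>\<^sub>k, \<beta>\<^sub>l) + E(\<beta>\<^sub>l, \<beta>\<^sub>k))\<close>, so that all other products vanish.\<close>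

section \<open>Dimension counts for subspaces of finite-dimensional subspaces\<close>

text \<open>Neither Gabriel's theorem nor the classification of Dynkin diagrams enters: positive
  definiteness is extracted from the Lie algebra itself, and the value 1 on bricks is forced by
  integrality, 0 < E(d, d) = dim Hom - dim Ext^1 <= 1. Hereditariness drives both Ringel's lemma and
  the passage from a representation to its summands: Ext^1 is the cokernel of a map between matrix
  spaces, so its vanishing is inherited by subobjects in the first argument and by quotients in the
  second. The obstacle is that genericity speaks of an open orbit of matrix tuples, while
  decompositions speak of summands. An orbit with Ext^1 = 0 is shown to be open by solving linear
  equations polynomially, two open orbits meet on the line through two of their points, and thus
  Ext^1 = 0 holds for every generic representation. The bounds on (\<mu>, \<beta>) and (\<nu>,
  \<beta>) come from the norm 2 of roots: a weight \<mu> + \<beta> or \<mu> - \<beta> of the same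
  length as \<mu> forces (\<mu>, \<beta>) = -1 or 1. Multiplicity one is not a separate argument:
  two equal dimension vectors would have product 1 instead of 0.\<close>

context vector_space
begin

text \<open>The ambient space may be infinite-dimensional, as the matrix ring below is. Finite
  dimension of a subspace is therefore expressed by containment in the span of a finite set
  \<open>F\<close>.\<close>

lemma finite_basis_in_span:
  assumes "S \<subseteq> span F" "finite F"
  obtains B where "finite B" "independent B" "B \<subseteq> S" "S \<subseteq> span B" "card B = dim S"
proof -
  obtain B where B: "B \<subseteq> S" "independent B" "S \<subseteq> span B" "card B = dim S"
    using basis_exists by blast
  have "finite B" using independent_span_bound[OF assms(2) B(2)] B(1) assms(1) by blast
  then show ?thesis using that B by blast
qed

lemma dim_mono_in_span:
  assumes "S \<subseteq> T" "T \<subseteq> span F" "finite F"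
  shows "dim S \<le> dim T"
proof -
  obtain B where B: "finite B" "T \<subseteq> span B" "card B = dim T"
    using finite_basis_in_span[OF assms(2,3)] by metis
  then show ?thesis using dim_le_card[of S B] assms(1) by auto
qed

lemma dim_psubset_in_span:
  assumes "subspace S" "S \<subset> T" "T \<subseteq> span F" "finite F"
  shows "dim S < dim T"
proof -
  obtain B where B: "finite B" "independent B" "B \<subseteq> S" "S \<subseteq> span B" "card B = dim S"
    using finite_basis_in_span[of S F] assms by (metis order.trans psubset_imp_subset)
  obtain C where C: "finite C" "independent C" "C \<subseteq> T" "T \<subseteq> span C" "card C = dim T"
    using finite_basis_in_span[OF assms(3,4)] by metis
  obtain x where x: "x \<in> T" "x \<notin> S" using assms(2) by blast
  have "span B \<subseteq> S" using B(3) assms(1) span_minimal by blast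
  then have "x \<notin> span B" using x by blast
  then have "independent (insert x B)" "x \<notin> B"
    using B(2) independent_insertI span_base by blast+
  moreover have "insert x B \<subseteq> span C" using x B C assms(2) by blast
  ultimately have "card (insert x B) \<le> card C" using independent_span_bound[OF C(1)] by blast
  then show ?thesis using B C \<open>x \<notin> B\<close> by simp
qed

lemma independent_Un_if_span_disjoint:
  assumes "finite C" "independent B" "independent C" "span B \<inter> span C = {0}"
  shows "independent (B \<union> C) \<and> B \<inter> C = {}"
  using assms(1,3,4)
proof (induction C rule: finite_induct)
  case (insert x C)
  have sub: "span C \<subseteq> span (insert x C)" by (rule span_mono) auto
  have "independent C" using insert.prems(1) independent_mono by blast
  moreover have "span B \<inter> span C = {0}" using insert.prems(2) sub span_zero by blast
  ultimately have IH: "independent (B \<union> C)" "B \<inter> C = {}" using insert.IH by auto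
  have nx: "x \<notin> span C"
    using insert.prems(1) insert.hyps(2) by (simp add: independent_insert)
  have "x \<notin> span (B \<union> C)"
  proof
    assume "x \<in> span (B \<union> C)"
    then obtain s t where st: "s \<in> span B" "t \<in> span C" "x = s + t"
      by (auto simp: span_Un)
    have "x \<in> span (insert x C)" by (simp add: span_base)
    then have "x - t \<in> span (insert x C)" using st(2) sub span_diff by blast
    moreover have "x - t = s" using st by simp
    ultimately have "s = 0" using st(1) insert.prems(2) by blast
    then show False using st nx by simp
  qed
  then have "independent (insert x (B \<union> C))" "x \<notin> B"
    using IH(1) independent_insertI by (blast, meson UnI1 span_base)
  then show ?case using IH by auto
qed (use assms in auto)

lemma dim_add_le_if_disjoint:
  assumes "subspace S" "subspace T" "S \<subseteq> U" "T \<subseteq> U" "S \<inter> T = {0}" "U \<subseteq> span F" "finite F"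
  shows "dim S + dim T \<le> dim U"
proof -
  obtain B where B: "finite B" "independent B" "B \<subseteq> S" "S \<subseteq> span B" "card B = dim S"
    using finite_basis_in_span[of S F] assms by (metis order.trans)
  obtain C where C: "finite C" "independent C" "C \<subseteq> T" "T \<subseteq> span C" "card C = dim T"
    using finite_basis_in_span[of T F] assms by (metis order.trans)
  obtain D where D: "finite D" "U \<subseteq> span D" "card D = dim U"
    using finite_basis_in_span[OF assms(6,7)] by metis
  have "span B = S" "span C = T"
    using B C assms(1,2) span_minimal by blast+
  then have *: "independent (B \<union> C)" "B \<inter> C = {}"
    using independent_Un_if_span_disjoint[OF C(1) B(2) C(2)] assms(5) by auto
  have "B \<union> C \<subseteq> span D" using B(3) C(3) D(2) assms(3,4) by blast
  then have "card (B \<union> C) \<le> card D" using independent_span_bound[OF D(1) *(1)] by blast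
  then show ?thesis using * B C D by (simp add: card_Un_disjoint)
qed

text \<open>Half of rank-nullity: a basis of the kernel together with lifts of a basis of the image
  spans \<open>S\<close>.\<close>

lemma dim_le_kernel_plus_image:
  assumes L: "Vector_Spaces.linear scale scale L" and S: "subspace S" "S \<subseteq> span F" "finite F"
  shows "dim S \<le> dim {x \<in> S. L x = 0} + dim (L ` S)"
proof -
  interpret L: Vector_Spaces.linear scale scale L by fact
  obtain B where B: "finite B" "B \<subseteq> {x \<in> S. L x = 0}" "{x \<in> S. L x = 0} \<subseteq> span B"
      "card B = dim {x \<in> S. L x = 0}"
    by (rule finite_basis_in_span[of "{x \<in> S. L x = 0}" F]) (use S in auto)
  have "L ` S \<subseteq> span (L ` F)" using S(2) L.span_image by auto
  then obtain C where C: "finite C" "C \<subseteq> L ` S" "L ` S \<subseteq> span C" "card C = dim (L ` S)"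
    by (rule finite_basis_in_span[of "L ` S" "L ` F"]) (use S(3) in auto)
  define g where "g = inv_into S L"
  have g: "g c \<in> S \<and> L (g c) = c" if "c \<in> C" for c
    using that C(2) inv_into_into[of c L S] f_inv_into_f[of c L S] unfolding g_def by blast
  have "S \<subseteq> span (B \<union> g ` C)"
  proof
    fix x assume x: "x \<in> S"
    have "L ` g ` C = C" using g by (force simp: image_image)
    then have "L x \<in> L ` span (g ` C)" using x C(3) L.span_image[of "g ` C"] by auto
    then obtain y where y: "y \<in> span (g ` C)" "L x = L y" by blast
    have "span (g ` C) \<subseteq> S" using g S(1) by (intro span_minimal) auto
    then have "x - y \<in> S" using x y S(1) subspace_diff by blast
    then have "x - y \<in> span B" using y(2) B(3) by (auto simp: L.diff)
    then have "(x - y) + y \<in> span (B \<union> g ` C)"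
      using y(1) by (meson span_add span_mono subsetD sup_ge1 sup_ge2)
    then show "x \<in> span (B \<union> g ` C)" by simp
  qed
  then have "dim S \<le> card (B \<union> g ` C)" using dim_le_card B(1) C(1) by simp
  also have "\<dots> \<le> card B + card C"
    using card_Un_le[of B "g ` C"] card_image_le[OF C(1), of g] by linarith
  finally show ?thesis using B C by simp
qed

lemma dim_image_le_in_span:
  assumes L: "Vector_Spaces.linear scale scale L" and S: "S \<subseteq> span F" "finite F"
  shows "dim (L ` S) \<le> dim S"
proof -
  interpret L: Vector_Spaces.linear scale scale L by fact
  obtain B where B: "finite B" "S \<subseteq> span B" "card B = dim S"
    using finite_basis_in_span[OF S] by metis
  have "L ` S \<subseteq> span (L ` B)" using B(2) L.span_image by auto
  then have "dim (L ` S) \<le> card (L ` B)" using B(1) dim_le_card by blast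
  then show ?thesis using B card_image_le[OF B(1), of L] by linarith
qed

text \<open>Extend the kernel element \<open>f\<close> to a basis of \<open>S\<close>; the images of
  the other basis vectors already span the image.\<close>

lemma dim_image_less:
  assumes L: "Vector_Spaces.linear scale scale L" and S: "subspace S" "S \<subseteq> span F" "finite F"
    and f: "f \<in> S" "f \<noteq> 0" "L f = 0"
  shows "dim (L ` S) < dim S"
proof -
  interpret L: Vector_Spaces.linear scale scale L by fact
  have "{f} \<subseteq> S" "independent {f}" using f by auto
  then obtain B where B: "{f} \<subseteq> B" "B \<subseteq> S" "independent B" "S \<subseteq> span B"
    by (rule maximal_independent_subset_extend)
  have finB: "finite B" using independent_span_bound[OF S(3) B(3)] B(2) S(2) by blast
  have card: "card B = dim S" by (rule basis_card_eq_dim) (use B in auto)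
  have "L ` S \<subseteq> span (L ` B)" using B(4) L.span_image by auto
  also have "L ` B \<subseteq> insert 0 (L ` (B - {f}))" using f(3) by auto
  then have "span (L ` B) \<subseteq> span (L ` (B - {f}))"
    using span_insert_0 span_mono by blast
  finally have "dim (L ` S) \<le> card (L ` (B - {f}))" using finB dim_le_card by blast
  also have "\<dots> \<le> card (B - {f})" using finB card_image_le by blast
  also have "\<dots> < card B" using finB B(1) by (intro psubset_card_mono) auto
  finally show ?thesis using card by simp
qed

end

section \<open>The ring of finitely supported matrices\<close>

text \<open>One type holds the linear maps between representations of all dimension vectors, so
  composition is a total, associative product. Finite support keeps the sums finite. The ring has no
  unit; idempotents take the place of identity maps.\<close>

typedef 'x fmat = "{A :: 'x \<Rightarrow> 'x \<Rightarrow> complex. finite {(x, y). A x y \<noteq> 0}}"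
  morphisms entry Fmat
  by (rule exI[of _ "\<lambda>_ _. 0"]) simp

setup_lifting type_definition_fmat

lemma fmat_eqI: "(\<And>x y. entry A x y = entry B x y) \<Longrightarrow> A = B"
  by (metis entry_inject ext)

lemma finite_support: "finite {(x, y). entry A x y \<noteq> 0}"
  using entry[of A] by simp

lemma finite_row_support: "finite {y. entry A x y \<noteq> 0}"
  using finite_imageI[OF finite_support[of A], of snd] by (rule finite_subset[rotated]) force

lemma finite_col_support: "finite {x. entry A x y \<noteq> 0}"
  using finite_imageI[OF finite_support[of A], of fst] by (rule finite_subset[rotated]) force

lift_definition scl :: "complex \<Rightarrow> 'x fmat \<Rightarrow> 'x fmat" is "\<lambda>c A x y. c * A x y"
  by (erule finite_subset[rotated]) auto

instantiation fmat :: (type) ab_group_add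
begin
lift_definition zero_fmat :: "'a fmat" is "\<lambda>_ _. 0" by simp
lift_definition plus_fmat :: "'a fmat \<Rightarrow> 'a fmat \<Rightarrow> 'a fmat" is "\<lambda>A B x y. A x y + B x y"
  subgoal for A B by (rule finite_subset[of _ "{(x, y). A x y \<noteq> 0} \<union> {(x, y). B x y \<noteq> 0}"]) auto
  done
lift_definition minus_fmat :: "'a fmat \<Rightarrow> 'a fmat \<Rightarrow> 'a fmat" is "\<lambda>A B x y. A x y - B x y"
  subgoal for A B by (rule finite_subset[of _ "{(x, y). A x y \<noteq> 0} \<union> {(x, y). B x y \<noteq> 0}"]) auto
  done
lift_definition uminus_fmat :: "'a fmat \<Rightarrow> 'a fmat" is "\<lambda>A x y. - A x y" by simp
instance by standard (transfer; simp add: fun_eq_iff)+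
end

lemma finite_mult_support:
  fixes A B :: "'x \<Rightarrow> 'x \<Rightarrow> complex"
  assumes "finite {(x, y). A x y \<noteq> 0}" "finite {(x, y). B x y \<noteq> 0}"
  shows "finite {(x, z). (\<Sum>y | A x y \<noteq> 0. A x y * B y z) \<noteq> 0}"
proof -
  let ?S = "fst ` {(x, y). A x y \<noteq> 0} \<times> snd ` {(x, y). B x y \<noteq> 0}"
  have "finite ?S" using assms by auto
  moreover have "{(x, z). (\<Sum>y | A x y \<noteq> 0. A x y * B y z) \<noteq> 0}
      \<subseteq> ?S"
  proof
    fix p assume "p \<in> {(x, z). (\<Sum>y | A x y \<noteq> 0. A x y * B y z) \<noteq> 0}"
    then obtain x z where p: "p = (x, z)" and "(\<Sum>y | A x y \<noteq> 0. A x y * B y z) \<noteq> 0" by blast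
    then obtain y where "A x y * B y z \<noteq> 0" by (meson sum.not_neutral_contains_not_neutral)
    then show "p \<in> ?S" using p by force
  qed
  ultimately show ?thesis by (rule finite_subset[rotated])
qed

instantiation fmat :: (type) times
begin
lift_definition times_fmat :: "'a fmat \<Rightarrow> 'a fmat \<Rightarrow> 'a fmat"
  is "\<lambda>A B x z. \<Sum>y | A x y \<noteq> 0. A x y * B y z"
  by (rule finite_mult_support)
instance ..
end

lemma entry_0[simp]: "entry 0 x y = 0" by transfer simp
lemma entry_add[simp]: "entry (A + B) x y = entry A x y + entry B x y" by transfer simp
lemma entry_diff[simp]: "entry (A - B) x y = entry A x y - entry B x y" by transfer simp
lemma entry_uminus[simp]: "entry (- A) x y = - entry A x y" by transfer simp
lemma entry_scl[simp]: "entry (scl c A) x y = c * entry A x y" by transfer simp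

lemma entry_sum[simp]: "entry (sum f S) x y = (\<Sum>s\<in>S. entry (f s) x y)"
  by (induction S rule: infinite_finite_induct) auto

lemma entry_mult_left:
  assumes "finite S" "\<And>y. entry A x y \<noteq> 0 \<Longrightarrow> y \<in> S"
  shows "entry (A * B) x z = (\<Sum>y\<in>S. entry A x y * entry B y z)"
proof -
  have "entry (A * B) x z = (\<Sum>y | entry A x y \<noteq> 0. entry A x y * entry B y z)"
    by transfer simp
  also have "\<dots> = (\<Sum>y\<in>S. entry A x y * entry B y z)"
    by (rule sum.mono_neutral_left) (use assms in auto)
  finally show ?thesis .
qed

text \<open>The product is defined by a sum over a row support of the left factor. Here a set
  containing a column support of the right factor serves as well, which makes linearity in the left
  factor visible.\<close>

lemma entry_mult_right:
  assumes "finite S" "\<And>y. entry B y z \<noteq> 0 \<Longrightarrow> y \<in> S"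
  shows "entry (A * B) x z = (\<Sum>y\<in>S. entry A x y * entry B y z)"
proof -
  have "entry (A * B) x z = (\<Sum>y\<in>S \<union> {y. entry A x y \<noteq> 0}. entry A x y * entry B y z)"
    by (rule entry_mult_left) (use assms finite_row_support in auto)
  also have "\<dots> = (\<Sum>y\<in>S. entry A x y * entry B y z)"
    by (rule sum.mono_neutral_right) (use assms finite_row_support in auto)
  finally show ?thesis .
qed

lemmas entry_mult_row = entry_mult_left[OF finite_row_support CollectI]
lemmas entry_mult_col = entry_mult_right[OF finite_col_support CollectI]

instance fmat :: (type) ring
proof
  fix A B C :: "'a fmat"
  show "A * B * C = A * (B * C)"
  proof (rule fmat_eqI)
    fix x z
    have "entry (A * B * C) x z
        = (\<Sum>w | entry C w z \<noteq> 0. (\<Sum>y | entry A x y \<noteq> 0. entry A x y * entry B y w) * entry C w z)"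
      by (simp only: entry_mult_col[of C] entry_mult_row[of A])
    also have "\<dots>
        = (\<Sum>y | entry A x y \<noteq> 0. entry A x y * (\<Sum>w | entry C w z \<noteq> 0. entry B y w * entry C w z))"
      unfolding sum_distrib_left sum_distrib_right
      by (subst sum.swap) (simp add: mult.assoc)
    also have "\<dots> = entry (A * (B * C)) x z"
      by (simp only: entry_mult_col[of C] entry_mult_row[of A])
    finally show "entry (A * B * C) x z = entry (A * (B * C)) x z" .
  qed
  show "(A + B) * C = A * C + B * C"
    by (rule fmat_eqI)
      (simp add: entry_mult_col[of C] sum.distrib distrib_right)
  show "A * (B + C) = A * B + A * C"
    by (rule fmat_eqI)
      (simp add: entry_mult_row[of A] sum.distrib distrib_left)
qed

interpretation fm: vector_space scl
  by unfold_locales (rule fmat_eqI, simp add: algebra_simps)+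

lemma scl_mult_left[simp]: "scl c A * B = scl c (A * B)"
  by (rule fmat_eqI)
    (simp add: entry_mult_col[of B] sum_distrib_left mult.assoc)

lemma scl_mult_right[simp]: "A * scl c B = scl c (A * B)"
  by (rule fmat_eqI)
    (simp add: entry_mult_row[of A] sum_distrib_left mult.left_commute)

lemma linear_fmatI:
  assumes "\<And>A B. L (A + B) = L A + L B" "\<And>c A. L (scl c A) = scl c (L A)"
  shows "Vector_Spaces.linear scl scl L"
  by unfold_locales (use assms in auto)

lift_definition munit :: "'x \<Rightarrow> 'x \<Rightarrow> 'x fmat" is "\<lambda>a b x y. if x = a \<and> y = b then 1 else 0"
  subgoal for a b by (rule finite_subset[of _ "{(a, b)}"]) auto
  done

lemma entry_munit[simp]: "entry (munit a b) x y = (if x = a \<and> y = b then 1 else 0)"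
  by transfer simp

lemma entry_munit_mult: "entry (munit a b * A) x y = (if x = a then entry A b y else 0)"
  by (subst entry_mult_left[of "{b}"]) (auto split: if_splits)

lemma entry_mult_munit: "entry (A * munit a b) x y = (if y = b then entry A x a else 0)"
  by (subst entry_mult_right[of "{a}"]) (auto split: if_splits)

lemma munit_mult_munit: "munit a b * munit c d = (if b = c then munit a d else 0)"
  by (rule fmat_eqI) (auto simp: entry_munit_mult)

lemma munit_mult_mult_munit: "munit a b * A * munit c d = scl (entry A b c) (munit a d)"
  by (rule fmat_eqI) (auto simp: entry_munit_mult entry_mult_munit)

definition supported :: "('x \<times> 'x) set \<Rightarrow> 'x fmat set" where
  "supported S = {A. \<forall>x y. entry A x y \<noteq> 0 \<longrightarrow> (x, y) \<in> S}"

lemma subspace_supported: "fm.subspace (supported S)"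
  unfolding fm.subspace_def supported_def by (auto, metis add_0)

lemma supported_eq_span:
  assumes "finite S"
  shows "supported S = fm.span ((\<lambda>(x, y). munit x y) ` S)"
proof
  show "fm.span ((\<lambda>(x, y). munit x y) ` S) \<subseteq> supported S"
    by (rule fm.span_minimal[OF _ subspace_supported])
      (auto simp: supported_def split: if_splits)
  show "supported S \<subseteq> fm.span ((\<lambda>(x, y). munit x y) ` S)"
  proof
    fix A :: "'a fmat" assume A: "A \<in> supported S"
    have "A = (\<Sum>z\<in>S. scl (entry A (fst z) (snd z)) (munit (fst z) (snd z)))"
    proof (rule fmat_eqI)
      fix x y
      have "entry (\<Sum>z\<in>S. scl (entry A (fst z) (snd z)) (munit (fst z) (snd z))) x y
        = (\<Sum>z\<in>S. if z = (x, y) then entry A x y else 0)"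
        by simp (rule sum.cong, auto)
      also have "\<dots> = entry A x y"
        using A assms by (auto simp: sum.delta supported_def)
      finally show "entry A x y
        = entry (\<Sum>z\<in>S. scl (entry A (fst z) (snd z)) (munit (fst z) (snd z))) x y" by simp
    qed
    also have "\<dots> \<in> fm.span ((\<lambda>(x, y). munit x y) ` S)"
      by (intro fm.span_sum fm.span_scale fm.span_base) force
    finally show "A \<in> fm.span ((\<lambda>(x, y). munit x y) ` S)" .
  qed
qed

lemma dim_supported:
  assumes "finite (S :: ('x \<times> 'x) set)"
  shows "fm.dim (supported S) = card S"
proof -
  let ?f = "\<lambda>(x, y). munit x y :: 'x fmat"
  have inj: "inj_on ?f S"
    by (rule inj_onI) (auto, (metis entry_munit zero_neq_one)+)
  have "fm.independent (?f ` S)"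
  proof (rule fm.independent_if_scalars_zero)
    show "finite (?f ` S)" using assms by simp
    fix g u assume sum0: "(\<Sum>v\<in>?f ` S. scl (g v) v) = 0" and "u \<in> ?f ` S"
    then obtain x y where xy: "(x, y) \<in> S" "u = munit x y" by auto
    have "0 = entry (\<Sum>v\<in>?f ` S. scl (g v) v) x y" using sum0 by simp
    also have "\<dots> = (\<Sum>z\<in>S. g (?f z) * entry (?f z) x y)"
      by (simp add: sum.reindex[OF inj])
    also have "\<dots> = (\<Sum>z\<in>S. if z = (x, y) then g u else 0)"
      by (rule sum.cong) (auto simp: xy split: if_splits)
    finally show "g u = 0" using xy assms by simp
  qed
  then have "fm.dim (fm.span (?f ` S)) = card (?f ` S)"
    by (rule fm.dim_span_eq_card_independent)
  then show ?thesis using supported_eq_span[OF assms] card_image[OF inj] by simp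
qed

lemma finite_dim_supported:
  assumes "finite S"
  obtains F where "finite F" "supported S \<subseteq> fm.span F"
  using supported_eq_span[OF assms] assms that[of "(\<lambda>(x, y). munit x y) ` S"] by auto

section \<open>Graded matrices and rank factorization\<close>

text \<open>Rows and columns are indexed by pairs of a vertex and a basis index. A \<open>graded\<close> matrix
  preserves the vertex; a matrix in \<open>arrow_mats Q\<close> combines the maps along all arrows, the entry
  in row \<open>x\<close> and column \<open>y\<close> belonging to the arrow from \<open>fst y\<close> to \<open>fst x\<close>.\<close>

definition graded :: "('i \<times> nat) fmat set" where
  "graded = supported {(x, y). fst x = fst y}"

definition arrow_mats :: "('i \<times> 'i) set \<Rightarrow> ('i \<times> nat) fmat set" where
  "arrow_mats Q = supported {(x, y). (fst y, fst x) \<in> Q}"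

text \<open>The identity map of the coordinate spaces of dimensions \<open>d\<close>, as an
  idempotent; vertex \<open>i\<close> has the basis indices below \<open>d i\<close>.\<close>

lift_definition iden :: "('i::finite \<Rightarrow> nat) \<Rightarrow> ('i \<times> nat) fmat"
  is "\<lambda>d x y. if x = y \<and> snd x < d (fst x) then 1 else 0"
  subgoal for d
    by (rule finite_subset[of _ "(\<lambda>x. (x, x)) ` (SIGMA i:UNIV. {..<d i})"]) (auto split: if_splits)
  done

lemma entry_iden[simp]: "entry (iden d) x y = (if x = y \<and> snd x < d (fst x) then 1 else 0)"
  by transfer simp

lemma supported_mult:
  assumes "A \<in> supported S" "B \<in> supported T" "S O T \<subseteq> U"
  shows "A * B \<in> supported U"
proof -
  have "(x, z) \<in> U" if nz: "entry (A * B) x z \<noteq> 0" for x z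
  proof -
    have "\<exists>y. entry A x y * entry B y z \<noteq> 0"
    proof (rule ccontr)
      assume "\<not> ?thesis"
      then have "entry (A * B) x z = 0" by (auto simp only: entry_mult_row intro!: sum.neutral)
      then show False using nz by simp
    qed
    then obtain y where "entry A x y \<noteq> 0" "entry B y z \<noteq> 0" by auto
    then have "(x, y) \<in> S" "(y, z) \<in> T" using assms(1,2) by (simp_all add: supported_def)
    then show ?thesis using assms(3) by blast
  qed
  then show ?thesis by (simp add: supported_def)
qed

lemma graded_mult[simp, intro]: "A \<in> graded \<Longrightarrow> B \<in> graded \<Longrightarrow> A * B \<in> graded"
  unfolding graded_def by (erule supported_mult) auto

lemma graded_mult_arrow_mats[simp, intro]:
  "A \<in> graded \<Longrightarrow> B \<in> arrow_mats Q \<Longrightarrow> A * B \<in> arrow_mats Q"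
  unfolding graded_def arrow_mats_def by (erule supported_mult) auto

lemma arrow_mats_mult_graded[simp, intro]:
  "A \<in> arrow_mats Q \<Longrightarrow> B \<in> graded \<Longrightarrow> A * B \<in> arrow_mats Q"
  unfolding graded_def arrow_mats_def by (erule supported_mult) auto

lemma subspace_graded: "fm.subspace graded" and subspace_arrow_mats: "fm.subspace (arrow_mats Q)"
  unfolding graded_def arrow_mats_def by (rule subspace_supported)+

lemma graded_closed[simp, intro]:
  "0 \<in> graded" "A \<in> graded \<Longrightarrow> B \<in> graded \<Longrightarrow> A + B \<in> graded"
  "A \<in> graded \<Longrightarrow> B \<in> graded \<Longrightarrow> A - B \<in> graded" "A \<in> graded \<Longrightarrow> - A \<in> graded"
  "A \<in> graded \<Longrightarrow> scl c A \<in> graded"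
  by (simp_all add: subspace_graded fm.subspace_0 fm.subspace_add fm.subspace_diff
      fm.subspace_neg fm.subspace_scale)

lemma arrow_mats_closed[simp, intro]:
  "0 \<in> arrow_mats Q" "A \<in> arrow_mats Q \<Longrightarrow> B \<in> arrow_mats Q \<Longrightarrow> A + B \<in> arrow_mats Q"
  "A \<in> arrow_mats Q \<Longrightarrow> B \<in> arrow_mats Q \<Longrightarrow> A - B \<in> arrow_mats Q"
  "A \<in> arrow_mats Q \<Longrightarrow> - A \<in> arrow_mats Q" "A \<in> arrow_mats Q \<Longrightarrow> scl c A \<in> arrow_mats Q"
  by (simp_all add: subspace_arrow_mats fm.subspace_0 fm.subspace_add fm.subspace_diff
      fm.subspace_neg fm.subspace_scale)

lemma graded_sum[intro]: "(\<And>s. s \<in> S \<Longrightarrow> f s \<in> graded) \<Longrightarrow> sum f S \<in> graded"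
  using fm.subspace_sum[OF subspace_graded] by blast

lemma munit_graded[simp]: "fst x = fst y \<Longrightarrow> munit x y \<in> graded"
  by (auto simp: graded_def supported_def split: if_splits)

lemma iden_graded[simp, intro]: "iden d \<in> graded"
  by (auto simp: graded_def supported_def split: if_splits)

lemma entry_iden_mult: "entry (iden d * A) x y = (if snd x < d (fst x) then entry A x y else 0)"
  by (subst entry_mult_left[of "{x}"]) (auto split: if_splits)

lemma entry_mult_iden: "entry (A * iden d) x y = (if snd y < d (fst y) then entry A x y else 0)"
  by (subst entry_mult_right[of "{y}"]) (auto split: if_splits)

lemma iden_mult_iden[simp]: "iden d * iden d = iden d"
  by (rule fmat_eqI) (auto simp: entry_iden_mult)

lemma iden_mult_eq_iff: "iden d * A = A \<longleftrightarrow> (\<forall>x y. entry A x y \<noteq> 0 \<longrightarrow> snd x < d (fst x))"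
proof
  assume eq: "iden d * A = A"
  have "entry A x y \<noteq> 0 \<longrightarrow> snd x < d (fst x)" for x y
    using arg_cong[OF eq, of "\<lambda>A. entry A x y"] by (auto simp: entry_iden_mult split: if_splits)
  then show "\<forall>x y. entry A x y \<noteq> 0 \<longrightarrow> snd x < d (fst x)" by blast
qed (rule fmat_eqI, unfold entry_iden_mult, metis)

lemma mult_iden_eq_iff: "A * iden d = A \<longleftrightarrow> (\<forall>x y. entry A x y \<noteq> 0 \<longrightarrow> snd y < d (fst y))"
proof
  assume eq: "A * iden d = A"
  have "entry A x y \<noteq> 0 \<longrightarrow> snd y < d (fst y)" for x y
    using arg_cong[OF eq, of "\<lambda>A. entry A x y"] by (auto simp: entry_mult_iden split: if_splits)
  then show "\<forall>x y. entry A x y \<noteq> 0 \<longrightarrow> snd y < d (fst y)" by blast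
qed (rule fmat_eqI, unfold entry_mult_iden, metis)

text \<open>Normalizing with \<open>mult.assoc\<close> nests products to the right, where an
  equation for \<open>A * B\<close> no longer matches inside a longer product. This is its version
  with a tail \<open>D\<close>.\<close>

lemma mult_assoc_eq: "A * B = C \<Longrightarrow> A * (B * D) = C * (D :: 'x fmat)"
  by (metis mult.assoc)

text \<open>A nonzero entry \<open>a\<close> in position \<open>(p, q)\<close> is used as a pivot: \<open>A - A E A / a\<close>, with \<open>E\<close> the
  matrix unit at \<open>(q, p)\<close>, has fewer nonzero rows.\<close>

lemma graded_rank_factorization:
  fixes A :: "('i::finite \<times> nat) fmat"
  assumes "A \<in> graded"
  shows "\<exists>d B B' C C'. B \<in> graded \<and> B' \<in> graded \<and> C \<in> graded \<and> C' \<in> graded \<and>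
    A = B * C \<and> B' * B = iden d \<and> C * C' = iden d \<and>
    B * iden d = B \<and> iden d * C = C \<and> iden d * B' = B' \<and> C' * iden d = C'"
  using assms
proof (induction "card {x. \<exists>y. entry A x y \<noteq> 0}" arbitrary: A rule: less_induct)
  case less
  have fin: "finite {x. \<exists>y. entry A x y \<noteq> 0}"
    by (rule finite_subset[OF _ finite_imageI[OF finite_support[of A], of fst]]) force
  show ?case
  proof (cases "A = 0")
    case True
    have "iden (\<lambda>_::'i. 0) = 0" by (rule fmat_eqI) auto
    then show ?thesis using True by (intro exI[of _ "\<lambda>_. 0"] exI[of _ 0]) auto
  next
    case False
    then obtain p q where pq: "entry A p q \<noteq> 0" by (metis entry_0 fmat_eqI)
    define a where "a = entry A p q"
    have a0: "a \<noteq> 0" using pq a_def by simp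
    have fst: "fst p = fst q" using less.prems pq unfolding graded_def supported_def by blast
    define A1 where "A1 = A - scl (1 / a) (A * (munit q p * A))"
    have A1g: "A1 \<in> graded" unfolding A1_def using less.prems fst by simp
    have pivot: "munit m p * (A * munit q m') = scl a (munit m m')" for m m'
      using munit_mult_mult_munit[of m p A q m'] by (simp add: mult.assoc a_def)
    have pivot': "munit m p * (A * (munit q m' * X)) = scl a (munit m m' * X)" for m m' X
    proof -
      have "munit m p * (A * (munit q m' * X)) = (munit m p * (A * munit q m')) * X"
        by (simp only: mult.assoc)
      then show ?thesis by (simp only: pivot scl_mult_left)
    qed
    have A1l: "munit m p * A1 = 0" for m
      using a0 by (simp add: A1_def right_diff_distrib pivot' munit_mult_munit)
    have A1r: "A1 * munit q m = 0" for m
      using a0 by (simp add: A1_def left_diff_distrib mult.assoc pivot munit_mult_munit)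
    have A1_entry: "entry A1 x y = entry A x y - 1 / a * (entry A x q * entry A p y)" for x y
      using entry_mult_munit[of A q p x p]
      by (simp add: A1_def mult.assoc[symmetric])
        (subst entry_mult_left[of "{p}"], auto simp: entry_mult_munit split: if_splits)
    have "{x. \<exists>y. entry A1 x y \<noteq> 0} \<subset> {x. \<exists>y. entry A x y \<noteq> 0}"
    proof
      have "entry A x q \<noteq> 0" if "entry A1 x y \<noteq> 0" "entry A x y = 0" for x y
        using that by (simp add: A1_entry)
      then show "{x. \<exists>y. entry A1 x y \<noteq> 0} \<subseteq> {x. \<exists>y. entry A x y \<noteq> 0}" by blast
      have "entry A1 p y = 0" for y using a0 by (simp add: A1_entry a_def[symmetric])
      then have "p \<notin> {x. \<exists>y. entry A1 x y \<noteq> 0}" by blast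
      then show "{x. \<exists>y. entry A1 x y \<noteq> 0} \<noteq> {x. \<exists>y. entry A x y \<noteq> 0}" using pq by blast
    qed
    then have "card {x. \<exists>y. entry A1 x y \<noteq> 0} < card {x. \<exists>y. entry A x y \<noteq> 0}"
      using fin psubset_card_mono by blast
    from less.hyps[OF this A1g] obtain d B B' C C' where
      g: "B \<in> graded" "B' \<in> graded" "C \<in> graded" "C' \<in> graded" and
      A1: "A1 = B * C" and B': "B' * B = iden d" and C': "C * C' = iden d" and
      idens: "B * iden d = B" "iden d * C = C" "iden d * B' = B'" "C' * iden d = C'"
      by blast
    define i where "i = fst p"
    \<comment> \<open>The rank at the vertex of the pivot grows by one, and \<open>d i\<close> is
      the first index not yet used there.\<close>
    define n where "n = (i, d i)"
    define d' where "d' = d(i := Suc (d i))"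
    have d': "iden d' = iden d + munit n n"
      by (rule fmat_eqI) (auto simp: d'_def n_def less_Suc_eq)
    have n0: "iden d * munit n m = 0" "munit m n * iden d = 0" for m
      by (rule fmat_eqI, auto simp: entry_iden_mult entry_mult_iden n_def)+
    have Bn: "B * munit n m = 0" for m
      by (metis idens(1) mult.assoc mult_zero_right n0(1))
    have nC: "munit m n * C = 0" for m
      by (metis idens(2) mult.assoc mult_zero_left n0(2))
    have nB': "munit m n * B' = 0" for m
      by (metis idens(3) mult.assoc mult_zero_left n0(2))
    have C'n: "C' * munit n m = 0" for m
      by (metis idens(4) mult.assoc mult_zero_right n0(1))
    \<comment> \<open>Row \<open>p\<close> of \<open>A1\<close> is zero, and \<open>C\<close> can be
      cancelled on the right, so row \<open>p\<close> of \<open>B\<close> is zero as well. Dually,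
      \<open>Cq\<close> says that column \<open>q\<close> of \<open>C\<close> is zero.\<close>
    have pB: "munit m p * B = 0" for m
    proof -
      have "munit m p * B = munit m p * (B * C) * C'" by (simp add: mult.assoc C' idens)
      then show ?thesis using A1l A1 by simp
    qed
    have Cq: "C * munit q m = 0" for m
    proof -
      have "C * munit q m = B' * (B * C * munit q m)"
        by (simp add: mult.assoc[symmetric] B' idens)
      then show ?thesis using A1r A1 by simp
    qed
    note expand = distrib_left distrib_right left_diff_distrib right_diff_distrib mult.assoc
    note zeros = Bn nC nB' C'n pB Cq Bn[THEN mult_assoc_eq] nC[THEN mult_assoc_eq]
      nB'[THEN mult_assoc_eq] C'n[THEN mult_assoc_eq] pB[THEN mult_assoc_eq] Cq[THEN mult_assoc_eq]
      n0 n0[THEN mult_assoc_eq]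
    note munits = munit_mult_munit munit_mult_munit[THEN mult_assoc_eq]
    \<comment> \<open>\<open>B2\<close> receives column \<open>q\<close> of \<open>A\<close>,
      divided by \<open>a\<close>, as its new column \<open>n\<close>, and \<open>C2\<close>
      receives row \<open>p\<close> of \<open>A\<close> as its new row \<open>n\<close>. Their
      product restores the term subtracted in \<open>A1\<close>.\<close>
    define B2 where "B2 = B + scl (1 / a) (A * munit q n)"
    define C2 where "C2 = C + munit n p * A"
    \<comment> \<open>The last terms of \<open>B2'\<close> and \<open>C2'\<close> cancel the cross
      products \<open>B' * (A * munit q n)\<close> and \<open>munit n p * (A * C')\<close>, which
      need not vanish.\<close>
    define B2' where "B2' = B' + munit n p - scl (1 / a) (B' * (A * munit q p))"
    define C2' where "C2' = C' + scl (1 / a) (munit q n) - scl (1 / a) (munit q p * (A * C'))"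
    have fsts: "fst n = fst p" "fst n = fst q" by (simp_all add: n_def i_def fst)
    have "B2 * C2 = B * C + scl (1 / a) (A * (munit q p * A))"
      by (simp add: B2_def C2_def distrib_left distrib_right mult.assoc zeros munits)
    then have 1: "A = B2 * C2" using A1 A1_def by (metis diff_add_cancel)
    have 2: "B2' * B2 = iden d'"
      using a0 by (simp add: B2_def B2'_def d' expand zeros munits B' pivot pivot')
    have 3: "C2 * C2' = iden d'"
      using a0 by (simp add: C2_def C2'_def d' expand zeros munits C' pivot pivot')
    have 4: "B2 * iden d' = B2" "iden d' * C2 = C2" "iden d' * B2' = B2'" "C2' * iden d' = C2'"
      by (simp_all add: B2_def C2_def B2'_def C2'_def d' expand zeros munits idens
          idens[THEN mult_assoc_eq])
    have 5: "B2 \<in> graded" "B2' \<in> graded" "C2 \<in> graded" "C2' \<in> graded"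
      unfolding B2_def C2_def B2'_def C2'_def using g less.prems fsts fst by simp_all
    show ?thesis using 1 2 3 4 5 by blast
  qed
qed

text \<open>A basis of the image of \<open>e\<close>: in a rank factorization
  \<open>e = B * C\<close>, cancelling the outer factors of \<open>B * C * B * C = B * C\<close>
  leaves \<open>C * B = iden d\<close>.\<close>

lemma graded_idempotent_factorization:
  fixes e :: "('i::finite \<times> nat) fmat"
  assumes "e \<in> graded" "e * e = e"
  obtains d B C where "B \<in> graded" "C \<in> graded" "B * C = e" "C * B = iden d"
    "e * B = B" "C * e = C" "B * iden d = B" "iden d * C = C"
proof -
  obtain d B B' C C' where g: "B \<in> graded" "B' \<in> graded" "C \<in> graded" "C' \<in> graded" and
    e: "e = B * C" and B': "B' * B = iden d" and C': "C * C' = iden d" and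
    idens: "B * iden d = B" "iden d * C = C" "iden d * B' = B'" "C' * iden d = C'"
    using graded_rank_factorization[OF assms(1)] by blast
  have "C * B = iden d * (C * B) * iden d" by (simp add: mult.assoc idens idens[THEN mult_assoc_eq])
  also have "\<dots> = (B' * B) * (C * B) * (C * C')" by (simp only: B' C')
  also have "\<dots> = B' * (e * e) * C'" by (simp add: e mult.assoc)
  also have "\<dots> = (B' * B) * (C * C')" unfolding assms(2) by (simp add: e mult.assoc)
  finally have CB: "C * B = iden d" by (simp add: B' C')
  have eB: "e * B = B" and Ce: "C * e = C"
    by (simp_all add: e mult.assoc CB idens) (simp add: mult.assoc[symmetric] CB idens)
  show ?thesis by (rule that[of B C d]) (simp_all add: g e[symmetric] CB idens eB Ce)
qed

section \<open>Homomorphisms, extensions and the Euler form\<close>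

text \<open>A representation is encoded as a pair of a graded idempotent \<open>e\<close>, whose image is the total
  space, and the matrix \<open>T\<close> of all its arrows. Subrepresentations and direct summands are then
  given by other idempotents in the same matrix ring, and no bases have to be chosen for them.\<close>

definition quiver_object :: "('i \<times> 'i) set \<Rightarrow> ('i \<times> nat) fmat \<Rightarrow> ('i \<times> nat) fmat \<Rightarrow> bool" where
  "quiver_object Q e T \<longleftrightarrow> e \<in> graded \<and> T \<in> arrow_mats Q \<and> e * e = e \<and> e * T = T \<and> T * e = T"

definition homs :: "('i \<times> nat) fmat \<Rightarrow> ('i \<times> nat) fmat \<Rightarrow> ('i \<times> nat) fmat \<Rightarrow> ('i \<times> nat) fmat
    \<Rightarrow> ('i \<times> nat) fmat set" where
  "homs e T e' T' = {f \<in> graded. e' * f = f \<and> f * e = f \<and> f * T = T' * f}"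

text \<open>\<open>Ext\<^sup>1\<close> is the cokernel of \<open>f \<mapsto> f T - T' f\<close>.\<close>

definition ext_vanishes :: "('i \<times> 'i) set \<Rightarrow> ('i \<times> nat) fmat \<Rightarrow> ('i \<times> nat) fmat
    \<Rightarrow> ('i \<times> nat) fmat \<Rightarrow> ('i \<times> nat) fmat \<Rightarrow> bool" where
  "ext_vanishes Q e T e' T' \<longleftrightarrow> (\<forall>c\<in>arrow_mats Q. e' * c = c \<longrightarrow> c * e = c \<longrightarrow>
     (\<exists>f\<in>graded. e' * f = f \<and> f * e = f \<and> c = f * T - T' * f))"

definition brick :: "('i \<times> nat) fmat \<Rightarrow> ('i \<times> nat) fmat \<Rightarrow> bool" where
  "brick e T \<longleftrightarrow> e \<noteq> 0 \<and> (\<forall>f\<in>homs e T e T. \<exists>c. f = scl c e)"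

text \<open>Indecomposability of an object, since its direct sum decompositions correspond to
  idempotent endomorphisms.\<close>

definition no_idempotents :: "('i \<times> nat) fmat \<Rightarrow> ('i \<times> nat) fmat \<Rightarrow> bool" where
  "no_idempotents e T \<longleftrightarrow> e \<noteq> 0 \<and> (\<forall>p\<in>homs e T e T. p * p = p \<longrightarrow> p = 0 \<or> p = e)"

lemma homsI:
  "f \<in> graded \<Longrightarrow> e' * f = f \<Longrightarrow> f * e = f \<Longrightarrow> f * T = T' * f \<Longrightarrow> f \<in> homs e T e' T'"
  by (simp add: homs_def)

lemma homsD:
  assumes "f \<in> homs e T e' T'"
  shows "f \<in> graded" "e' * f = f" "f * e = f" "f * T = T' * f"
  using assms by (simp_all add: homs_def)

lemma quiver_objectD:
  assumes "quiver_object Q e T"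
  shows "e \<in> graded" "T \<in> arrow_mats Q" "e * e = e" "e * T = T" "T * e = T"
  using assms by (simp_all add: quiver_object_def)

lemma homs_comp: "f \<in> homs e T e' T' \<Longrightarrow> g \<in> homs e' T' e'' T'' \<Longrightarrow> g * f \<in> homs e T e'' T''"
  unfolding homs_def by (auto simp: mult.assoc) (metis mult.assoc)+

text \<open>A solution \<open>f\<close> need not be supported on the two objects: compressing it to
  \<open>e' * f * e\<close> compresses the coboundary to \<open>e' * c * e = c\<close>.\<close>

lemma ext_vanishesI:
  assumes ob: "quiver_object Q e T" "quiver_object Q e' T'"
    and ex: "\<And>c. c \<in> arrow_mats Q \<Longrightarrow> e' * c = c \<Longrightarrow> c * e = c \<Longrightarrow> \<exists>f\<in>graded. c = f * T - T' * f"
  shows "ext_vanishes Q e T e' T'"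
  unfolding ext_vanishes_def
proof (intro ballI impI)
  fix c assume c: "c \<in> arrow_mats Q" "e' * c = c" "c * e = c"
  then obtain f where f: "f \<in> graded" "c = f * T - T' * f" using ex by blast
  note e = quiver_objectD[OF ob(1)] and e' = quiver_objectD[OF ob(2)]
  let ?g = "e' * (f * e)"
  have "c = e' * (c * e)" using c by simp
  also have "\<dots> = e' * (f * T) - e' * (T' * (f * e))"
    by (simp add: f(2) left_diff_distrib right_diff_distrib mult.assoc e)
  also have "\<dots> = ?g * T - T' * ?g"
    by (simp add: mult.assoc e e' e(3-5)[THEN mult_assoc_eq] e'(3-5)[THEN mult_assoc_eq])
  finally have "c = ?g * T - T' * ?g" .
  moreover have "?g \<in> graded" "e' * ?g = ?g" "?g * e = ?g"
    using f e e' by (simp_all add: mult.assoc e'(3)[THEN mult_assoc_eq])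
  ultimately show "\<exists>f\<in>graded. e' * f = f \<and> f * e = f \<and> c = f * T - T' * f" by blast
qed

text \<open>Right exactness of Ext^1 for quivers: vanishing passes to a subobject of the first and a
  quotient of the second argument. Accordingly \<open>j\<close> and \<open>p\<close> are morphisms,
  while the retraction \<open>r\<close> and the section \<open>s\<close> are merely linear.\<close>

lemma ext_vanishes_retract:
  assumes ob: "quiver_object Q e T" "quiver_object Q e' T'"
    and j: "j \<in> homs e T e1 T1" and r: "r \<in> graded" "r * e1 = r" "r * j = e"
    and p: "p \<in> homs e1' T1' e' T'" and s: "s \<in> graded" "e1' * s = s" "p * s = e'"
    and ext: "ext_vanishes Q e1 T1 e1' T1'"
  shows "ext_vanishes Q e T e' T'"
proof (rule ext_vanishesI[OF ob])
  fix c assume c: "c \<in> arrow_mats Q" "e' * c = c" "c * e = c"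
  note j = homsD[OF j] and p = homsD[OF p]
  have "s * (c * r) \<in> arrow_mats Q" "e1' * (s * (c * r)) = s * (c * r)" "s * (c * r) * e1 = s * (c * r)"
    using c r s by (simp_all add: mult.assoc s(2)[THEN mult_assoc_eq])
  then obtain f where f: "f \<in> graded" "s * (c * r) = f * T1 - T1' * f"
    using ext unfolding ext_vanishes_def by blast
  have "c = p * (s * (c * r)) * j"
    using c r s by (simp add: mult.assoc s(3)[THEN mult_assoc_eq] c(2)[THEN mult_assoc_eq])
  also have "\<dots> = (p * (f * j)) * T - T' * (p * (f * j))"
    by (simp add: f left_diff_distrib right_diff_distrib mult.assoc j(4)
        p(4)[THEN mult_assoc_eq])
  finally have "c = (p * (f * j)) * T - T' * (p * (f * j))" .
  then show "\<exists>f\<in>graded. c = f * T - T' * f" using f j p by blast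
qed

section \<open>Dimension counts for the two-term complex computing Hom and Ext^1\<close>

definition vertex_support :: "('i \<Rightarrow> nat) \<Rightarrow> ('i \<Rightarrow> nat) \<Rightarrow> (('i \<times> nat) \<times> ('i \<times> nat)) set" where
  "vertex_support d d' = {((j, r), (i, s)). i = j \<and> r < d' j \<and> s < d i}"

definition arrow_support :: "('i \<times> 'i) set \<Rightarrow> ('i \<Rightarrow> nat) \<Rightarrow> ('i \<Rightarrow> nat)
    \<Rightarrow> (('i \<times> nat) \<times> ('i \<times> nat)) set" where
  "arrow_support Q d d' = {((j, r), (i, s)). (i, j) \<in> Q \<and> r < d' j \<and> s < d i}"

lemma vertex_support_card:
  "finite (vertex_support d d')" "card (vertex_support d d') = (\<Sum>i\<in>UNIV. d i * d' (i :: 'i :: finite))"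
proof -
  let ?f = "\<lambda>(i, r, s). ((i :: 'i, r :: nat), (i, s :: nat))"
  let ?S = "SIGMA i:UNIV. {..<d' i} \<times> {..<d i}"
  have img: "vertex_support d d' = ?f ` ?S" by (force simp: vertex_support_def)
  have "inj_on ?f ?S" by (auto simp: inj_on_def)
  then have "card (vertex_support d d') = card ?S" unfolding img by (rule card_image)
  also have "\<dots> = (\<Sum>i\<in>UNIV. d i * d' i)"
    by (subst card_SigmaI) (auto simp: card_cartesian_product mult.commute)
  finally show "card (vertex_support d d') = (\<Sum>i\<in>UNIV. d i * d' i)" .
  show "finite (vertex_support d d')" unfolding img by auto
qed

lemma arrow_support_card:
  "finite (arrow_support Q d d')"
  "card (arrow_support Q d d') = (\<Sum>(i, j)\<in>(Q :: ('i :: finite \<times> 'i) set). d i * d' j)"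
proof -
  let ?f = "\<lambda>((i, j), r, s). ((j :: 'i, r :: nat), (i :: 'i, s :: nat))"
  let ?S = "SIGMA a:Q. {..<d' (snd a)} \<times> {..<d (fst a)}"
  have img: "arrow_support Q d d' = ?f ` ?S" by (force simp: arrow_support_def)
  have fin: "finite Q" by simp
  have "inj_on ?f ?S" by (auto simp: inj_on_def)
  then have "card (arrow_support Q d d') = card ?S" unfolding img by (rule card_image)
  also have "\<dots> = (\<Sum>(i, j)\<in>Q. d i * d' j)"
    using fin by (subst card_SigmaI) (auto simp: card_cartesian_product mult.commute split_def)
  finally show "card (arrow_support Q d d') = (\<Sum>(i, j)\<in>Q. d i * d' j)" .
  show "finite (arrow_support Q d d')" unfolding img using fin by auto
qed

lemma supported_vertex_support:
  "supported (vertex_support d d') = {f \<in> graded. iden d' * f = f \<and> f * iden d = f}"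
  unfolding iden_mult_eq_iff mult_iden_eq_iff
  by (force simp: supported_def graded_def vertex_support_def)

lemma supported_arrow_support:
  "supported (arrow_support Q d d') = {c \<in> arrow_mats Q. iden d' * c = c \<and> c * iden d = c}"
  unfolding iden_mult_eq_iff mult_iden_eq_iff
  by (force simp: supported_def arrow_mats_def arrow_support_def)

lemma euler_form_eq_card:
  fixes Q :: "('i :: finite \<times> 'i) set"
  shows "euler_form Q (\<lambda>i. int (d i)) (\<lambda>i. int (d' i))
    = int (card (vertex_support d d')) - int (card (arrow_support Q d d'))"
  by (simp add: euler_form_def vertex_support_card arrow_support_card split_def)

lemma linear_coboundary: "Vector_Spaces.linear scl scl (\<lambda>f. f * T - T' * f)"
  by (rule linear_fmatI) (simp_all add: algebra_simps fm.scale_right_diff_distrib)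

lemma coboundary_image:
  assumes ob: "quiver_object Q (iden d) T" "quiver_object Q (iden d') T'"
  shows "(\<lambda>f. f * T - T' * f) ` supported (vertex_support d d') \<subseteq> supported (arrow_support Q d d')"
  unfolding supported_vertex_support supported_arrow_support
proof (rule image_subsetI)
  fix f assume "f \<in> {f \<in> graded. iden d' * f = f \<and> f * iden d = f}"
  then have f: "f \<in> graded" "iden d' * f = f" "f * iden d = f" by auto
  note T = quiver_objectD[OF ob(1)] and T' = quiver_objectD[OF ob(2)]
  show "f * T - T' * f \<in> {c \<in> arrow_mats Q. iden d' * c = c \<and> c * iden d = c}"
    using f T T' by (simp add: left_diff_distrib right_diff_distrib mult.assoc
        f(2)[THEN mult_assoc_eq] T'(4)[THEN mult_assoc_eq])
qed

lemma ext_vanishes_iff_surj: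
  assumes ob: "quiver_object Q (iden d) T" "quiver_object Q (iden d') T'"
  shows "ext_vanishes Q (iden d) T (iden d') T' \<longleftrightarrow>
    (\<lambda>f. f * T - T' * f) ` supported (vertex_support d d') = supported (arrow_support Q d d')"
    (is "?E \<longleftrightarrow> ?I = _")
proof -
  have "?E \<longleftrightarrow> supported (arrow_support Q d d') \<subseteq> ?I"
    unfolding ext_vanishes_def supported_vertex_support supported_arrow_support by blast
  then show ?thesis using coboundary_image[OF ob] by blast
qed

lemma coboundary_kernel:
  "{f \<in> supported (vertex_support d d'). f * T - T' * f = 0} = homs (iden d) T (iden d') T'"
  unfolding supported_vertex_support homs_def by auto

text \<open>If the coboundary map is onto, the Euler form is the dimension of its kernel Hom; a
  nonzero homomorphism would make the dimension of the image drop strictly.\<close>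

lemma euler_form_nonneg_if_ext_vanishes:
  fixes Q :: "('i :: finite \<times> 'i) set"
  assumes ob: "quiver_object Q (iden d) T" "quiver_object Q (iden d') T'"
    and ext: "ext_vanishes Q (iden d) T (iden d') T'"
  shows "euler_form Q (\<lambda>i. int (d i)) (\<lambda>i. int (d' i)) \<ge> 0"
    and "euler_form Q (\<lambda>i. int (d i)) (\<lambda>i. int (d' i)) = 0 \<Longrightarrow> homs (iden d) T (iden d') T' = {0}"
proof -
  let ?L = "\<lambda>f. f * T - T' * f"
  have im: "?L ` supported (vertex_support d d') = supported (arrow_support Q d d')"
    using ext ext_vanishes_iff_surj[OF ob] by simp
  obtain F where F: "finite F" "supported (vertex_support d d') \<subseteq> fm.span F"
    using finite_dim_supported vertex_support_card(1) by metis
  have dims: "fm.dim (supported (vertex_support d d')) = card (vertex_support d d')"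
      "fm.dim (supported (arrow_support Q d d')) = card (arrow_support Q d d')"
    by (simp_all add: dim_supported vertex_support_card(1) arrow_support_card(1))
  show "euler_form Q (\<lambda>i. int (d i)) (\<lambda>i. int (d' i)) \<ge> 0"
    using fm.dim_image_le_in_span[OF linear_coboundary[of T T'] F(2,1)]
    unfolding im dims euler_form_eq_card by simp
  assume "euler_form Q (\<lambda>i. int (d i)) (\<lambda>i. int (d' i)) = 0"
  then have eq: "card (vertex_support d d') = card (arrow_support Q d d')"
    unfolding euler_form_eq_card by simp
  have "f = 0" if "f \<in> homs (iden d) T (iden d') T'" for f
  proof (rule ccontr)
    assume "f \<noteq> 0"
    moreover have "f \<in> supported (vertex_support d d')" "?L f = 0"
      using that unfolding coboundary_kernel[symmetric] by auto
    ultimately show False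
      using fm.dim_image_less[OF linear_coboundary[of T T'] subspace_supported F(2,1)]
      unfolding im dims eq by blast
  qed
  then show "homs (iden d) T (iden d') T' = {0}" by (auto simp: homs_def)
qed

text \<open>The kernel of the coboundary map is at most a line, so E = dim Hom - dim Ext^1 is at
  most 1. Equality forces the image to have full dimension.\<close>

lemma brick_euler_form_le_1:
  fixes Q :: "('i :: finite \<times> 'i) set"
  assumes ob: "quiver_object Q (iden d) T" and brick: "brick (iden d) T"
  shows "euler_form Q (\<lambda>i. int (d i)) (\<lambda>i. int (d i)) \<le> 1"
    and "euler_form Q (\<lambda>i. int (d i)) (\<lambda>i. int (d i)) = 1 \<Longrightarrow> ext_vanishes Q (iden d) T (iden d) T"
proof -
  let ?L = "\<lambda>f. f * T - T * f"
  let ?I = "?L ` supported (vertex_support d d)"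
  obtain F where F: "finite F" "supported (vertex_support d d) \<subseteq> fm.span F"
    using finite_dim_supported vertex_support_card(1) by metis
  obtain G where G: "finite G" "supported (arrow_support Q d d) \<subseteq> fm.span G"
    using finite_dim_supported arrow_support_card(1) by metis
  have dims: "fm.dim (supported (vertex_support d d)) = card (vertex_support d d)"
      "fm.dim (supported (arrow_support Q d d)) = card (arrow_support Q d d)"
    by (simp_all add: dim_supported vertex_support_card(1) arrow_support_card(1))
  have "homs (iden d) T (iden d) T \<subseteq> fm.span {iden d}"
    using brick unfolding brick_def fm.span_singleton by blast
  then have "fm.dim (homs (iden d) T (iden d) T) \<le> 1"
    using fm.dim_le_card[of _ "{iden d}"] by simp
  then have 1: "card (vertex_support d d) \<le> 1 + fm.dim ?I"
    using fm.dim_le_kernel_plus_image[OF linear_coboundary[of T T] subspace_supported F(2,1)]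
    unfolding coboundary_kernel dims by linarith
  have sub: "?I \<subseteq> supported (arrow_support Q d d)" by (rule coboundary_image[OF ob ob])
  have 2: "fm.dim ?I \<le> card (arrow_support Q d d)"
    using fm.dim_mono_in_span[OF sub G(2,1)] dims by simp
  show "euler_form Q (\<lambda>i. int (d i)) (\<lambda>i. int (d i)) \<le> 1"
    using 1 2 unfolding euler_form_eq_card by simp
  assume "euler_form Q (\<lambda>i. int (d i)) (\<lambda>i. int (d i)) = 1"
  then have "\<not> fm.dim ?I < card (arrow_support Q d d)"
    using 1 unfolding euler_form_eq_card by simp
  moreover interpret L: Vector_Spaces.linear scl scl ?L by (rule linear_coboundary)
  have "fm.subspace ?I" by (rule L.subspace_image[OF subspace_supported])
  ultimately have "?I = supported (arrow_support Q d d)"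
    using fm.dim_psubset_in_span[OF _ _ G(2,1), of ?I] sub dims by auto
  then show "ext_vanishes Q (iden d) T (iden d) T"
    using ext_vanishes_iff_surj[OF ob ob] by simp
qed

section \<open>Indecomposable objects are bricks\<close>

text \<open>All endomorphisms of the graded vector space \<open>e\<close>, whether or not they
  commute with the arrows. Its dimension is the measure in the inductions below.\<close>

definition corner :: "('i \<times> nat) fmat \<Rightarrow> ('i \<times> nat) fmat set" where
  "corner e = {a \<in> graded. e * a = a \<and> a * e = a}"

lemma subspace_corner: "fm.subspace (corner e)"
  unfolding fm.subspace_def corner_def by (auto simp: distrib_left distrib_right)

lemma finite_dim_corner:
  obtains F where "finite F" "corner (e :: ('i::finite \<times> nat) fmat) \<subseteq> fm.span F"
proof -
  let ?S = "{(x, y). entry e x y \<noteq> 0}"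
  have "corner e \<subseteq> supported (fst ` ?S \<times> snd ` ?S)"
  proof
    fix a assume a: "a \<in> corner e"
    have "x \<in> fst ` ?S \<and> y \<in> snd ` ?S" if nz: "entry a x y \<noteq> 0" for x y
    proof -
      have "x \<in> fst ` ?S"
      proof (rule ccontr)
        assume "x \<notin> fst ` ?S"
        then have "(x, u) \<notin> ?S" for u by (metis fst_conv image_eqI)
        then have "entry e x u = 0" for u by simp
        then have "entry (e * a) x y = 0" by (simp add: entry_mult_row)
        then show False using a nz by (simp add: corner_def)
      qed
      moreover have "y \<in> snd ` ?S"
      proof (rule ccontr)
        assume "y \<notin> snd ` ?S"
        then have "(u, y) \<notin> ?S" for u by (metis snd_conv image_eqI)
        then have "entry e u y = 0" for u by simp
        then have "entry (a * e) x y = 0" by (simp add: entry_mult_col)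
        then show False using a nz by (simp add: corner_def)
      qed
      ultimately show ?thesis by blast
    qed
    then show "a \<in> supported (fst ` ?S \<times> snd ` ?S)" by (simp add: supported_def)
  qed
  moreover have "finite (fst ` ?S \<times> snd ` ?S)" using finite_support[of e] by blast
  then obtain F where "finite F" "supported (fst ` ?S \<times> snd ` ?S) \<subseteq> fm.span F"
    by (rule finite_dim_supported)
  ultimately show ?thesis using that by blast
qed

text \<open>For a proper subidempotent \<open>p\<close>, the element \<open>e\<close> lies in the
  larger corner but not in the smaller one.\<close>

lemma dim_corner_less:
  fixes e :: "('i::finite \<times> nat) fmat"
  assumes "e \<in> graded" "e * e = e" "e * p = p" "p * e = p" "p \<noteq> e"
  shows "fm.dim (corner p) < fm.dim (corner e)"
proof -
  obtain F where F: "finite F" "corner e \<subseteq> fm.span F" by (rule finite_dim_corner)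
  have "corner p \<subseteq> corner e"
    unfolding corner_def using assms(3,4) by (auto, metis mult.assoc, metis mult.assoc)
  moreover have "e \<in> corner e" "e \<notin> corner p" using assms by (auto simp: corner_def)
  ultimately have "corner p \<subset> corner e" by blast
  then show ?thesis by (rule fm.dim_psubset_in_span[OF subspace_corner _ F(2,1)])
qed

lemma linear_mult_left: "Vector_Spaces.linear scl scl (\<lambda>x. g * x)"
  by (rule linear_fmatI) (simp_all add: distrib_left)

lemma linear_mult_right: "Vector_Spaces.linear scl scl (\<lambda>x. x * g)"
  by (rule linear_fmatI) (simp_all add: distrib_right)

text \<open>Left multiplication by \<open>g\<close> is injective on a finite-dimensional space,
  hence onto, so \<open>e = g * x\<close> for some \<open>x\<close>; this \<open>x\<close> has to be
  \<open>w\<close>.\<close>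

lemma corner_left_inverse_is_right_inverse:
  fixes e :: "('i::finite \<times> nat) fmat"
  assumes e: "e \<in> graded" "e * e = e" and g: "g \<in> corner e" and w: "w \<in> corner e" and "w * g = e"
  shows "g * w = e"
proof -
  obtain F where F: "finite F" "corner e \<subseteq> fm.span F" by (rule finite_dim_corner)
  let ?I = "(\<lambda>x. g * x) ` corner e"
  have sub: "?I \<subseteq> corner e"
    using g by (auto simp: corner_def mult.assoc) (metis mult.assoc)
  have "(\<lambda>x. w * x) ` ?I = corner e"
    using \<open>w * g = e\<close> by (auto simp: image_image corner_def mult.assoc[symmetric])
  then have "fm.dim (corner e) \<le> fm.dim ?I"
    using fm.dim_image_le_in_span[OF linear_mult_left[of w], of ?I F] sub F by auto
  moreover interpret L: Vector_Spaces.linear scl scl "\<lambda>x. g * x" by (rule linear_mult_left)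
  have "fm.subspace ?I" by (rule L.subspace_image[OF subspace_corner])
  ultimately have "?I = corner e"
    using fm.dim_psubset_in_span[OF _ _ F(2,1), of ?I] sub by fastforce
  moreover have "e \<in> corner e" using e by (simp add: corner_def)
  ultimately obtain x where x: "x \<in> corner e" "e = g * x" by blast
  have "w = w * e" using w by (simp add: corner_def)
  also have "\<dots> = w * g * x" using x by (simp add: mult.assoc)
  also have "\<dots> = x" using \<open>w * g = e\<close> x by (simp add: corner_def)
  finally show ?thesis using x by simp
qed

text \<open>Dimension vectors and the counts above are available only for objects on
  \<open>iden d\<close>; every object is isomorphic to one of these.\<close>

lemma coordinate_object:
  fixes e :: "('i::finite \<times> nat) fmat"
  assumes "quiver_object Q e T"
  obtains d T' B C where "quiver_object Q (iden d) T'" "B \<in> homs (iden d) T' e T"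
    "C \<in> homs e T (iden d) T'" "B * C = e" "C * B = iden d"
proof -
  note e = quiver_objectD[OF assms]
  obtain d B C where
    g: "B \<in> graded" "C \<in> graded" and r: "B * C = e" "C * B = iden d"
    "e * B = B" "C * e = C" "B * iden d = B" "iden d * C = C"
    by (rule graded_idempotent_factorization[OF e(1,3)])
  let ?T = "C * (T * B)"
  note rw = mult.assoc r r[THEN mult_assoc_eq] e(3-5) e(3-5)[THEN mult_assoc_eq]
  have "quiver_object Q (iden d) ?T" by (simp add: quiver_object_def g e(1,2) rw)
  moreover have "B \<in> homs (iden d) ?T e T" by (simp add: homs_def g rw)
  moreover have "C \<in> homs e T (iden d) ?T" by (simp add: homs_def g rw)
  ultimately show ?thesis using r(1,2) by (rule that)
qed

text \<open>At a vertex where the image of \<open>e\<close> is nonzero, the block of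
  \<open>f\<close> in a basis of that image is a complex square matrix of positive size and has an
  eigenvalue.\<close>

lemma graded_eigenvector:
  fixes e :: "('i::finite \<times> nat) fmat"
  assumes e: "e \<in> graded" "e * e = e" "e \<noteq> 0" and f: "f \<in> corner e"
  shows "\<exists>c. \<exists>a\<in>graded. a \<noteq> 0 \<and> e * a = a \<and> f * a = scl c a"
proof -
  obtain d B C where
    g: "B \<in> graded" "C \<in> graded" and r: "B * C = e" "C * B = iden d"
    "e * B = B" "C * e = C" "B * iden d = B" "iden d * C = C"
    by (rule graded_idempotent_factorization[OF e(1,2)])
  have "iden d \<noteq> 0" using r e(3) by (metis mult_zero_left mult_zero_right)
  then obtain x where x: "entry (iden d) x x \<noteq> 0" by (metis entry_0 entry_iden fmat_eqI)
  define i where "i = fst x"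
  define n where "n = d i"
  have n: "n > 0" using x by (auto simp: n_def i_def split: if_splits)
  let ?h = "C * (f * B)"
  have hg: "?h \<in> graded" using f g by (auto simp: corner_def)
  define F where "F = mat n n (\<lambda>(r, s). entry ?h (i, r) (i, s))"
  have F: "F \<in> carrier_mat n n" by (simp add: F_def)
  have "\<not> constant (poly (char_poly F))"
    using degree_monic_char_poly[OF F] n by (simp add: constant_degree)
  then obtain c where "poly (char_poly F) c = 0" using fundamental_theorem_of_algebra by blast
  then have "eigenvalue F c" using eigenvalue_root_char_poly[OF F] by simp
  then obtain v where v: "v \<in> carrier_vec n" "v \<noteq> 0\<^sub>v n" "F *\<^sub>v v = c \<cdot>\<^sub>v v"
    using F by (auto simp: eigenvalue_def eigenvector_def)
  \<comment> \<open>The eigenvector is stored as column \<open>(i, 0)\<close> of an otherwise zero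
    matrix, so that it lives in the same ring.\<close>
  define V where "V = (\<Sum>r<n. scl (v $ r) (munit (i, r) (i, 0)))"
  have Vg: "V \<in> graded" unfolding V_def by (intro graded_sum graded_closed munit_graded) simp
  have V_entry: "entry V x y = (if fst x = i \<and> snd x < n \<and> y = (i, 0) then v $ snd x else 0)" for x y
  proof -
    have "entry V x y = (\<Sum>r<n. if r = snd x then (if fst x = i \<and> y = (i, 0) then v $ snd x else 0) else 0)"
      unfolding V_def entry_sum by (rule sum.cong) (auto simp: prod_eq_iff)
    then show ?thesis by auto
  qed
  have hV: "?h * V = scl c V"
  proof (rule fmat_eqI)
    fix x y
    have sum: "entry (?h * V) x y = (\<Sum>r<n. entry ?h x (i, r) * entry V (i, r) y)"
      by (subst entry_mult_right[of "Pair i ` {..<n}"])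
        (auto simp: V_entry sum.reindex inj_on_def prod_eq_iff split: if_splits)
    show "entry (?h * V) x y = entry (scl c V) x y"
    proof (cases "y = (i, 0) \<and> fst x = i \<and> snd x < n")
      case True
      then have "entry (?h * V) x y = (F *\<^sub>v v) $ snd x"
        using v(1) unfolding sum
        by (cases x) (simp add: V_entry F_def scalar_prod_def lessThan_atLeast0)
      then show ?thesis using True v by (simp add: V_entry)
    next
      case False
      have "entry ?h x (i, r) * entry V (i, r) y = 0" if "r < n" for r
      proof (cases "fst x = i")
        case True
        have "iden d * ?h = ?h" using r by (simp add: mult.assoc[symmetric])
        then have "entry ?h x (i, r) = 0 \<or> snd x < d (fst x)" unfolding iden_mult_eq_iff by blast
        then show ?thesis using False True by (auto simp: V_entry n_def)
      next
        case False
        then have "entry ?h x (i, r) = 0" using hg unfolding graded_def supported_def by fastforce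
        then show ?thesis by simp
      qed
      then have "entry (?h * V) x y = 0" unfolding sum by (intro sum.neutral) simp
      then show ?thesis using False by (auto simp: V_entry)
    qed
  qed
  have CBV: "C * (B * V) = V"
    using r(2) V_entry iden_mult_eq_iff[of d V] by (simp add: mult.assoc[symmetric] n_def)
  have "V \<noteq> 0"
  proof
    assume "V = 0"
    then have "v $ r = 0" if "r < n" for r using V_entry[of "(i, r)" "(i, 0)"] that by simp
    then have "v = 0\<^sub>v n" using v(1) by (intro eq_vecI) auto
    then show False using v(2) by simp
  qed
  then have "B * V \<noteq> 0" using CBV by auto
  moreover have "f * (B * V) = scl c (B * V)"
  proof -
    have "f * (B * V) = e * (f * (B * V))"
      using f by (simp add: corner_def mult.assoc[symmetric])
    also have "\<dots> = B * (?h * V)" by (simp add: r(1)[symmetric] mult.assoc)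
    finally show ?thesis by (simp add: hV)
  qed
  moreover have "e * (B * V) = B * V" by (simp add: mult.assoc[symmetric] r)
  ultimately show ?thesis using g Vg by blast
qed

lemma iden_eq_0_iff: "iden d = 0 \<longleftrightarrow> d = (\<lambda>_. 0)"
proof
  assume 0: "iden d = 0"
  have "d i = 0" for i using arg_cong[OF 0, of "\<lambda>A. entry A (i, 0) (i, 0)"] by (simp split: if_splits)
  then show "d = (\<lambda>_. 0)" by blast
qed (auto intro: fmat_eqI)

text \<open>All that the theory of quivers takes from the Dynkin diagram is positivity on nonzero
  dimension vectors.\<close>

locale definite_quiver =
  fixes Q :: "('i::finite \<times> 'i) set"
  assumes euler_form_pos: "d \<noteq> (\<lambda>_. 0) \<Longrightarrow> euler_form Q (\<lambda>i. int (d i)) (\<lambda>i. int (d i)) > 0"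
begin

lemma brick_euler_form:
  assumes "quiver_object Q (iden d) T" "brick (iden d) T"
  shows "euler_form Q (\<lambda>i. int (d i)) (\<lambda>i. int (d i)) = 1"
proof -
  have "d \<noteq> (\<lambda>_. 0)" using assms(2) iden_eq_0_iff by (auto simp: brick_def)
  then show ?thesis using euler_form_pos[of d] brick_euler_form_le_1(1)[OF assms] by simp
qed

text \<open>The object is transported to coordinate spaces, where the Euler form of a brick is 1,
  and the vanishing is carried back along the isomorphism \<open>B\<close>,
  \<open>C\<close>.\<close>

lemma ext_vanishes_brick:
  assumes ob: "quiver_object Q e T" and brick: "brick e T"
  shows "ext_vanishes Q e T e T"
proof -
  obtain d T' B C where ob': "quiver_object Q (iden d) T'" and
    hom: "B \<in> homs (iden d) T' e T" "C \<in> homs e T (iden d) T'" and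
    BC: "B * C = e" and CB: "C * B = iden d"
    by (rule coordinate_object[OF ob])
  note B = homsD[OF hom(1)] and C = homsD[OF hom(2)]
  have "brick (iden d) T'"
    unfolding brick_def
  proof (intro conjI ballI)
    show "iden d \<noteq> 0"
    proof
      assume "iden d = 0"
      then have "B = 0" using B(3) by simp
      then show False using BC brick by (simp add: brick_def)
    qed
    fix g assume g: "g \<in> homs (iden d) T' (iden d) T'"
    have "B * g * C \<in> homs e T e T" using homs_comp[OF hom(2) homs_comp[OF g hom(1)]] .
    then obtain c where c: "B * g * C = scl c e" using brick by (auto simp: brick_def)
    have "g = iden d * g * iden d" using homsD[OF g] by simp
    also have "\<dots> = C * (B * g * C) * B" unfolding CB[symmetric] by (simp only: mult.assoc)
    also have "\<dots> = scl c (C * e * B)" by (simp add: c)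
    also have "C * e * B = iden d" by (simp add: C CB)
    finally show "\<exists>c. g = scl c (iden d)" by blast
  qed
  then have "ext_vanishes Q (iden d) T' (iden d) T'"
    using brick_euler_form_le_1(2)[OF ob'] brick_euler_form[OF ob'] by blast
  then show ?thesis
    by (rule ext_vanishes_retract[OF ob ob hom(2) B(1,3) BC hom(1) C(1,2) BC])
qed

text \<open>Ringel's argument. Choose a nonzero, noninvertible endomorphism \<open>\<theta>\<close> that generates a minimal left
  ideal. Then \<open>\<theta>\<^sup>2 = 0\<close>, so its image \<open>I\<close> lies in its kernel \<open>K\<close>; some indecomposable summand of
  \<open>K\<close> contains a copy of \<open>I\<close>, has no self-extensions by induction, and is hence a summand of the
  whole object.\<close>

theorem no_idempotents_imp_brick:
  assumes "quiver_object Q e T" "no_idempotents e T"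
  shows "brick e T"
  using assms
proof (induction "fm.dim (corner e)" arbitrary: e T rule: less_induct)
  case less
  note ob = less.prems(1)
  note e = quiver_objectD[OF ob]
  have e0: "e \<noteq> 0" using less.prems(2) by (simp add: no_idempotents_def)
  have idem: "p = 0 \<or> p = e" if "p \<in> homs e T e T" "p * p = p" for p
    using less.prems(2) that by (simp add: no_idempotents_def)
  show ?case
  proof (rule ccontr)
    assume "\<not> brick e T"
    then obtain f where f: "f \<in> homs e T e T" "\<And>c. f \<noteq> scl c e" using e0 by (auto simp: brick_def)
    have "f \<in> corner e" using f by (auto simp: corner_def homs_def)
    then obtain c a where a: "a \<in> graded" "a \<noteq> 0" "e * a = a" "f * a = scl c a"
      using graded_eigenvector[OF e(1,3) e0] by blast
    \<comment> \<open>Subtracting an eigenvalue makes the nonscalar endomorphism \<open>f\<close>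
      noninvertible without making it zero: \<open>th0\<close> kills \<open>a\<close>.\<close>
    define th0 where "th0 = f - scl c e"
    have th0: "th0 \<in> homs e T e T" "th0 \<noteq> 0" "th0 * a = 0"
      using f(1) f(2)[of c] e a unfolding th0_def homs_def
      by (auto simp: left_diff_distrib right_diff_distrib)
    \<comment> \<open>The multipliers range over all graded linear maps, not only over
      endomorphisms. The dimension of this left ideal is a weighted sum of the vertexwise ranks of
      \<open>th\<close>.\<close>
    define ideal where "ideal = (\<lambda>th. (\<lambda>b. b * th) ` corner e)"
    obtain F where F: "finite F" "corner e \<subseteq> fm.span F" by (rule finite_dim_corner)
    have e_corner: "e \<in> corner e" using e by (simp add: corner_def)
    have ideal_sub: "ideal th \<subseteq> corner e" if "th \<in> homs e T e T" for th
      using homsD[OF that] by (auto simp: ideal_def corner_def mult.assoc) (metis mult.assoc)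
    have ideal_subspace: "fm.subspace (ideal th)" for th
    proof -
      interpret L: Vector_Spaces.linear scl scl "\<lambda>x. x * th" by (rule linear_mult_right)
      show ?thesis unfolding ideal_def by (rule L.subspace_image[OF subspace_corner])
    qed
    define th where "th = (ARG_MIN (\<lambda>th. fm.dim (ideal th)) th. th \<in> homs e T e T \<and> th \<noteq> 0)"
    have th: "th \<in> homs e T e T" "th \<noteq> 0"
      and th_min: "\<And>x. x \<in> homs e T e T \<Longrightarrow> x \<noteq> 0 \<Longrightarrow> fm.dim (ideal th) \<le> fm.dim (ideal x)"
      using arg_min_nat_lemma[of "\<lambda>th. th \<in> homs e T e T \<and> th \<noteq> 0" th0 "\<lambda>th. fm.dim (ideal th)"] th0
      unfolding th_def[symmetric] by auto
    have th_min': "th \<in> ideal x" if x: "x \<in> homs e T e T" "x \<noteq> 0" "x \<in> ideal th" for x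
    proof -
      have "ideal x \<subseteq> ideal th"
      proof
        fix y assume "y \<in> ideal x"
        then obtain b b' where b: "y = b * x" "b \<in> corner e" "x = b' * th" "b' \<in> corner e"
          using x(3) by (auto simp: ideal_def)
        then have "b * b' \<in> corner e" by (auto simp: corner_def mult.assoc) (metis mult.assoc)
        then show "y \<in> ideal th" using b unfolding ideal_def by (auto simp: mult.assoc[symmetric])
      qed
      moreover have "\<not> fm.dim (ideal x) < fm.dim (ideal th)" using th_min[OF x(1,2)] by simp
      ultimately have "ideal x = ideal th"
        using fm.dim_psubset_in_span[OF ideal_subspace, of x "ideal th" F] F ideal_sub[OF th(1)] by blast
      moreover have "th \<in> ideal th"
        unfolding ideal_def using e_corner homsD(2)[OF th(1)] by (metis image_eqI)
      ultimately show ?thesis by simp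
    qed
    \<comment> \<open>If \<open>e\<close> were in the ideal, minimality would make the ideal of
      \<open>th0\<close> all of \<open>corner e\<close>, so that \<open>th0\<close> would have a
      left inverse, although it kills \<open>a\<close>.\<close>
    have e_notin: "e \<notin> ideal th"
    proof
      assume "e \<in> ideal th"
      then have "corner e \<subseteq> ideal th"
        unfolding ideal_def
        by (auto simp: corner_def image_iff) (metis e(3) graded_mult mult.assoc)
      then have "fm.dim (corner e) \<le> fm.dim (ideal th)"
        using fm.dim_mono_in_span[of _ "ideal th" F] F ideal_sub[OF th(1)] by blast
      also have "\<dots> \<le> fm.dim (ideal th0)" by (rule th_min[OF th0(1,2)])
      finally have "\<not> ideal th0 \<subset> corner e"
        using fm.dim_psubset_in_span[OF ideal_subspace _ F(2,1), of th0] by auto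
      then have "e \<in> ideal th0" using ideal_sub[OF th0(1)] e_corner by blast
      then obtain b where "e = b * th0" by (auto simp: ideal_def)
      then have "a = b * (th0 * a)" using a(3) by (simp add: mult.assoc[symmetric])
      then show False using th0(3) a(2) by simp
    qed
    obtain d B B1 C C1 where
      g: "B \<in> graded" "B1 \<in> graded" "C \<in> graded" "C1 \<in> graded" and
      th_eq: "th = B * C" and B1: "B1 * B = iden d" and C1: "C * C1 = iden d" and
      idens: "B * iden d = B" "iden d * C = C" "iden d * B1 = B1" "C1 * iden d = C1"
      using graded_rank_factorization[OF homsD(1)[OF th(1)]] by blast
    note thD = homsD[OF th(1)]
    have eB: "e * B = B"
    proof -
      have "e * B = e * th * C1" by (simp add: th_eq mult.assoc C1 idens)
      then show ?thesis unfolding thD by (simp add: th_eq mult.assoc C1 idens)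
    qed
    have Ce: "C * e = C"
    proof -
      have "C * e = B1 * (th * e)" by (simp add: th_eq mult.assoc B1[THEN mult_assoc_eq] idens(2)[THEN mult_assoc_eq])
      then show ?thesis unfolding thD by (simp add: th_eq mult.assoc[symmetric] B1 idens)
    qed
    define B' where "B' = B1 * e"
    define C' where "C' = e * C1"
    have g': "B' \<in> graded" "C' \<in> graded" using g e by (simp_all add: B'_def C'_def)
    have B'B: "B' * B = iden d" by (simp add: B'_def mult.assoc eB B1)
    have CC': "C * C' = iden d" by (simp add: C'_def mult.assoc[symmetric] Ce C1)
    have idens': "iden d * B' = B'" "C' * iden d = C'" "B' * e = B'" "e * C' = C'"
      unfolding B'_def C'_def
      by (simp_all add: mult.assoc idens e(3) idens(3)[THEN mult_assoc_eq] e(3)[THEN mult_assoc_eq])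
    note idens = idens(1,2) idens' idens(1,2)[THEN mult_assoc_eq] idens'[THEN mult_assoc_eq]
    \<comment> \<open>The arrows of the image \<open>I\<close> of \<open>th\<close>:
      \<open>B\<close> embeds \<open>I\<close> into the object, and \<open>C\<close> maps the object
      onto it.\<close>
    define TI where "TI = B' * (T * B)"
    have CT: "C * T = TI * C"
    proof -
      have "C * T = B' * (th * T)" by (simp add: th_eq mult.assoc B'B[THEN mult_assoc_eq] idens)
      also have "\<dots> = B' * (T * th)" by (simp only: thD)
      finally show ?thesis by (simp add: th_eq TI_def mult.assoc)
    qed
    have BT: "B * TI = T * B"
    proof -
      have TB: "T * B = B * (C * (T * C'))"
      proof -
        have "T * B = T * th * C'" by (simp add: th_eq mult.assoc CC' idens)
        also have "\<dots> = th * T * C'" by (simp only: thD)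
        finally show ?thesis by (simp add: th_eq mult.assoc)
      qed
      have "B * TI = B * (B' * (B * (C * (T * C'))))" by (simp only: TI_def TB)
      also have "\<dots> = B * (C * (T * C'))" by (simp add: B'B[THEN mult_assoc_eq] idens)
      finally show ?thesis by (simp only: TB)
    qed
    have obI: "quiver_object Q (iden d) TI"
      unfolding quiver_object_def TI_def using g g' e by (simp add: mult.assoc idens)
    have ideal_B: "B * x * C \<in> ideal th" if "x \<in> graded" for x
    proof -
      have "B * x * B' \<in> corner e"
        using that g g' by (simp add: corner_def mult.assoc idens eB[THEN mult_assoc_eq])
      moreover have "B * x * C = (B * x * B') * th"
        by (simp add: th_eq mult.assoc B'B[THEN mult_assoc_eq] idens)
      ultimately show ?thesis by (auto simp: ideal_def)
    qed
    \<comment> \<open>This says that \<open>th\<close> squares to zero, as \<open>C * B\<close> is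
      the restriction of \<open>th\<close> to \<open>I\<close>. Otherwise minimality makes this
      restriction invertible, and with its inverse \<open>w\<close> the product
      \<open>B * w * C\<close> is an idempotent endomorphism with image \<open>I\<close>; it is
      nonzero and lies in the ideal, which does not contain \<open>e\<close>.\<close>
    have CB: "C * B = 0"
    proof (rule ccontr)
      assume nz: "C * B \<noteq> 0"
      have "B' * (th * th) * C' = C * B"
        by (simp add: th_eq mult.assoc B'B[THEN mult_assoc_eq] CC' idens)
      then have "th * th \<noteq> 0" using nz by auto
      moreover have "th * th \<in> homs e T e T" by (rule homs_comp[OF th(1) th(1)])
      moreover have "th * th \<in> ideal th" using thD by (auto simp: ideal_def corner_def)
      ultimately have "th \<in> ideal (th * th)" by (intro th_min')
      then obtain b where b: "b \<in> corner e" "th = b * (th * th)" by (auto simp: ideal_def)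
      define w where "w = B' * (b * B)"
      have bg: "b \<in> graded" using b by (simp add: corner_def)
      have "iden d = B' * th * C'" by (simp add: th_eq mult.assoc B'B[THEN mult_assoc_eq] CC' idens)
      also have "\<dots> = B' * (b * (th * th)) * C'" by (simp only: b(2)[symmetric])
      also have "\<dots> = w * (C * B)" by (simp add: th_eq w_def mult.assoc CC' idens)
      finally have wl: "w * (C * B) = iden d" by simp
      have w: "w \<in> corner (iden d)" "C * B \<in> corner (iden d)"
        using g g' bg by (simp_all add: corner_def w_def mult.assoc idens)
      have wr: "C * B * w = iden d"
        by (rule corner_left_inverse_is_right_inverse[OF iden_graded iden_mult_iden w(2,1) wl])
      have CBT: "C * B * TI = TI * (C * B)"
        by (simp add: mult.assoc BT CT[THEN mult_assoc_eq])
      have "w * TI = w * TI * (C * B * w)"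
        by (simp only: wr) (simp add: mult.assoc quiver_objectD(5)[OF obI])
      also have "\<dots> = w * (TI * (C * B)) * w" by (simp only: mult.assoc)
      also have "\<dots> = w * (C * B) * TI * w" by (simp only: CBT[symmetric] mult.assoc)
      also have "\<dots> = TI * w" using obI by (simp add: wl quiver_object_def)
      finally have wT: "w * TI = TI * w" .
      let ?p = "B * w * C"
      have "?p \<in> homs e T e T"
      proof (rule homsI)
        show "?p \<in> graded" using g w by (simp add: corner_def)
        show "e * ?p = ?p" "?p * e = ?p" by (simp_all add: mult.assoc[symmetric] eB) (simp add: mult.assoc Ce)
        have "?p * T = B * (w * TI) * C" by (simp add: mult.assoc CT)
        also have "\<dots> = T * ?p" by (simp add: wT mult.assoc[symmetric] BT)
        finally show "?p * T = T * ?p" .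
      qed
      moreover have "?p * ?p = ?p"
      proof -
        have "?p * ?p = B * (w * (C * B)) * w * C" by (simp only: mult.assoc)
        then show ?thesis by (simp add: wl mult.assoc idens)
      qed
      moreover have "?p \<noteq> 0"
      proof
        assume "?p = 0"
        then have "C * ?p * B = 0" by simp
        then have "(C * B * w) * (C * B) = 0" by (simp only: mult.assoc)
        then show False using nz by (simp add: wr idens mult.assoc[symmetric])
      qed
      moreover have "?p \<noteq> e" using ideal_B[of w] w e_notin by (auto simp: corner_def)
      ultimately show False using idem by blast
    qed
    \<comment> \<open>A linear projection onto the kernel of \<open>th\<close>, which contains
      \<open>I\<close> because of \<open>CB\<close>. It need not commute with the arrows; the kernel
      is the object \<open>k\<close> with arrows \<open>T * k\<close>.\<close>
    define k where "k = e - C' * C"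
    have kg: "k \<in> graded" using e g g' by (simp add: k_def)
    have Ck: "C * k = 0"
      by (simp add: k_def right_diff_distrib mult.assoc[symmetric] CC' Ce idens)
    have kB: "k * B = B" by (simp add: k_def left_diff_distrib mult.assoc CB eB)
    have ek: "e * k = k" "k * e = k"
      by (simp_all add: k_def left_diff_distrib right_diff_distrib mult.assoc Ce e idens)
    have kk: "k * k = k"
    proof -
      have "k * k = e * k - C' * (C * k)" by (simp add: k_def left_diff_distrib mult.assoc)
      then show ?thesis by (simp add: Ck ek)
    qed
    have CTk: "C * (T * k) = 0" by (simp add: mult.assoc[symmetric] CT) (simp add: mult.assoc Ck)
    have kTk: "k * (T * k) = T * k"
    proof -
      have "k * (T * k) = e * (T * k) - C' * (C * (T * k))"
        by (simp add: k_def left_diff_distrib mult.assoc)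
      then show ?thesis by (simp add: CTk e(4)[THEN mult_assoc_eq])
    qed
    \<comment> \<open>Projections of the kernel onto summands in which \<open>I\<close> has nonzero
      image. One of minimal size is indecomposable: if it split as \<open>s + (p - s)\<close>, one
      of the parts would still not kill \<open>B\<close>.\<close>
    define P where "P = {p \<in> homs k (T * k) k (T * k). p * p = p \<and> p * B \<noteq> 0}"
    have "B \<noteq> 0" using th(2) th_eq by auto
    then have "k \<in> P" by (simp add: P_def homs_def kg kk kB kTk mult.assoc)
    define p where "p = (ARG_MIN (\<lambda>p. fm.dim (corner p)) p. p \<in> P)"
    have p: "p \<in> P" and p_min: "\<And>x. x \<in> P \<Longrightarrow> fm.dim (corner p) \<le> fm.dim (corner x)"
      using arg_min_nat_lemma[of "\<lambda>p. p \<in> P" k "\<lambda>p. fm.dim (corner p)"] \<open>k \<in> P\<close>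
      unfolding p_def[symmetric] by auto
    have pp: "p * p = p" and pB: "p * B \<noteq> 0" and pg: "p \<in> graded" and
      kp: "k * p = p" and pk: "p * k = p" and pTk: "p * (T * k) = T * p"
      using p by (auto simp: P_def homs_def mult.assoc)
    have pTp: "p * (T * p) = T * p"
    proof -
      have "p * (T * p) = p * (p * (T * k))" by (simp only: pTk)
      also have "\<dots> = T * p" by (simp add: mult.assoc[symmetric] pp) (simp add: mult.assoc pTk)
      finally show ?thesis .
    qed
    have obp: "quiver_object Q p (T * p)"
      using e pg by (simp add: quiver_object_def pp pTp mult.assoc)
    have no_idem_p: "no_idempotents p (T * p)"
      unfolding no_idempotents_def
    proof (intro conjI ballI impI)
      show "p \<noteq> 0" using pB by auto
      fix s assume "s \<in> homs p (T * p) p (T * p)" and ss: "s * s = s"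
      then have s: "s \<in> graded" "p * s = s" "s * p = s" "s * (T * p) = T * s"
        by (auto simp: homs_def mult.assoc)
      have ks: "k * s = s" by (metis kp mult.assoc s(2))
      have sk: "s * k = s" by (metis pk mult.assoc s(3))
      have sT: "s * (T * k) = T * s"
      proof -
        have "s * (T * k) = s * (p * (T * k))" by (simp add: mult.assoc[symmetric] s)
        then show ?thesis by (simp add: pTk s)
      qed
      have sub: "s * B = 0" if "s \<noteq> p"
      proof (rule ccontr)
        assume "s * B \<noteq> 0"
        then have "s \<in> P" using s ks sk sT ss by (simp add: P_def homs_def mult.assoc)
        then show False using p_min[of s] dim_corner_less[OF pg pp s(2,3) that] by simp
      qed
      have sub': "(p - s) * B = 0" if "s \<noteq> 0"
      proof (rule ccontr)
        assume "(p - s) * B \<noteq> 0"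
        moreover have "(p - s) * (p - s) = p - s" "p * (p - s) = p - s" "(p - s) * p = p - s"
          by (simp_all add: left_diff_distrib right_diff_distrib pp s ss)
        moreover have "p - s \<in> homs k (T * k) k (T * k)"
          using s pg by (intro homsI) (simp_all add: left_diff_distrib right_diff_distrib mult.assoc
              kp pk ks sk sT pTk)
        ultimately show False
          using p_min[of "p - s"] dim_corner_less[OF pg pp, of "p - s"] that by (simp add: P_def)
      qed
      show "s = 0 \<or> s = p"
      proof (rule ccontr)
        assume "\<not> (s = 0 \<or> s = p)"
        then have "s * B = 0" "(p - s) * B = 0" using sub sub' by blast+
        then show False using pB by (simp add: left_diff_distrib)
      qed
    qed
    have ep: "e * p = p" by (metis ek(1) kp mult.assoc)
    have pe: "p * e = p" by (metis ek(2) pk mult.assoc)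
    have p_ne: "p \<noteq> e"
    proof
      assume "p = e"
      then have "C' * C = 0" using kp ek by (simp add: k_def)
      then have "C * (C' * C) = 0" by simp
      then have "C = 0" by (simp add: mult.assoc[symmetric] CC' idens)
      then show False using th(2) th_eq by simp
    qed
    have "brick p (T * p)"
      by (rule less.hyps[OF dim_corner_less[OF e(1,3) ep pe p_ne] obp no_idem_p])
    then have ext: "ext_vanishes Q p (T * p) p (T * p)" by (rule ext_vanishes_brick[OF obp])
    have pBT: "p * B * TI = T * p * B"
    proof -
      have "p * B * TI = p * (T * k) * B" by (simp add: mult.assoc BT kB)
      then show ?thesis by (simp add: pTk)
    qed
    \<comment> \<open>Although \<open>p\<close> acts only on the kernel, \<open>p * th\<close> is a
      nonzero endomorphism of the whole object, and it lies in the minimal ideal. Hence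
      \<open>th\<close> can be recovered from it, which makes \<open>p\<close> injective on
      \<open>I\<close>.\<close>
    obtain b where b: "b \<in> corner e" "th = b * (p * th)"
    proof -
      have "p * th \<in> homs e T e T"
      proof (rule homsI)
        have "p * th * T = p * B * TI * C" by (simp add: th_eq mult.assoc CT)
        also have "\<dots> = T * p * B * C" by (simp only: pBT)
        also have "\<dots> = T * (p * th)" by (simp only: th_eq mult.assoc)
        finally show "p * th * T = T * (p * th)" .
      qed (use pg thD in \<open>simp_all add: mult.assoc ep[THEN mult_assoc_eq]\<close>)
      moreover have "p * th \<noteq> 0"
      proof
        assume "p * th = 0"
        then have "p * th * C' = 0" by simp
        then show False using pB by (simp add: th_eq mult.assoc CC' idens)
      qed
      moreover have "p * th \<in> ideal th" using pg ep pe by (auto simp: ideal_def corner_def)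
      ultimately have "th \<in> ideal (p * th)" by (rule th_min')
      then show ?thesis using that by (auto simp: ideal_def)
    qed
    have bpB: "b * (p * B) = B"
    proof -
      have "b * (p * B) = b * (p * th) * C'" by (simp add: th_eq mult.assoc CC' idens)
      also have "\<dots> = B" unfolding b(2)[symmetric] by (simp add: th_eq mult.assoc CC' idens)
      finally show ?thesis .
    qed
    \<comment> \<open>\<open>I\<close> is a subobject of the summand \<open>p\<close>, and
      \<open>p\<close> has no self-extensions.\<close>
    have "ext_vanishes Q (iden d) TI p (T * p)"
    proof (rule ext_vanishes_retract[OF obI obp _ _ _ _ _ _ _ _ ext])
      show "p * B \<in> homs (iden d) TI p (T * p)"
        using pg g by (intro homsI) (simp_all add: pBT, simp_all add: mult.assoc idens pp pp[THEN mult_assoc_eq])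
      show "B' * (b * p) \<in> graded" using b pg g' by (simp add: corner_def)
      show "B' * (b * p) * p = B' * (b * p)" by (simp add: mult.assoc pp)
      show "B' * (b * p) * (p * B) = iden d"
        by (simp add: mult.assoc pp[THEN mult_assoc_eq] bpB B'B)
      show "p \<in> homs p (T * p) p (T * p)" using pg by (intro homsI) (simp_all add: mult.assoc pp pTp)
    qed (use pg pp in simp_all)
    \<comment> \<open>\<open>?D\<close> is the failure of \<open>p\<close> to be an endomorphism of
      the whole object. It vanishes on the kernel and therefore factors through \<open>C\<close>, so
      \<open>?D * C'\<close> is a cocycle for extensions of \<open>I\<close> by the summand
      \<open>p\<close>.\<close>
    moreover let ?D = "p * T - T * p"
    have "p * ?D = p * p * T - p * (T * p)" by (simp only: right_diff_distrib mult.assoc)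
    then have pD: "p * ?D = ?D" by (simp only: pp pTp)
    have "?D * C' \<in> arrow_mats Q" "p * (?D * C') = ?D * C'" "?D * C' * iden d = ?D * C'"
      using pg e(2) g'(2) by (simp, simp only: mult.assoc[symmetric] pD, simp only: mult.assoc idens)
    ultimately obtain s where s: "s \<in> graded" "p * s = s" "s * iden d = s"
      "?D * C' = s * TI - T * p * s"
      unfolding ext_vanishes_def by blast
    have Dk: "?D * k = 0" by (simp add: left_diff_distrib mult.assoc pk pTk)
    have De: "?D * e = ?D" by (simp add: left_diff_distrib mult.assoc e pe)
    have "e = k + C' * C" by (simp add: k_def)
    then have "?D * e = ?D * k + ?D * C' * C" by (simp only: distrib_left mult.assoc)
    then have "?D = (s * TI - T * p * s) * C" by (simp only: De Dk s(4) add_0)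
    then have D: "?D = s * TI * C - T * p * s * C" by (simp only: left_diff_distrib)
    \<comment> \<open>Splitting the cocycle corrects \<open>p\<close> to an endomorphism, and
      \<open>C * p = 0\<close> keeps it idempotent with the image of \<open>p\<close>.\<close>
    define q where "q = p - s * C"
    have Cp: "C * p = 0" by (metis Ck kp mult.assoc mult_zero_left)
    have pq: "p * q = q" by (simp add: q_def right_diff_distrib pp s(2) mult.assoc[symmetric])
    have qp: "q * p = p" by (simp add: q_def left_diff_distrib pp mult.assoc Cp)
    have "q \<in> homs e T e T"
    proof (rule homsI)
      show "q \<in> graded" using pg s g by (simp add: q_def)
      have "e * s = s" by (metis ep s(2) mult.assoc)
      then show "e * q = q" by (simp add: q_def right_diff_distrib ep mult.assoc[symmetric])
      show "q * e = q" by (simp add: q_def left_diff_distrib pe mult.assoc Ce)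
      have "T * p * s = T * s" by (simp add: mult.assoc s)
      then have "p * T - T * p = s * TI * C - T * s * C" using D by simp
      then have "p * T - s * TI * C = T * p - T * s * C" by (simp add: algebra_simps)
      then show "q * T = T * q" by (simp add: q_def left_diff_distrib right_diff_distrib mult.assoc CT)
    qed
    moreover have "q * q = q" by (metis pq qp mult.assoc)
    moreover have "q \<noteq> 0" using qp pB by auto
    moreover have "q \<noteq> e" using pq pe p_ne by auto
    ultimately show False using idem by blast
  qed
qed

end

section \<open>Existence of objects without self-extensions\<close>

lemma subspace_homs: "fm.subspace (homs e T e' T')"
  unfolding fm.subspace_def homs_def by (auto simp: distrib_left distrib_right)

lemma homs_subset_corner: "homs e T e T \<subseteq> corner e"
  by (auto simp: homs_def corner_def)

text \<open>A nonsplit extension has fewer endomorphisms than the direct sum of its ends: the graded pieces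
  of its endomorphism space with respect to \<open>p\<close> and \<open>e - p\<close> consist of endomorphisms of the direct
  sum, and \<open>p\<close> itself does not occur among them.\<close>

lemma dim_homs_extension_less:
  fixes e :: "('i::finite \<times> nat) fmat"
  assumes ob: "quiver_object Q e T" and p: "p \<in> homs e T e T" "p * p = p"
    and c: "c \<in> arrow_mats Q" "p * c = c" "c * p = 0" "c * e = c"
    and nonsplit: "\<And>b. b \<in> graded \<Longrightarrow> p * b = b \<Longrightarrow> b * p = 0 \<Longrightarrow> b * e = b \<Longrightarrow> c \<noteq> b * T - T * b"
  shows "fm.dim (homs e (T + c) e (T + c)) < fm.dim (homs e T e T)"
proof -
  note e = quiver_objectD[OF ob] and pD = homsD[OF p(1)]
  define p' where "p' = e - p"
  have ec: "e * c = c" by (metis c(2) mult.assoc pD(2))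
  have p': "p' \<in> graded" "e * p' = p'" "p' * e = p'" "p' * T = T * p'" "p' * p' = p'"
      "p * p' = 0" "p' * p = 0" "p' * c = 0" "c * p' = c"
    using e pD p(2) c ec by (simp_all add: p'_def left_diff_distrib right_diff_distrib)
  define H where "H = homs e T e T"
  define W where "W = homs e (T + c) e (T + c)"
  obtain F where F: "finite F" "corner e \<subseteq> fm.span F" by (rule finite_dim_corner)
  have HF: "H \<subseteq> fm.span F" and WF: "W \<subseteq> fm.span F"
    unfolding H_def W_def using homs_subset_corner F(2) by blast+
  note rw = mult.assoc distrib_left distrib_right p' p(2) pD(2-4) c(2-4) ec e(3-5)
    p'(2-9)[THEN mult_assoc_eq] p(2)[THEN mult_assoc_eq] pD(2-4)[THEN mult_assoc_eq]
    c(2-4)[THEN mult_assoc_eq] ec[THEN mult_assoc_eq] e(3-5)[THEN mult_assoc_eq]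
  \<comment> \<open>Blocks for the splitting into \<open>p\<close> and \<open>p'\<close>:
    \<open>L1\<close> goes from \<open>p\<close> to \<open>p'\<close>, \<open>L2\<close> is
    diagonal, and \<open>L3\<close> goes from \<open>p'\<close> to \<open>p\<close>, the direction
    of the cocycle \<open>c\<close>.\<close>
  define L1 where "L1 = (\<lambda>f. p' * (f * p))"
  define L2 where "L2 = (\<lambda>f. p * (f * p) + p' * (f * p'))"
  define L3 where "L3 = (\<lambda>f. p * (f * p'))"
  have lin: "Vector_Spaces.linear scl scl L1" "Vector_Spaces.linear scl scl L2"
    unfolding L1_def L2_def by (rule linear_fmatI; simp add: distrib_left distrib_right fm.scale_right_distrib)+
  have decomp: "f = L1 f + L2 f + L3 f" if "e * f = f" "f * e = f" for f
  proof -
    have "f = (p + p') * (f * (p + p'))" using that by (simp add: p'_def)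
    then show ?thesis by (simp only: L1_def L2_def L3_def distrib_left distrib_right add_ac)
  qed
  have block: "x * f * (T * y) + x * f * (c * y) = x * T * (f * y) + x * c * (f * y)"
    if "f \<in> W" for x y f
  proof -
    have "x * (f * (T + c)) * y = x * ((T + c) * f) * y" using that by (simp add: W_def homs_def)
    then show ?thesis by (simp only: distrib_left distrib_right mult.assoc)
  qed
  have WD: "f \<in> graded" "e * f = f" "f * e = f" if "f \<in> W" for f using that by (auto simp: W_def homs_def)
  \<comment> \<open>\<open>W\<close> is filtered by vanishing of \<open>L1\<close> and then of
    \<open>L2\<close>. The layers embed into \<open>H21\<close>, \<open>D\<close> and
    \<open>H12\<close>, whose sum in \<open>H\<close> is direct.\<close>
  define H21 where "H21 = {f \<in> H. L1 f = f}"
  define H0 where "H0 = {f \<in> H. L1 f = 0}"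
  define D where "D = {f \<in> H. L2 f = f}"
  define H12 where "H12 = {f \<in> H. L3 f = f}"
  define W0 where "W0 = {f \<in> W. L1 f = 0}"
  have subspaces: "fm.subspace H21" "fm.subspace H0" "fm.subspace D" "fm.subspace H12" "fm.subspace W0"
    using subspace_homs[of e T e T] subspace_homs[of e "T + c" e "T + c"]
    unfolding fm.subspace_def H21_def H0_def D_def H12_def W0_def L1_def L2_def L3_def
      H_def[symmetric] W_def[symmetric]
    by (auto simp: distrib_left distrib_right fm.scale_right_distrib[symmetric] add.assoc add.left_commute)
  \<comment> \<open>In this block the commutation relations for \<open>T + c\<close> and for
    \<open>T\<close> agree, because \<open>p' * c = 0\<close> and \<open>c * p = 0\<close>.\<close>
  have "L1 ` W \<subseteq> H21"
  proof (rule image_subsetI)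
    fix f assume f: "f \<in> W"
    have "p' * (f * (T * p)) = p' * (T * (f * p))"
      using block[OF f, of p' p] by (simp add: rw)
    then have "L1 f * T = T * L1 f" unfolding L1_def by (simp add: rw)
    then show "L1 f \<in> H21"
      using WD[OF f] pD p' by (simp add: H21_def H_def homs_def L1_def rw)
  qed
  then have 1: "fm.dim W \<le> fm.dim W0 + fm.dim H21"
    using fm.dim_le_kernel_plus_image[OF lin(1) subspace_homs WF[unfolded W_def] F(1)]
      fm.dim_mono_in_span[of "L1 ` W" H21 F] HF F(1)
    unfolding W0_def W_def[symmetric] by (force simp: H21_def)
  have "{f \<in> W0. L2 f = 0} \<subseteq> H12"
  proof
    fix f assume "f \<in> {f \<in> W0. L2 f = 0}"
    then have f: "f \<in> W" "L1 f = 0" "L2 f = 0" by (auto simp: W0_def)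
    then have f3: "f = p * (f * p')" using decomp[of f] WD[OF f(1)] by (simp add: L3_def)
    have "f * c = 0" by (subst f3) (simp add: rw)
    moreover have "c * f = 0" by (subst f3) (simp add: rw)
    moreover have "f * (T + c) = (T + c) * f" using f(1) by (simp add: W_def homs_def)
    ultimately have "f * T = T * f" by (simp add: distrib_left distrib_right)
    then show "f \<in> H12" using WD[OF f(1)] f3 by (simp add: H12_def H_def homs_def L3_def)
  qed
  then have 2: "fm.dim {f \<in> W0. L2 f = 0} \<le> fm.dim H12"
    using HF F(1) by (intro fm.dim_mono_in_span[of _ _ F]) (auto simp: H12_def)
  have "L2 ` W0 \<subset> D"
  proof
    show "L2 ` W0 \<subseteq> D"
    proof (rule image_subsetI)
      fix f assume "f \<in> W0"
      then have f: "f \<in> W" "p' * (f * p) = 0" by (auto simp: W0_def L1_def)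
      have "p * (f * (T * p)) = p * (T * (f * p))"
      proof -
        have "c * (f * p) = c * (p' * (f * p))" by (simp add: rw)
        then show ?thesis using block[OF f(1), of p p] f(2) by (simp add: rw)
      qed
      moreover have "p' * (f * (T * p')) = p' * (T * (f * p'))"
      proof -
        have "p' * (f * c) = p' * (f * p) * c" by (simp add: rw)
        then show ?thesis using block[OF f(1), of p' p'] f(2) by (simp add: rw)
      qed
      ultimately have "L2 f * T = T * L2 f" unfolding L2_def by (simp add: rw)
      then show "L2 f \<in> D"
        using WD[OF f(1)] pD p' by (simp add: D_def H_def homs_def L2_def rw)
    qed
    have "p \<in> D" using p by (simp add: D_def H_def L2_def rw)
    \<comment> \<open>An endomorphism \<open>p + b\<close> of the extension, with \<open>b\<close>
      off-diagonal, would exhibit \<open>c\<close> as the coboundary of \<open>- b\<close>.\<close>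
    moreover have "p \<notin> L2 ` W0"
    proof
      assume "p \<in> L2 ` W0"
      then obtain f where f: "f \<in> W" "L1 f = 0" "L2 f = p" by (auto simp: W0_def)
      define b where "b = p * (f * p')"
      have fb: "f = p + b" using decomp[of f] WD[OF f(1)] f by (simp add: L3_def b_def)
      have b: "b \<in> graded" "p * b = b" "b * p = 0" "b * e = b"
        using WD[OF f(1)] pD p' by (simp_all add: b_def rw)
      have "b * c = 0" "c * b = 0" by (simp_all add: b_def rw)
      moreover have "f * (T + c) = (T + c) * f" using f(1) by (simp add: W_def homs_def)
      ultimately have "c = (- b) * T - T * (- b)"
        unfolding fb by (simp add: distrib_left distrib_right pD c algebra_simps)
      then show False using nonsplit[of "- b"] b by simp
    qed
    ultimately show "L2 ` W0 \<noteq> D" by blast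
  qed
  moreover have "fm.subspace (L2 ` W0)"
  proof -
    interpret L: Vector_Spaces.linear scl scl L2 by (rule lin)
    show ?thesis by (rule L.subspace_image[OF subspaces(5)])
  qed
  ultimately have 3: "fm.dim (L2 ` W0) < fm.dim D"
    using HF F(1) by (intro fm.dim_psubset_in_span[of _ _ F]) (auto simp: D_def)
  have W0F: "W0 \<subseteq> fm.span F" using WF by (auto simp: W0_def)
  have 4: "fm.dim W0 \<le> fm.dim {f \<in> W0. L2 f = 0} + fm.dim (L2 ` W0)"
    by (rule fm.dim_le_kernel_plus_image[OF lin(2) subspaces(5) W0F F(1)])
  have 5: "fm.dim D + fm.dim H12 \<le> fm.dim H0"
  proof (rule fm.dim_add_le_if_disjoint[OF subspaces(3,4)])
    have "L1 f = 0" if "L2 f = f" for f by (subst that[symmetric]) (simp add: L1_def L2_def rw)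
    then show "D \<subseteq> H0" by (auto simp: D_def H0_def)
    have "L1 f = 0" if "L3 f = f" for f by (subst that[symmetric]) (simp add: L1_def L3_def rw)
    then show "H12 \<subseteq> H0" by (auto simp: H12_def H0_def)
    have "f = 0" if "L2 f = f" "L3 f = f" for f
    proof -
      have "L3 (L2 f) = 0" by (simp add: L2_def L3_def rw)
      then show ?thesis using that by simp
    qed
    then show "D \<inter> H12 = {0}"
      using fm.subspace_0[OF subspaces(3)] fm.subspace_0[OF subspaces(4)] by (auto simp: D_def H12_def)
  qed (use HF F(1) in \<open>auto simp: H0_def\<close>)
  have 6: "fm.dim H21 + fm.dim H0 \<le> fm.dim H"
  proof (rule fm.dim_add_le_if_disjoint[OF subspaces(1,2)])
    show "H21 \<inter> H0 = {0}"
      using fm.subspace_0[OF subspaces(1)] fm.subspace_0[OF subspaces(2)] by (auto simp: H21_def H0_def)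
  qed (use HF F(1) in \<open>auto simp: H0_def H21_def\<close>)
  show ?thesis using 1 2 3 4 5 6 unfolding H_def[symmetric] W_def[symmetric] by linarith
qed

lemma quiver_object_summand:
  assumes ob: "quiver_object Q e T" and p: "p \<in> homs e T e T" "p * p = p"
  shows "quiver_object Q p (T * p)"
proof -
  note pD = homsD[OF p(1)]
  have "p * (T * p) = T * p" by (metis mult.assoc p(2) pD(4))
  then show ?thesis using quiver_objectD[OF ob] pD p(2) by (simp add: quiver_object_def mult.assoc)
qed

context definite_quiver
begin

text \<open>Minimality by itself handles only extensions between complementary summands.
  Self-extensions of an indecomposable summand vanish because it is a brick, and induction over
  summands puts the blocks together.\<close>

theorem object_without_self_extensions:
  fixes d :: "'i \<Rightarrow> nat"
  shows "\<exists>T. quiver_object Q (iden d) T \<and> ext_vanishes Q (iden d) T (iden d) T"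
proof -
  define e where "e = iden d"
  define h where "h = (\<lambda>T. fm.dim (homs e T e T))"
  define T where "T = (ARG_MIN h T. quiver_object Q e T)"
  have "quiver_object Q e 0" by (simp add: quiver_object_def e_def)
  then have ob: "quiver_object Q e T" and T_min: "\<And>T'. quiver_object Q e T' \<Longrightarrow> h T \<le> h T'"
    using arg_min_nat_lemma[of "quiver_object Q e" 0 h] unfolding T_def[symmetric] by auto
  note e = quiver_objectD[OF ob]
  \<comment> \<open>A cocycle with values in the summand \<open>p\<close> that vanishes on
    \<open>p\<close> must be a coboundary; otherwise \<open>T + c\<close> would have fewer
    endomorphisms than \<open>T\<close>.\<close>
  have split: "\<exists>b\<in>graded. c = b * T - T * b"
    if "p \<in> homs e T e T" "p * p = p" "c \<in> arrow_mats Q" "p * c = c" "c * p = 0" "c * e = c" for p c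
  proof (rule ccontr)
    assume "\<not> ?thesis"
    then have "h (T + c) < h T"
      unfolding h_def by (intro dim_homs_extension_less[OF ob that]) auto
    moreover have "e * c = c" by (metis homsD(2)[OF that(1)] mult.assoc that(4))
    then have "quiver_object Q e (T + c)"
      using e that(3,6) by (simp add: quiver_object_def distrib_left distrib_right)
    ultimately show False using T_min[of "T + c"] by simp
  qed
  have "ext_vanishes Q p (T * p) p (T * p)" if "p \<in> homs e T e T" "p * p = p" for p
    using that
  proof (induction "fm.dim (corner p)" arbitrary: p rule: less_induct)
    case less
    note pD = homsD[OF less.prems(1)] and pp = less.prems(2)
    have obp: "quiver_object Q p (T * p)" by (rule quiver_object_summand[OF ob less.prems])
    consider "p = 0" | "no_idempotents p (T * p)"
      | s where "p \<noteq> 0" "s \<in> homs p (T * p) p (T * p)" "s * s = s" "s \<noteq> 0" "s \<noteq> p"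
      unfolding no_idempotents_def by blast
    then show ?case
    proof cases
      case 1
      then show ?thesis by (auto simp: ext_vanishes_def intro!: bexI[of _ 0])
    next
      case 2
      then show ?thesis by (intro ext_vanishes_brick[OF obp] no_idempotents_imp_brick[OF obp])
    next
      case (3 s)
      define t where "t = p - s"
      note sD = homsD[OF 3(2)]
      have es: "e * s = s" by (metis pD(2) sD(2) mult.assoc)
      have se: "s * e = s" by (metis pD(3) sD(3) mult.assoc)
      have sT: "s * T = T * s"
      proof -
        have "s * T = s * (p * T)" by (simp add: mult.assoc[symmetric] sD)
        also have "\<dots> = s * (T * p)" by (simp only: pD)
        also have "\<dots> = T * s" by (simp only: sD(4)) (simp add: mult.assoc sD(2))
        finally show ?thesis .
      qed
      have s: "s \<in> homs e T e T" using sD es se sT by (intro homsI)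
      have t: "t \<in> homs e T e T"
        using sD(1) pD es se sT by (intro homsI) (simp_all add: t_def left_diff_distrib right_diff_distrib)
      have tt: "t * t = t" and st: "s * t = 0" "t * s = 0" and pt: "p * t = t" "t * p = t"
        by (simp_all add: t_def left_diff_distrib right_diff_distrib 3 sD pp)
      have te: "t * e = t" and tT: "t * T = T * t" and tg: "t \<in> graded" using homsD[OF t] by auto
      have "ext_vanishes Q s (T * s) s (T * s)"
        using less.hyps[OF dim_corner_less[OF pD(1) pp sD(2,3) 3(5)] s 3(3)] .
      have t_ne: "t \<noteq> p" using 3(4) by (simp add: t_def)
      have ext_st: "\<exists>b\<in>graded. u * (c * u) = b * T - T * b" if "u \<in> {s, t}" "c \<in> arrow_mats Q" for u c
      proof -
        have u: "u \<in> homs e T e T" "u * u = u" "ext_vanishes Q u (T * u) u (T * u)"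
          using that(1) s t 3(3) tt less.hyps[OF dim_corner_less[OF pD(1) pp sD(2,3) 3(5)] s 3(3)]
            less.hyps[OF dim_corner_less[OF pD(1) pp pt t_ne] t tt] by auto
        note uD = homsD[OF u(1)]
        have "u * (c * u) \<in> arrow_mats Q" "u * (u * (c * u)) = u * (c * u)" "u * (c * u) * u = u * (c * u)"
          using uD(1) that(2) by (simp_all add: mult.assoc u(2) u(2)[THEN mult_assoc_eq])
        then obtain f where f: "f \<in> graded" "u * f = f" "f * u = f" "u * (c * u) = f * (T * u) - T * u * f"
          using u(3) unfolding ext_vanishes_def by blast
        have "f * (T * u) = f * u * T" by (simp only: uD(4)[symmetric] mult.assoc)
        then have "u * (c * u) = f * T - T * f" using f by (simp add: mult.assoc)
        then show ?thesis using f(1) by blast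
      qed
      show ?thesis
      proof (rule ext_vanishesI[OF obp obp])
        fix c assume c: "c \<in> arrow_mats Q" "p * c = c" "c * p = c"
        \<comment> \<open>The cocycle is cut into four blocks: the diagonal ones are settled by
          induction, the mixed ones by \<open>split\<close>.\<close>
        have "p = s + t" by (simp add: t_def)
        then have "c = (s + t) * (c * (s + t))" using c by simp
        then have c4: "c = s * (c * s) + s * (c * t) + (t * (c * s) + t * (c * t))"
          by (simp only: distrib_left distrib_right add_ac)
        have "\<exists>b\<in>graded. s * (c * t) = b * T - T * b"
          by (rule split[OF s 3(3)])
            (use c sD tg in \<open>simp_all add: mult.assoc 3 3(3)[THEN mult_assoc_eq] st te\<close>)
        moreover have "\<exists>b\<in>graded. t * (c * s) = b * T - T * b"
          by (rule split[OF t tt])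
            (use c sD tg in \<open>simp_all add: mult.assoc tt tt[THEN mult_assoc_eq] st se\<close>)
        moreover note ext_st[of s c] ext_st[of t c]
        ultimately obtain b1 b2 b3 b4 where
          b: "b1 \<in> graded" "b2 \<in> graded" "b3 \<in> graded" "b4 \<in> graded" and
          "s * (c * t) = b1 * T - T * b1" "t * (c * s) = b2 * T - T * b2"
          "s * (c * s) = b3 * T - T * b3" "t * (c * t) = b4 * T - T * b4"
          using c(1) by blast
        then have "c = (b3 * T - T * b3) + (b1 * T - T * b1) + ((b2 * T - T * b2) + (b4 * T - T * b4))"
          using c4 by simp
        moreover define f where "f = b3 + b1 + (b2 + b4)"
        ultimately have f: "f \<in> graded" "c = f * T - T * f"
          using b by (simp_all add: f_def distrib_left distrib_right)
        have "c = p * (c * p)" using c by simp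
        also have "\<dots> = p * (f * (T * p)) - p * T * (f * p)"
          by (simp only: f(2) left_diff_distrib right_diff_distrib mult.assoc)
        also have "\<dots> = (p * (f * p)) * (T * p) - T * p * (p * (f * p))"
          by (simp add: mult.assoc pD(4)[THEN mult_assoc_eq] pD(4) pp pp[THEN mult_assoc_eq])
        finally show "\<exists>f\<in>graded. c = f * (T * p) - T * p * f" using f(1) pD(1) by blast
      qed
    qed
  qed
  from this[of e] have "ext_vanishes Q e T e T" using e by (simp add: homs_def)
  then show ?thesis using ob unfolding e_def by blast
qed

end

section \<open>Quiver representations as objects\<close>

text \<open>The vertex maps are assembled into one block matrix. The value 0 is set explicitly
  outside the blocks, where the entries of the matrices \<open>f i\<close> are unspecified.\<close>

lift_definition hom_fmat :: "('i::finite \<Rightarrow> nat) \<Rightarrow> ('i \<Rightarrow> nat) \<Rightarrow> ('i \<Rightarrow> complex mat) \<Rightarrow> ('i \<times> nat) fmat"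
  is "\<lambda>d d' f x y. if (x, y) \<in> vertex_support d d' then f (fst x) $$ (snd x, snd y) else 0"
  subgoal for d d' f by (rule finite_subset[OF _ vertex_support_card(1)[of d d']]) auto
  done

lift_definition arrow_fmat :: "('i::finite \<times> 'i) set \<Rightarrow> ('i \<Rightarrow> nat) \<Rightarrow> ('i \<times> 'i \<Rightarrow> complex mat)
    \<Rightarrow> ('i \<times> nat) fmat"
  is "\<lambda>Q d m x y. if (x, y) \<in> arrow_support Q d d then m (fst y, fst x) $$ (snd x, snd y) else 0"
  subgoal for Q d m by (rule finite_subset[OF _ arrow_support_card(1)[of Q d d]]) auto
  done

abbreviation rep_fmat :: "('i::finite \<times> 'i) set \<Rightarrow> 'i quiver_rep \<Rightarrow> ('i \<times> nat) fmat" where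
  "rep_fmat Q M \<equiv> arrow_fmat Q (dimv M) (maps M)"

definition fmat_block :: "('i \<times> nat) fmat \<Rightarrow> 'i \<Rightarrow> 'i \<Rightarrow> nat \<Rightarrow> nat \<Rightarrow> complex mat" where
  "fmat_block A j i n m = mat n m (\<lambda>(r, s). entry A (j, r) (i, s))"

definition fmat_rep :: "('i \<times> 'i) set \<Rightarrow> ('i \<Rightarrow> nat) \<Rightarrow> ('i \<times> nat) fmat \<Rightarrow> 'i quiver_rep" where
  "fmat_rep Q d T = \<lparr>dimv = d, maps = (\<lambda>(i, j)\<in>Q. fmat_block T j i (d j) (d i))\<rparr>"

abbreviation rep_homs :: "('i::finite \<times> 'i) set \<Rightarrow> 'i quiver_rep \<Rightarrow> 'i quiver_rep \<Rightarrow> ('i \<times> nat) fmat set"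
  where "rep_homs Q M N \<equiv> homs (iden (dimv M)) (rep_fmat Q M) (iden (dimv N)) (rep_fmat Q N)"

lemma entry_hom_fmat[simp]: "entry (hom_fmat d d' f) (j, r) (i, s)
    = (if i = j \<and> r < d' j \<and> s < d i then f j $$ (r, s) else 0)"
  by (auto simp: hom_fmat.rep_eq vertex_support_def)

lemma entry_arrow_fmat[simp]: "entry (arrow_fmat Q d m) (j, r) (i, s)
    = (if (i, j) \<in> Q \<and> r < d j \<and> s < d i then m (i, j) $$ (r, s) else 0)"
  by (auto simp: arrow_fmat.rep_eq arrow_support_def)

lemma hom_fmat_supported: "hom_fmat d d' f \<in> supported (vertex_support d d')"
  by (simp add: supported_def hom_fmat.rep_eq)

lemma hom_fmat_graded:
  "hom_fmat d d' f \<in> graded" "iden d' * hom_fmat d d' f = hom_fmat d d' f"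
  "hom_fmat d d' f * iden d = hom_fmat d d' f"
  using hom_fmat_supported[of d d' f] unfolding supported_vertex_support by auto

lemma quiver_object_arrow_fmat[simp]: "quiver_object Q (iden d) (arrow_fmat Q d m)"
proof -
  have "arrow_fmat Q d m \<in> supported (arrow_support Q d d)" by (simp add: supported_def arrow_fmat.rep_eq)
  then show ?thesis unfolding supported_arrow_support by (auto simp: quiver_object_def)
qed

lemma fmat_block_carrier[simp, intro]: "fmat_block A j i n m \<in> carrier_mat n m"
  by (simp add: fmat_block_def)

lemma dim_fmat_block[simp]: "dim_row (fmat_block A j i n m) = n" "dim_col (fmat_block A j i n m) = m"
  by (simp_all add: fmat_block_def)

lemma fmat_block_index[simp]:
  "r < n \<Longrightarrow> s < m \<Longrightarrow> fmat_block A j i n m $$ (r, s) = entry A (j, r) (i, s)"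
  by (simp add: fmat_block_def)

lemma fmat_rep_simps[simp]: "dimv (fmat_rep Q d T) = d" "is_rep Q (fmat_rep Q d T)"
  by (auto simp: fmat_rep_def is_rep_def rep_space_def restrict_def PiE_def extensional_def)

lemma fmat_eqI_pairs: "(\<And>j r i s. entry A (j, r) (i, s) = entry B (j, r) (i, s)) \<Longrightarrow> A = B"
  by (rule fmat_eqI) auto

lemma arrow_fmat_fmat_rep:
  assumes "quiver_object Q (iden d) T"
  shows "arrow_fmat Q d (maps (fmat_rep Q d T)) = T"
proof -
  have "T \<in> supported (arrow_support Q d d)"
    using assms unfolding supported_arrow_support by (simp add: quiver_object_def)
  then show ?thesis
    by (intro fmat_eqI_pairs) (auto simp: fmat_rep_def supported_def arrow_support_def)
qed

lemma maps_carrier: "is_rep Q M \<Longrightarrow> (i, j) \<in> Q \<Longrightarrow> maps M (i, j) \<in> carrier_mat (dimv M j) (dimv M i)"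
  unfolding is_rep_def rep_space_def by (auto dest: PiE_mem)

lemma fmat_block_arrow_fmat:
  "is_rep Q M \<Longrightarrow> (i, j) \<in> Q \<Longrightarrow> fmat_block (rep_fmat Q M) j i (dimv M j) (dimv M i) = maps M (i, j)"
  by (rule eq_matI) (use maps_carrier[of Q M i j] in auto)

lemma fmat_block_hom_fmat:
  "f i \<in> carrier_mat (d' i) (d i) \<Longrightarrow> fmat_block (hom_fmat d d' f) i i (d' i) (d i) = f i"
  by (rule eq_matI) auto

lemma fmat_block_iden: "fmat_block (iden d) i i (d i) (d i) = 1\<^sub>m (d i)"
  by (rule eq_matI) auto

lemma entry_mult_graded_right:
  assumes "B \<in> graded" "iden d * B = B"
  shows "entry (A * B) x (i, s) = (\<Sum>t<d i. entry A x (i, t) * entry B (i, t) (i, s))"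
proof -
  have "y \<in> Pair i ` {..<d i}" if "entry B y (i, s) \<noteq> 0" for y
  proof -
    have "snd y < d (fst y)" using that assms(2) unfolding iden_mult_eq_iff by blast
    moreover have "fst y = i" using that assms(1) unfolding graded_def supported_def by fastforce
    ultimately show ?thesis by (cases y) auto
  qed
  then show ?thesis by (subst entry_mult_right[of "Pair i ` {..<d i}"]) (auto simp: sum.reindex inj_on_def)
qed

lemma entry_mult_graded_left:
  assumes "A \<in> graded" "A * iden d = A"
  shows "entry (A * B) (j, r) y = (\<Sum>t<d j. entry A (j, r) (j, t) * entry B (j, t) y)"
proof -
  have "z \<in> Pair j ` {..<d j}" if "entry A (j, r) z \<noteq> 0" for z
  proof -
    have "snd z < d (fst z)" using that assms(2) unfolding mult_iden_eq_iff by blast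
    moreover have "fst z = j" using that assms(1) unfolding graded_def supported_def by fastforce
    ultimately show ?thesis by (cases z) auto
  qed
  then show ?thesis by (subst entry_mult_left[of "Pair j ` {..<d j}"]) (auto simp: sum.reindex inj_on_def)
qed

text \<open>A graded factor stays at its vertex, so the sum over all inner indices reduces to the
  indices below \<open>d i\<close> at that vertex.\<close>

lemma fmat_block_mult_right:
  assumes "B \<in> graded" "iden d * B = B"
  shows "fmat_block (A * B) j i n m = fmat_block A j i n (d i) * fmat_block B i i (d i) m"
  by (rule eq_matI)
    (auto simp: entry_mult_graded_right[OF assms] scalar_prod_def lessThan_atLeast0 intro!: sum.cong)

lemma fmat_block_mult_left:
  assumes "A \<in> graded" "A * iden d = A"
  shows "fmat_block (A * B) j i n m = fmat_block A j j n (d j) * fmat_block B j i (d j) m"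
  by (rule eq_matI)
    (auto simp: entry_mult_graded_left[OF assms] scalar_prod_def lessThan_atLeast0 intro!: sum.cong)

lemma graded_eqI:
  assumes "A \<in> supported (vertex_support d d')" "B \<in> supported (vertex_support d d')"
    and eq: "\<And>i. fmat_block A i i (d' i) (d i) = fmat_block B i i (d' i) (d i)"
  shows "A = B"
proof (rule fmat_eqI_pairs)
  fix j r i s
  show "entry A (j, r) (i, s) = entry B (j, r) (i, s)"
  proof (cases "i = j \<and> r < d' j \<and> s < d i")
    case True
    then show ?thesis using arg_cong[OF eq[of i], of "\<lambda>M. M $$ (r, s)"] by auto
  next
    case False
    then have "((j, r), (i, s)) \<notin> vertex_support d d'" by (auto simp: vertex_support_def)
    then show ?thesis using assms(1,2) by (metis (mono_tags, lifting) mem_Collect_eq supported_def)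
  qed
qed

lemma arrow_eqI:
  assumes "A \<in> supported (arrow_support Q d d')" "B \<in> supported (arrow_support Q d d')"
    and eq: "\<And>i j. (i, j) \<in> Q \<Longrightarrow> fmat_block A j i (d' j) (d i) = fmat_block B j i (d' j) (d i)"
  shows "A = B"
proof (rule fmat_eqI_pairs)
  fix j r i s
  show "entry A (j, r) (i, s) = entry B (j, r) (i, s)"
  proof (cases "(i, j) \<in> Q \<and> r < d' j \<and> s < d i")
    case True
    then show ?thesis using arg_cong[OF eq[of i j], of "\<lambda>M. M $$ (r, s)"] by auto
  next
    case False
    then have "((j, r), (i, s)) \<notin> arrow_support Q d d'" by (auto simp: arrow_support_def)
    then show ?thesis using assms(1,2) by (metis (mono_tags, lifting) mem_Collect_eq supported_def)
  qed
qed

lemma hom_fmat_in_homs: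
  assumes "is_rep Q M" "is_rep Q N" "f \<in> rep_hom Q M N"
  shows "hom_fmat (dimv M) (dimv N) f \<in> rep_homs Q M N"
proof (rule homsI)
  let ?F = "hom_fmat (dimv M) (dimv N) f"
  note F = hom_fmat_graded[where d = "dimv M" and d' = "dimv N" and f = f]
  note TM = quiver_objectD[OF quiver_object_arrow_fmat[of Q "dimv M" "maps M"]]
  note TN = quiver_objectD[OF quiver_object_arrow_fmat[of Q "dimv N" "maps N"]]
  show "?F * rep_fmat Q M = rep_fmat Q N * ?F"
  proof (rule arrow_eqI)
    show "?F * rep_fmat Q M \<in> supported (arrow_support Q (dimv M) (dimv N))"
      "rep_fmat Q N * ?F \<in> supported (arrow_support Q (dimv M) (dimv N))"
      unfolding supported_arrow_support using F TM TN
      by (simp_all add: mult.assoc F(2)[THEN mult_assoc_eq] TN(4)[THEN mult_assoc_eq])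
    fix i j assume ij: "(i, j) \<in> Q"
    have f: "f i \<in> carrier_mat (dimv N i) (dimv M i)" "f j \<in> carrier_mat (dimv N j) (dimv M j)"
      "f j * maps M (i, j) = maps N (i, j) * f i"
      using assms(3) ij unfolding rep_hom_def by auto
    show "fmat_block (?F * rep_fmat Q M) j i (dimv N j) (dimv M i)
        = fmat_block (rep_fmat Q N * ?F) j i (dimv N j) (dimv M i)"
      unfolding fmat_block_mult_left[OF F(1,3)] fmat_block_mult_right[OF F(1,2)]
      using f ij by (simp add: fmat_block_hom_fmat fmat_block_arrow_fmat assms)
  qed
qed (use hom_fmat_graded in auto)

lemma fmat_block_in_rep_hom:
  assumes "is_rep Q M" "is_rep Q N" "A \<in> rep_homs Q M N"
  shows "(\<lambda>i. fmat_block A i i (dimv N i) (dimv M i)) \<in> rep_hom Q M N"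
proof -
  note A = homsD[OF assms(3)]
  have "fmat_block A j j (dimv N j) (dimv M j) * maps M (i, j)
      = maps N (i, j) * fmat_block A i i (dimv N i) (dimv M i)" if ij: "(i, j) \<in> Q" for i j
  proof -
    have "fmat_block (A * rep_fmat Q M) j i (dimv N j) (dimv M i)
        = fmat_block (rep_fmat Q N * A) j i (dimv N j) (dimv M i)" by (simp only: A(4))
    then show ?thesis
      unfolding fmat_block_mult_left[OF A(1,3)] fmat_block_mult_right[OF A(1,2)]
      by (simp add: fmat_block_arrow_fmat assms ij)
  qed
  then show ?thesis by (auto simp: rep_hom_def)
qed

text \<open>At each vertex \<open>u * v\<close> and \<open>v * u\<close> have the same trace, and
  traces of identities recover dimensions in characteristic zero.\<close>

lemma iso_imp_dims_eq:
  assumes "u \<in> graded" "iden d' * u = u" "u * iden d = u" "v \<in> graded" "iden d * v = v" "v * iden d' = v"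
    and "u * v = iden d'" "v * u = iden d"
  shows "d = d'"
proof
  fix i
  have "of_nat (d' i) = (\<Sum>r<d' i. entry (u * v) (i, r) (i, r))" by (simp add: assms(7))
  also have "\<dots> = (\<Sum>r<d' i. \<Sum>t<d i. entry u (i, r) (i, t) * entry v (i, t) (i, r))"
    by (simp add: entry_mult_graded_left[OF assms(1,3)])
  also have "\<dots> = (\<Sum>t<d i. \<Sum>r<d' i. entry v (i, t) (i, r) * entry u (i, r) (i, t))"
    by (subst sum.swap) (simp add: mult.commute)
  also have "\<dots> = (\<Sum>t<d i. entry (v * u) (i, t) (i, t))"
    by (simp add: entry_mult_graded_left[OF assms(4,6)])
  also have "\<dots> = of_nat (d i)" by (simp add: assms(8))
  finally have "(of_nat (d' i) :: complex) = of_nat (d i)" .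
  then show "d i = d' i" unfolding of_nat_eq_iff by (rule sym)
qed

lemma invertible_matD:
  assumes "invertible_mat A" "A \<in> carrier_mat n m"
  obtains B where "n = m" "B \<in> carrier_mat m n" "A * B = 1\<^sub>m n" "B * A = 1\<^sub>m m"
proof -
  obtain B where inv: "inverts_mat A B" "inverts_mat B A" and sq: "square_mat A"
    using assms(1) unfolding invertible_mat_def by blast
  have B: "A * B = 1\<^sub>m n" "B * A = 1\<^sub>m (dim_row B)"
    using inv assms(2) unfolding inverts_mat_def by auto
  have cols: "dim_col B = n" using arg_cong[OF B(1), of dim_col] by simp
  have rows: "dim_row B = m" using arg_cong[OF B(2), of dim_col] assms(2) by simp
  show ?thesis
  proof (rule that)
    show "n = m" using sq assms(2) by simp
    show "B \<in> carrier_mat m n" using rows cols by (rule carrier_matI)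
    show "A * B = 1\<^sub>m n" "B * A = 1\<^sub>m m" using B rows by simp_all
  qed
qed

lemma rep_iso_iff:
  assumes M: "is_rep Q M" and N: "is_rep Q N"
  shows "rep_iso Q M N \<longleftrightarrow>
    (\<exists>u\<in>rep_homs Q M N. \<exists>v\<in>rep_homs Q N M. u * v = iden (dimv N) \<and> v * u = iden (dimv M))"
proof
  assume "rep_iso Q M N"
  then obtain f where f: "f \<in> rep_hom Q M N" "\<And>i. invertible_mat (f i)" by (auto simp: rep_iso_def)
  have fc: "f i \<in> carrier_mat (dimv N i) (dimv M i)" for i using f(1) by (auto simp: rep_hom_def)
  have "\<exists>B. B \<in> carrier_mat (dimv M i) (dimv N i) \<and> f i * B = 1\<^sub>m (dimv N i) \<and> B * f i = 1\<^sub>m (dimv M i)" for i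
    using invertible_matD[OF f(2) fc, of i] by blast
  then obtain g where g: "\<And>i. g i \<in> carrier_mat (dimv M i) (dimv N i)"
    "\<And>i. f i * g i = 1\<^sub>m (dimv N i)" "\<And>i. g i * f i = 1\<^sub>m (dimv M i)" by metis
  let ?u = "hom_fmat (dimv M) (dimv N) f" and ?v = "hom_fmat (dimv N) (dimv M) g"
  note u = hom_fmat_graded[where d = "dimv M" and d' = "dimv N" and f = f] and v = hom_fmat_graded[where d = "dimv N" and d' = "dimv M" and f = g]
  have uv: "?u * ?v = iden (dimv N)"
    by (rule graded_eqI[of _ "dimv N" "dimv N"])
      (auto simp: supported_vertex_support mult.assoc u v u(2)[THEN mult_assoc_eq]
        fmat_block_mult_left[OF u(1,3)] fmat_block_hom_fmat fc g fmat_block_iden)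
  have vu: "?v * ?u = iden (dimv M)"
    by (rule graded_eqI[of _ "dimv M" "dimv M"])
      (auto simp: supported_vertex_support mult.assoc u v v(2)[THEN mult_assoc_eq]
        fmat_block_mult_left[OF v(1,3)] fmat_block_hom_fmat fc g fmat_block_iden)
  have hu: "?u \<in> rep_homs Q M N" by (rule hom_fmat_in_homs[OF M N f(1)])
  note TM = quiver_objectD[OF quiver_object_arrow_fmat[of Q "dimv M" "maps M"]]
  note TN = quiver_objectD[OF quiver_object_arrow_fmat[of Q "dimv N" "maps N"]]
  \<comment> \<open>The vertexwise inverse commutes with the arrows automatically: insert
    \<open>?u * ?v\<close> and move \<open>?u\<close> past the arrows.\<close>
  have "?v * rep_fmat Q N = ?v * (rep_fmat Q N * (?u * ?v))" by (simp add: uv TN)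
  also have "\<dots> = ?v * (?u * rep_fmat Q M) * ?v" by (simp add: homsD(4)[OF hu] mult.assoc)
  also have "\<dots> = rep_fmat Q M * ?v" by (simp add: mult.assoc[symmetric] vu TM)
  finally have "?v \<in> rep_homs Q N M" using v by (intro homsI)
  then show "\<exists>u\<in>rep_homs Q M N. \<exists>v\<in>rep_homs Q N M. u * v = iden (dimv N) \<and> v * u = iden (dimv M)"
    using hu uv vu by blast
next
  assume "\<exists>u\<in>rep_homs Q M N. \<exists>v\<in>rep_homs Q N M. u * v = iden (dimv N) \<and> v * u = iden (dimv M)"
  then obtain u v where uv: "u \<in> rep_homs Q M N" "v \<in> rep_homs Q N M"
    "u * v = iden (dimv N)" "v * u = iden (dimv M)" by blast
  note u = homsD[OF uv(1)] and v = homsD[OF uv(2)]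
  have d: "dimv M = dimv N" by (rule iso_imp_dims_eq[OF u(1-3) v(1-3) uv(3,4)])
  have "invertible_mat (fmat_block u i i (dimv N i) (dimv M i))" for i
  proof -
    have "fmat_block u i i (dimv N i) (dimv M i) * fmat_block v i i (dimv M i) (dimv N i) = 1\<^sub>m (dimv N i)"
      using arg_cong[OF uv(3), of "\<lambda>A. fmat_block A i i (dimv N i) (dimv N i)"]
      by (simp add: fmat_block_mult_left[OF u(1,3)] fmat_block_iden)
    moreover have "fmat_block v i i (dimv M i) (dimv N i) * fmat_block u i i (dimv N i) (dimv M i) = 1\<^sub>m (dimv M i)"
      using arg_cong[OF uv(4), of "\<lambda>A. fmat_block A i i (dimv M i) (dimv M i)"]
      by (simp add: fmat_block_mult_left[OF v(1,3)] fmat_block_iden)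
    ultimately show ?thesis
      using d unfolding invertible_mat_def inverts_mat_def by auto
  qed
  then show "rep_iso Q M N"
    unfolding rep_iso_def by (intro bexI[OF _ fmat_block_in_rep_hom[OF M N uv(1)]]) simp
qed

section \<open>Comparison of the cokernel description of Ext^1 with Yoneda extensions\<close>

lemma mat_factor_through:
  fixes A W :: "complex mat"
  assumes "A \<in> carrier_mat n m" "W \<in> carrier_mat n k"
    and "\<And>s. s < k \<Longrightarrow> \<exists>v\<in>carrier_vec m. A *\<^sub>v v = col W s"
  shows "\<exists>X\<in>carrier_mat m k. A * X = W"
proof -
  obtain v where v: "\<And>s. s < k \<Longrightarrow> v s \<in> carrier_vec m \<and> A *\<^sub>v v s = col W s"
    using assms(3) by metis
  define X where "X = mat m k (\<lambda>(r, s). v s $ r)"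
  have X: "X \<in> carrier_mat m k" by (simp add: X_def)
  have "col X s = v s" if "s < k" for s using v[OF that] that by (auto simp: X_def)
  then have "col (A * X) s = col W s" if "s < k" for s
    using col_mult2[OF assms(1) X that] v[OF that] that by simp
  then have "A * X = W" using assms(1,2) X by (intro mat_col_eqI) auto
  then show ?thesis using X by blast
qed

text \<open>A short exact sequence splits linearly; the failure of a linear section to be a
  homomorphism is a cocycle, and a solution of the coboundary equation corrects the section.\<close>

lemma ext1_zero_if_ext_vanishes:
  assumes M: "is_rep Q M" and N: "is_rep Q N"
    and ext: "ext_vanishes Q (iden (dimv M)) (rep_fmat Q M) (iden (dimv N)) (rep_fmat Q N)"
  shows "ext1_zero Q M N"
  unfolding ext1_zero_def
proof (intro allI impI, elim conjE)
  fix E f g assume E: "is_rep Q E" and se: "short_exact Q N E M f g"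
  have f: "f \<in> rep_hom Q N E" and g: "g \<in> rep_hom Q E M"
    and ker: "\<And>i. (\<lambda>v. f i *\<^sub>v v) ` carrier_vec (dimv N i)
            = {v \<in> carrier_vec (dimv E i). g i *\<^sub>v v = 0\<^sub>v (dimv M i)}"
    and surj: "\<And>i. (\<lambda>v. g i *\<^sub>v v) ` carrier_vec (dimv E i) = carrier_vec (dimv M i)"
    using se unfolding short_exact_def by blast+
  have fc: "f i \<in> carrier_mat (dimv E i) (dimv N i)" and gc: "g i \<in> carrier_mat (dimv M i) (dimv E i)" for i
    using f g by (auto simp: rep_hom_def)
  let ?F = "hom_fmat (dimv N) (dimv E) f" and ?G = "hom_fmat (dimv E) (dimv M) g"
  have hF: "?F \<in> rep_homs Q N E" and hG: "?G \<in> rep_homs Q E M"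
    using hom_fmat_in_homs M N E f g by blast+
  note F = homsD[OF hF] and G = homsD[OF hG]
  note TE = quiver_objectD[OF quiver_object_arrow_fmat[of Q "dimv E" "maps E"]]
  note TM = quiver_objectD[OF quiver_object_arrow_fmat[of Q "dimv M" "maps M"]]
  have "\<exists>X\<in>carrier_mat (dimv E i) (dimv M i). g i * X = 1\<^sub>m (dimv M i)" for i
  proof (rule mat_factor_through[OF gc one_carrier_mat])
    fix s assume s: "s < dimv M i"
    have "unit_vec (dimv M i) s \<in> (\<lambda>v. g i *\<^sub>v v) ` carrier_vec (dimv E i)" unfolding surj by simp
    then show "\<exists>v\<in>carrier_vec (dimv E i). g i *\<^sub>v v = col (1\<^sub>m (dimv M i)) s" using s by auto
  qed
  then obtain sg where sg: "\<And>i. sg i \<in> carrier_mat (dimv E i) (dimv M i)" "\<And>i. g i * sg i = 1\<^sub>m (dimv M i)"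
    by metis
  let ?S = "hom_fmat (dimv M) (dimv E) sg"
  note S = hom_fmat_graded[where d = "dimv M" and d' = "dimv E" and f = sg]
  have GS: "?G * ?S = iden (dimv M)"
    by (rule graded_eqI[of _ "dimv M" "dimv M"])
      (auto simp: supported_vertex_support mult.assoc G(1-3) S G(2)[THEN mult_assoc_eq]
        fmat_block_mult_left[OF G(1,3)] fmat_block_hom_fmat gc sg fmat_block_iden)
  \<comment> \<open>The columns of \<open>1 - sg * g\<close> lie in the kernel of
    \<open>g i\<close>, which is the image of \<open>f i\<close>. The resulting \<open>R\<close> is
    the linear retraction that belongs to the section \<open>sg\<close>.\<close>
  have "\<exists>X\<in>carrier_mat (dimv N i) (dimv E i). f i * X = 1\<^sub>m (dimv E i) - sg i * g i" for i
  proof (rule mat_factor_through[OF fc])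
    show W: "1\<^sub>m (dimv E i) - sg i * g i \<in> carrier_mat (dimv E i) (dimv E i)"
      using sg(1)[of i] gc[of i] by auto
    fix s assume s: "s < dimv E i"
    let ?w = "col (1\<^sub>m (dimv E i) - sg i * g i) s"
    have "g i * (sg i * g i) = g i"
      using assoc_mult_mat[OF gc sg(1) gc, of i] sg(2)[of i] gc[of i] by simp
    then have "g i * (1\<^sub>m (dimv E i) - sg i * g i) = 0\<^sub>m (dimv M i) (dimv E i)"
      using mult_minus_distrib_mat[OF gc[of i] one_carrier_mat, of "sg i * g i"] sg(1)[of i] gc[of i]
      by auto
    then have "g i *\<^sub>v ?w = 0\<^sub>v (dimv M i)"
      using col_mult2[OF gc[of i] W s] s by simp
    moreover have "?w \<in> carrier_vec (dimv E i)" using col_carrier_vec[OF s W] .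
    ultimately have "?w \<in> (\<lambda>v. f i *\<^sub>v v) ` carrier_vec (dimv N i)" using ker[of i] by blast
    then show "\<exists>v\<in>carrier_vec (dimv N i). f i *\<^sub>v v = ?w" by (metis imageE)
  qed
  then obtain R where R: "\<And>i. R i \<in> carrier_mat (dimv N i) (dimv E i)"
    "\<And>i. f i * R i = 1\<^sub>m (dimv E i) - sg i * g i" by metis
  let ?R = "hom_fmat (dimv E) (dimv N) R"
  note Rg = hom_fmat_graded[where d = "dimv E" and d' = "dimv N" and f = R]
  have FR: "?F * ?R = iden (dimv E) - ?S * ?G"
  proof (rule graded_eqI[of _ "dimv E" "dimv E"])
    show "?F * ?R \<in> supported (vertex_support (dimv E) (dimv E))"
      "iden (dimv E) - ?S * ?G \<in> supported (vertex_support (dimv E) (dimv E))"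
      by (simp_all add: supported_vertex_support mult.assoc left_diff_distrib right_diff_distrib
          F(1-3) G(1-3) S Rg F(2)[THEN mult_assoc_eq] S(2)[THEN mult_assoc_eq])
    fix i
    have "fmat_block (iden (dimv E) - ?S * ?G) i i (dimv E i) (dimv E i)
        = fmat_block (iden (dimv E)) i i (dimv E i) (dimv E i) - fmat_block (?S * ?G) i i (dimv E i) (dimv E i)"
      by (rule eq_matI) auto
    then show "fmat_block (?F * ?R) i i (dimv E i) (dimv E i)
        = fmat_block (iden (dimv E) - ?S * ?G) i i (dimv E i) (dimv E i)"
      by (simp add: fmat_block_mult_left[OF F(1,3)] fmat_block_mult_left[OF S(1,3)]
          fmat_block_hom_fmat fc gc sg R fmat_block_iden)
  qed
  have gf: "g i * f i = 0\<^sub>m (dimv M i) (dimv N i)" for i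
  proof (rule mat_col_eqI)
    fix s assume "s < dim_col (0\<^sub>m (dimv M i) (dimv N i) :: complex mat)"
    then have s: "s < dimv N i" by simp
    have "f i *\<^sub>v unit_vec (dimv N i) s \<in> {v \<in> carrier_vec (dimv E i). g i *\<^sub>v v = 0\<^sub>v (dimv M i)}"
      unfolding ker[of i, symmetric] by (rule imageI) simp
    then have "g i *\<^sub>v (f i *\<^sub>v unit_vec (dimv N i) s) = 0\<^sub>v (dimv M i)" by simp
    then show "col (g i * f i) s = col (0\<^sub>m (dimv M i) (dimv N i)) s"
      using s col_mult2[OF gc[of i] fc[of i] s] col_mult2[OF fc[of i] one_carrier_mat s] fc[of i] by simp
  qed (use gc[of i] fc[of i] in auto)
  have GF: "?G * ?F = 0"
  proof (rule graded_eqI[of _ "dimv N" "dimv M"])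
    show "?G * ?F \<in> supported (vertex_support (dimv N) (dimv M))"
      "0 \<in> supported (vertex_support (dimv N) (dimv M))"
      by (simp_all add: supported_vertex_support mult.assoc F(1-3) G(1-3) G(2)[THEN mult_assoc_eq])
    show "fmat_block (?G * ?F) i i (dimv M i) (dimv N i) = fmat_block 0 i i (dimv M i) (dimv N i)" for i
      unfolding fmat_block_mult_left[OF G(1,3)]
      by (rule eq_matI) (simp_all add: fmat_block_hom_fmat fc gc gf)
  qed
  \<comment> \<open>\<open>?G\<close> kills this defect of the section, so it comes from the cocycle
    \<open>?R * ?D\<close> by applying \<open>?F\<close>.\<close>
  let ?D = "rep_fmat Q E * ?S - ?S * rep_fmat Q M"
  have "?G * ?D = rep_fmat Q M * (?G * ?S) - (?G * ?S) * rep_fmat Q M"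
    by (simp add: right_diff_distrib mult.assoc G(4)[THEN mult_assoc_eq])
  then have GD: "?G * ?D = 0" by (simp add: GS TM)
  have "?F * (?R * ?D) = (iden (dimv E) - ?S * ?G) * ?D" by (simp only: FR[symmetric] mult.assoc)
  also have "\<dots> = iden (dimv E) * ?D - ?S * (?G * ?D)" by (simp only: left_diff_distrib mult.assoc)
  also have "\<dots> = ?D"
    unfolding GD by (simp add: right_diff_distrib S(2)[THEN mult_assoc_eq] TE(4)[THEN mult_assoc_eq])
  finally have FRD: "?F * (?R * ?D) = ?D" .
  have "?R * ?D \<in> arrow_mats Q" "iden (dimv N) * (?R * ?D) = ?R * ?D" "?R * ?D * iden (dimv M) = ?R * ?D"
    using Rg S TE TM by (simp_all add: Rg(2)[THEN mult_assoc_eq] left_diff_distrib mult.assoc)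
  then obtain h where h: "h \<in> graded" "iden (dimv N) * h = h" "h * iden (dimv M) = h"
    "?R * ?D = h * rep_fmat Q M - rep_fmat Q N * h"
    using ext unfolding ext_vanishes_def by blast
  \<comment> \<open>The correction term lies in the image of \<open>?F\<close>, so \<open>?s\<close>
    is still a section of \<open>?G\<close>.\<close>
  let ?s = "?S + ?F * h"
  have "?F * (h * rep_fmat Q M - rep_fmat Q N * h) = ?D" by (simp only: h(4)[symmetric] FRD)
  then have "?F * h * rep_fmat Q M - rep_fmat Q E * (?F * h) = ?D"
    by (simp add: right_diff_distrib mult.assoc F(4)[THEN mult_assoc_eq])
  then have "?s * rep_fmat Q M = rep_fmat Q E * ?s"
    by (simp add: distrib_left distrib_right algebra_simps)
  then have s: "?s \<in> rep_homs Q M E"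
    using S F h by (intro homsI) (simp_all add: distrib_left distrib_right mult.assoc F(2)[THEN mult_assoc_eq])
  have Gs: "?G * ?s = iden (dimv M)" by (simp add: distrib_left GS mult.assoc[symmetric] GF)
  have "g i * fmat_block ?s i i (dimv E i) (dimv M i) = 1\<^sub>m (dimv M i)" for i
    using arg_cong[OF Gs, of "\<lambda>A. fmat_block A i i (dimv M i) (dimv M i)"]
    by (simp add: fmat_block_mult_left[OF G(1,3)] fmat_block_iden fmat_block_hom_fmat gc)
  then show "\<exists>s\<in>rep_hom Q M E. \<forall>i. g i * s i = 1\<^sub>m (dimv M i)"
    by (intro bexI[OF _ fmat_block_in_rep_hom[OF M E s]]) simp
qed

lemma hom_zero_if_homs_eq_0:
  assumes M: "is_rep Q M" and N: "is_rep Q N" and 0: "rep_homs Q M N = {0}"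
  shows "hom_zero Q M N"
  unfolding hom_zero_def
proof
  show "rep_hom Q M N \<subseteq> {\<lambda>i. 0\<^sub>m (dimv N i) (dimv M i)}"
  proof
    fix f assume f: "f \<in> rep_hom Q M N"
    then have "hom_fmat (dimv M) (dimv N) f = 0" using hom_fmat_in_homs[OF M N] 0 by blast
    then have "f i $$ (r, s) = 0" if "r < dimv N i" "s < dimv M i" for i r s
      using entry_hom_fmat[of "dimv M" "dimv N" f i r i s] that by simp
    moreover have fc: "f i \<in> carrier_mat (dimv N i) (dimv M i)" for i using f by (auto simp: rep_hom_def)
    ultimately have "f i = 0\<^sub>m (dimv N i) (dimv M i)" for i
      using carrier_matD[OF fc[of i]] by (intro eq_matI) auto
    then show "f \<in> {\<lambda>i. 0\<^sub>m (dimv N i) (dimv M i)}" by auto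
  qed
  have "(\<lambda>i. fmat_block 0 i i (dimv N i) (dimv M i)) \<in> rep_hom Q M N"
    using 0 by (intro fmat_block_in_rep_hom[OF M N]) auto
  moreover have "fmat_block 0 i i n m = 0\<^sub>m n m" for i :: 'a and n m by (rule eq_matI) auto
  ultimately show "{\<lambda>i. 0\<^sub>m (dimv N i) (dimv M i)} \<subseteq> rep_hom Q M N" by simp
qed

section \<open>Direct sums and decompositions\<close>

text \<open>Direct sums are described by inclusions and projections. This is invariant under
  isomorphism and keeps block matrices out of all later arguments.\<close>

definition binary_sum :: "('i::finite \<times> 'i) set \<Rightarrow> 'i quiver_rep \<Rightarrow> 'i quiver_rep \<Rightarrow> 'i quiver_rep
    \<Rightarrow> ('i \<times> nat) fmat \<Rightarrow> ('i \<times> nat) fmat \<Rightarrow> ('i \<times> nat) fmat \<Rightarrow> ('i \<times> nat) fmat \<Rightarrow> bool" where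
  "binary_sum Q M A B a a' b b' \<longleftrightarrow>
     a \<in> rep_homs Q A M \<and> a' \<in> rep_homs Q M A \<and> b \<in> rep_homs Q B M \<and> b' \<in> rep_homs Q M B \<and>
     a' * a = iden (dimv A) \<and> b' * b = iden (dimv B) \<and> a' * b = 0 \<and> b' * a = 0 \<and>
     a * a' + b * b' = iden (dimv M)"

definition biproduct :: "('i::finite \<times> 'i) set \<Rightarrow> 'i quiver_rep \<Rightarrow> 'i quiver_rep list
    \<Rightarrow> (nat \<Rightarrow> ('i \<times> nat) fmat) \<Rightarrow> (nat \<Rightarrow> ('i \<times> nat) fmat) \<Rightarrow> bool" where
  "biproduct Q M Ms a a' \<longleftrightarrow>
     (\<forall>k<length Ms. a k \<in> rep_homs Q (Ms ! k) M \<and> a' k \<in> rep_homs Q M (Ms ! k)) \<and>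
     (\<forall>k<length Ms. \<forall>l<length Ms. a' k * a l = (if k = l then iden (dimv (Ms ! k)) else 0)) \<and>
     (\<Sum>k<length Ms. a k * a' k) = iden (dimv M)"

lemma biproductD:
  assumes "biproduct Q M Ms a a'"
  shows "\<And>k. k < length Ms \<Longrightarrow> a k \<in> rep_homs Q (Ms ! k) M"
    "\<And>k. k < length Ms \<Longrightarrow> a' k \<in> rep_homs Q M (Ms ! k)"
    "\<And>k l. k < length Ms \<Longrightarrow> l < length Ms \<Longrightarrow> a' k * a l = (if k = l then iden (dimv (Ms ! k)) else 0)"
    "(\<Sum>k<length Ms. a k * a' k) = iden (dimv M)"
  using assms by (simp_all add: biproduct_def)

lemma biproduct_comparison:
  assumes "biproduct Q M Ms a a'" "biproduct Q N Ms b b'"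
  shows "(\<Sum>k<length Ms. a k * b' k) * (\<Sum>k<length Ms. b k * a' k) = iden (dimv M)"
proof -
  note a = biproductD[OF assms(1)] and b = biproductD[OF assms(2)]
  have "(\<Sum>k<length Ms. a k * b' k) * (\<Sum>k<length Ms. b k * a' k)
    = (\<Sum>k<length Ms. \<Sum>l<length Ms. a k * (b' k * b l) * a' l)"
    by (simp add: sum_product mult.assoc)
  also have "\<dots> = (\<Sum>k<length Ms. \<Sum>l<length Ms. if l = k then a k * a' k else 0)"
    using b(3) homsD(3)[OF a(1)] by (intro sum.cong) auto
  also have "\<dots> = iden (dimv M)" using a(4) by simp
  finally show ?thesis .
qed

lemma homs_sum: "(\<And>k. k \<in> S \<Longrightarrow> f k \<in> homs e T e' T') \<Longrightarrow> sum f S \<in> homs e T e' T'"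
  by (rule fm.subspace_sum[OF subspace_homs])

lemma biproduct_unique:
  assumes "is_rep Q M" "is_rep Q N" "biproduct Q M Ms a a'" "biproduct Q N Ms b b'"
  shows "rep_iso Q M N"
  unfolding rep_iso_iff[OF assms(1,2)]
proof (intro bexI conjI)
  show "(\<Sum>k<length Ms. b k * a' k) * (\<Sum>k<length Ms. a k * b' k) = iden (dimv N)"
    "(\<Sum>k<length Ms. a k * b' k) * (\<Sum>k<length Ms. b k * a' k) = iden (dimv M)"
    using biproduct_comparison assms(3,4) by blast+
  show "(\<Sum>k<length Ms. b k * a' k) \<in> rep_homs Q M N" "(\<Sum>k<length Ms. a k * b' k) \<in> rep_homs Q N M"
    using biproductD(1,2)[OF assms(3)] biproductD(1,2)[OF assms(4)]
    by (auto intro!: homs_sum homs_comp)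
qed

lemma biproduct_iso:
  assumes "is_rep Q M" "is_rep Q N" "rep_iso Q M N" "biproduct Q N Ms b b'"
  shows "\<exists>a a'. biproduct Q M Ms a a'"
proof -
  obtain u v where u: "u \<in> rep_homs Q M N" "v \<in> rep_homs Q N M"
    "u * v = iden (dimv N)" "v * u = iden (dimv M)"
    using assms(3) unfolding rep_iso_iff[OF assms(1,2)] by blast
  note b = biproductD[OF assms(4)]
  have "b' k * u * (v * b l) = b' k * b l" if "k < length Ms" for k l
  proof -
    have "b' k * u * (v * b l) = b' k * iden (dimv N) * b l" by (simp only: u(3)[symmetric] mult.assoc)
    then show ?thesis using homsD(3)[OF b(2)[OF that]] by simp
  qed
  moreover have "(\<Sum>k<length Ms. v * b k * (b' k * u)) = iden (dimv M)"
  proof -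
    have "(\<Sum>k<length Ms. v * b k * (b' k * u)) = v * (\<Sum>k<length Ms. b k * b' k) * u"
      by (simp add: sum_distrib_left sum_distrib_right mult.assoc)
    then show ?thesis using u(4) homsD(3)[OF u(2)] b(4) by simp
  qed
  ultimately have "biproduct Q M Ms (\<lambda>k. v * b k) (\<lambda>k. b' k * u)"
    unfolding biproduct_def using b u by (auto intro!: homs_comp)
  then show ?thesis by blast
qed

lemma biproduct_Nil: "zero_rep M \<Longrightarrow> biproduct Q M [] a a'"
  by (auto simp: biproduct_def zero_rep_def intro!: fmat_eqI)

lemma biproduct_Cons:
  assumes s: "binary_sum Q M A B a a' b b'" and B: "biproduct Q B Ms c c'"
  shows "biproduct Q M (A # Ms) (case_nat a (\<lambda>k. b * c k)) (case_nat a' (\<lambda>k. c' k * b'))"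
  unfolding biproduct_def
proof (intro conjI allI impI)
  have ab: "a \<in> rep_homs Q A M" "a' \<in> rep_homs Q M A" "b \<in> rep_homs Q B M" "b' \<in> rep_homs Q M B"
    "a' * a = iden (dimv A)" "b' * b = iden (dimv B)" "a' * b = 0" "b' * a = 0"
    "a * a' + b * b' = iden (dimv M)"
    using s by (simp_all add: binary_sum_def)
  note c = biproductD[OF B]
  fix k assume k: "k < length (A # Ms)"
  show "case_nat a (\<lambda>k. b * c k) k \<in> rep_homs Q ((A # Ms) ! k) M"
    "case_nat a' (\<lambda>k. c' k * b') k \<in> rep_homs Q M ((A # Ms) ! k)"
    using ab k c(1,2) by (auto split: nat.split intro!: homs_comp)
  fix l assume l: "l < length (A # Ms)"
  have "c' k * b' * (b * c l) = c' k * c l" if "k < length Ms" for k l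
  proof -
    have "c' k * b' * (b * c l) = c' k * (b' * b) * c l" by (simp only: mult.assoc)
    then show ?thesis using homsD(3)[OF c(2)[OF that]] ab(6) by simp
  qed
  moreover have "a' * (b * c l) = 0" "c' k * b' * a = 0" for k l
    by (simp add: mult.assoc[symmetric] ab(7)) (simp add: mult.assoc ab(8))
  ultimately show "case_nat a' (\<lambda>k. c' k * b') k * case_nat a (\<lambda>k. b * c k) l
      = (if k = l then iden (dimv ((A # Ms) ! k)) else 0)"
    using k l c(3) ab(5) by (auto split: nat.split)
next
  have ab: "b \<in> rep_homs Q B M" "a * a' + b * b' = iden (dimv M)"
    using s by (simp_all add: binary_sum_def)
  have "(\<Sum>k<length Ms. b * c k * (c' k * b')) = b * (\<Sum>k<length Ms. c k * c' k) * b'"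
    by (simp add: sum_distrib_left sum_distrib_right mult.assoc)
  also have "\<dots> = b * b'" using biproductD(4)[OF B] homsD(3)[OF ab(1)] by simp
  finally show "(\<Sum>k<length (A # Ms). case_nat a (\<lambda>k. b * c k) k * case_nat a' (\<lambda>k. c' k * b') k)
      = iden (dimv M)"
    using ab(2) by (simp add: lessThan_Suc_eq_insert_0 sum.reindex o_def)
qed

text \<open>The inclusion of the second summand, whose basis vectors are placed after the first
  \<open>d1\<close> ones. Its transpose \<open>unshift_fmat\<close> is the projection.\<close>

lift_definition shift_fmat :: "('i::finite \<Rightarrow> nat) \<Rightarrow> ('i \<Rightarrow> nat) \<Rightarrow> ('i \<times> nat) fmat"
  is "\<lambda>d1 d2 x y. if fst x = fst y \<and> snd x = d1 (fst y) + snd y \<and> snd y < d2 (fst y) then 1 else 0"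
  subgoal for d1 d2
    by (rule finite_subset[of _ "(\<lambda>(i, s). ((i, d1 i + s), (i, s))) ` (SIGMA i:UNIV. {..<d2 i})"])
      (auto split: if_splits simp: image_iff)
  done

lift_definition unshift_fmat :: "('i::finite \<Rightarrow> nat) \<Rightarrow> ('i \<Rightarrow> nat) \<Rightarrow> ('i \<times> nat) fmat"
  is "\<lambda>d1 d2 y x. if fst x = fst y \<and> snd x = d1 (fst y) + snd y \<and> snd y < d2 (fst y) then 1 else 0"
  subgoal for d1 d2
    by (rule finite_subset[of _ "(\<lambda>(i, s). ((i, s), (i, d1 i + s))) ` (SIGMA i:UNIV. {..<d2 i})"])
      (auto split: if_splits simp: image_iff)
  done

lemma entry_shift_mult: "entry (shift_fmat d1 d2 * A) (j, r) y
    = (if d1 j \<le> r \<and> r - d1 j < d2 j then entry A (j, r - d1 j) y else 0)"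
  by (subst entry_mult_left[of "{(j, r - d1 j)}"]) (auto simp: shift_fmat.rep_eq split: if_splits)

lemma entry_mult_shift: "entry (A * shift_fmat d1 d2) x (i, s)
    = (if s < d2 i then entry A x (i, d1 i + s) else 0)"
  by (subst entry_mult_right[of "{(i, d1 i + s)}"]) (auto simp: shift_fmat.rep_eq split: if_splits)

lemma entry_unshift_mult: "entry (unshift_fmat d1 d2 * A) (j, r) y
    = (if r < d2 j then entry A (j, d1 j + r) y else 0)"
  by (subst entry_mult_left[of "{(j, d1 j + r)}"]) (auto simp: unshift_fmat.rep_eq split: if_splits)

lemma entry_mult_unshift: "entry (A * unshift_fmat d1 d2) x (i, s)
    = (if d1 i \<le> s \<and> s - d1 i < d2 i then entry A x (i, s - d1 i) else 0)"
  by (subst entry_mult_right[of "{(i, s - d1 i)}"]) (auto simp: unshift_fmat.rep_eq split: if_splits)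

lemma shift_fmat_graded: "shift_fmat d1 d2 \<in> graded" "unshift_fmat d1 d2 \<in> graded"
  by (auto simp: graded_def supported_def shift_fmat.rep_eq unshift_fmat.rep_eq split: if_splits)

lemma direct_sum_Nil: "is_rep Q (direct_sum Q [])" "zero_rep (direct_sum Q [])"
  by (auto simp: direct_sum_def is_rep_def rep_space_def zero_rep_def)

lemma direct_sum_Cons:
  fixes Q :: "('i::finite \<times> 'i) set"
  assumes M: "is_rep Q M" and N: "is_rep Q (direct_sum Q Ms)"
  shows "is_rep Q (direct_sum Q (M # Ms))"
    and "\<exists>a a' b b'. binary_sum Q (direct_sum Q (M # Ms)) M (direct_sum Q Ms) a a' b b'"
proof -
  let ?N = "direct_sum Q Ms" and ?S = "direct_sum Q (M # Ms)"
  let ?d1 = "dimv M" and ?d2 = "dimv ?N"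
  have dS: "dimv ?S = (\<lambda>i. ?d1 i + ?d2 i)" by (simp add: direct_sum_def)
  have mS: "maps ?S (i, j) = four_block_mat (maps M (i, j)) (0\<^sub>m (?d1 j) (?d2 i))
      (0\<^sub>m (?d2 j) (?d1 i)) (maps ?N (i, j))" if ij: "(i, j) \<in> Q" for i j
    using maps_carrier[OF M ij] maps_carrier[OF N ij] ij by (auto simp: direct_sum_def Let_def)
  have "maps ?S (i, j) \<in> carrier_mat (dimv ?S j) (dimv ?S i)" if "(i, j) \<in> Q" for i j
    unfolding mS[OF that] dS using maps_carrier[OF M that] maps_carrier[OF N that] by simp
  moreover have "maps ?S \<in> extensional Q" by (simp add: direct_sum_def)
  ultimately show "is_rep Q ?S"
    unfolding is_rep_def rep_space_def by (auto simp: PiE_def)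
  have TS: "entry (rep_fmat Q ?S) (j, r) (i, s) =
      (if r < ?d1 j \<and> s < ?d1 i then entry (rep_fmat Q M) (j, r) (i, s)
       else if ?d1 j \<le> r \<and> ?d1 i \<le> s then entry (rep_fmat Q ?N) (j, r - ?d1 j) (i, s - ?d1 i) else 0)"
    for i j r s
  proof (cases "(i, j) \<in> Q")
    case True
    then show ?thesis
      using maps_carrier[OF M True] maps_carrier[OF N True] by (auto simp: mS dS)
  qed simp
  have zeros: "\<not> r < ?d1 j \<Longrightarrow> entry (rep_fmat Q M) (j, r) y = 0"
    "\<not> s < ?d1 i \<Longrightarrow> entry (rep_fmat Q M) x (i, s) = 0"
    "\<not> r < ?d2 j \<Longrightarrow> entry (rep_fmat Q ?N) (j, r) y = 0"
    "\<not> s < ?d2 i \<Longrightarrow> entry (rep_fmat Q ?N) x (i, s) = 0" for i j r s x y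
    by (cases x; cases y; simp)+
  \<comment> \<open>The first summand occupies the leading indices, so \<open>iden ?d1\<close> is
    both its inclusion and its projection.\<close>
  let ?a = "iden ?d1" and ?b = "shift_fmat ?d1 ?d2" and ?b' = "unshift_fmat ?d1 ?d2"
  have "?a \<in> rep_homs Q M ?S"
    by (rule homsI; (rule fmat_eqI_pairs)?) (auto simp: entry_iden_mult entry_mult_iden dS TS[unfolded dS] zeros simp del: entry_arrow_fmat)
  moreover have "?a \<in> rep_homs Q ?S M"
    by (rule homsI; (rule fmat_eqI_pairs)?) (auto simp: entry_iden_mult entry_mult_iden dS TS[unfolded dS] zeros simp del: entry_arrow_fmat)
  moreover have "?b \<in> rep_homs Q ?N ?S"
    by (rule homsI; (rule fmat_eqI_pairs)?)
      (auto simp: shift_fmat_graded entry_iden_mult entry_mult_iden entry_shift_mult entry_mult_shift dS TS[unfolded dS] zeros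
        shift_fmat.rep_eq simp del: entry_arrow_fmat)
  moreover have "?b' \<in> rep_homs Q ?S ?N"
    by (rule homsI; (rule fmat_eqI_pairs)?)
      (auto simp: shift_fmat_graded entry_iden_mult entry_mult_iden entry_unshift_mult entry_mult_unshift dS TS[unfolded dS] zeros
        unshift_fmat.rep_eq simp del: entry_arrow_fmat)
  moreover have "?b' * ?b = iden ?d2"
    by (rule fmat_eqI_pairs) (auto simp: entry_unshift_mult shift_fmat.rep_eq)
  moreover have "?a * ?b = 0" "?b' * ?a = 0"
    by (rule fmat_eqI_pairs, auto simp: entry_iden_mult entry_mult_iden shift_fmat.rep_eq unshift_fmat.rep_eq)+
  moreover have "?a * ?a + ?b * ?b' = iden (dimv ?S)"
    by (rule fmat_eqI_pairs) (auto simp: entry_shift_mult unshift_fmat.rep_eq dS)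
  ultimately have "binary_sum Q ?S M ?N ?a ?a ?b ?b'" by (simp add: binary_sum_def)
  then show "\<exists>a a' b b'. binary_sum Q ?S M ?N a a' b b'" by blast
qed

lemma biproduct_direct_sum:
  assumes "\<forall>N\<in>set Ms. is_rep Q N"
  shows "is_rep Q (direct_sum Q Ms) \<and> (\<exists>a a'. biproduct Q (direct_sum Q Ms) Ms a a')"
  using assms
proof (induction Ms)
  case Nil
  then show ?case using direct_sum_Nil biproduct_Nil by blast
next
  case (Cons M Ms)
  then have M: "is_rep Q M" and N: "is_rep Q (direct_sum Q Ms)"
    and bi: "\<exists>a a'. biproduct Q (direct_sum Q Ms) Ms a a'" by auto
  show ?case using direct_sum_Cons[OF M N] bi biproduct_Cons by blast
qed

lemma rep_iso_direct_sum_iff: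
  assumes M: "is_rep Q M" and Ms: "\<forall>N\<in>set Ms. is_rep Q N"
  shows "rep_iso Q M (direct_sum Q Ms) \<longleftrightarrow> (\<exists>a a'. biproduct Q M Ms a a')"
  using biproduct_direct_sum[OF Ms] biproduct_iso[OF M] biproduct_unique[OF M] by blast

lemma rep_iso_dims:
  fixes Q :: "('i::finite \<times> 'i) set"
  assumes "is_rep Q M" "is_rep Q N" "rep_iso Q M N"
  shows "dimv M = dimv N"
proof -
  obtain u v where uv: "u \<in> rep_homs Q M N" "v \<in> rep_homs Q N M"
    "u * v = iden (dimv N)" "v * u = iden (dimv M)"
    using assms(3) unfolding rep_iso_iff[OF assms(1,2)] by blast
  show ?thesis by (rule iso_imp_dims_eq[OF homsD(1-3)[OF uv(1)] homsD(1-3)[OF uv(2)] uv(3,4)])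
qed

lemma binary_sum_rep_iso:
  assumes "is_rep Q M" "is_rep Q A" "is_rep Q B" "binary_sum Q M A B a a' b b'"
  shows "rep_iso Q M (direct_sum Q [A, B])"
proof -
  obtain z :: "'a quiver_rep" where z: "is_rep Q z" "zero_rep z" using direct_sum_Nil by blast
  have 0: "iden (dimv z) = 0" using z(2) by (auto simp: zero_rep_def intro!: fmat_eqI)
  have "binary_sum Q B B z (iden (dimv B)) (iden (dimv B)) 0 0"
    using quiver_objectD[OF quiver_object_arrow_fmat[of Q "dimv B" "maps B"]]
    by (simp add: binary_sum_def homs_def 0)
  from biproduct_Cons[OF this biproduct_Nil[OF z(2)]] biproduct_Cons[OF assms(4)]
  have "\<exists>c c'. biproduct Q M [A, B] c c'" by blast
  then show ?thesis using rep_iso_direct_sum_iff[OF assms(1), of "[A, B]"] assms(2,3) by auto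
qed

section \<open>Splitting idempotents and decomposing into indecomposables\<close>

lemma idempotent_splits:
  fixes M :: "'i::finite quiver_rep"
  assumes p: "p \<in> rep_homs Q M M" "p * p = p"
  obtains A b b' where "is_rep Q A" "b \<in> rep_homs Q A M" "b' \<in> rep_homs Q M A"
    "b * b' = p" "b' * b = iden (dimv A)" "p * b = b" "b' * p = b'"
proof -
  let ?T = "rep_fmat Q M"
  note pD = homsD[OF p(1)]
  obtain d T' b b' where ob: "quiver_object Q (iden d) T'" and
    b: "b \<in> homs (iden d) T' p (?T * p)" and b': "b' \<in> homs p (?T * p) (iden d) T'" and
    bb': "b * b' = p" and b'b: "b' * b = iden d"
    by (rule coordinate_object[OF quiver_object_summand[OF quiver_object_arrow_fmat p]])
  note bD = homsD[OF b] and b'D = homsD[OF b']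
  let ?A = "fmat_rep Q d T'"
  have "b \<in> rep_homs Q ?A M"
    unfolding fmat_rep_simps arrow_fmat_fmat_rep[OF ob]
  proof (rule homsI)
    show "iden (dimv M) * b = b" by (metis bD(2) mult.assoc pD(2))
    show "b * T' = ?T * b" using bD(2,4) by (simp add: mult.assoc)
  qed (use bD in auto)
  moreover have "b' \<in> rep_homs Q M ?A"
    unfolding fmat_rep_simps arrow_fmat_fmat_rep[OF ob]
  proof (rule homsI)
    show "b' * iden (dimv M) = b'" by (metis b'D(3) mult.assoc pD(3))
    have "b' * ?T = b' * (p * ?T)" using b'D(3) by (simp add: mult.assoc[symmetric])
    then show "b' * ?T = T' * b'" using b'D(4) pD(4) by simp
  qed (use b'D in auto)
  ultimately show ?thesis using that[of ?A b b'] bb' b'b bD(2) b'D(3) by simp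
qed

text \<open>The complement is the image of the idempotent endomorphism
  \<open>1 - a * a'\<close>.\<close>

lemma retract_is_summand:
  fixes M :: "'i::finite quiver_rep"
  assumes a: "a \<in> rep_homs Q A M" "a' \<in> rep_homs Q M A" "a' * a = iden (dimv A)"
  obtains B b b' where "is_rep Q B" "binary_sum Q M A B a a' b b'"
proof -
  note T = quiver_objectD[OF quiver_object_arrow_fmat[of Q "dimv M" "maps M"]]
  define p where "p = iden (dimv M) - a * a'"
  note aD = homsD[OF a(1)] and a'D = homsD[OF a(2)]
  have "iden (dimv M) \<in> rep_homs Q M M" using T by (simp add: homs_def)
  then have p: "p \<in> rep_homs Q M M"
    unfolding p_def using fm.subspace_diff[OF subspace_homs] homs_comp[OF a(2,1)] by blast
  have a'p: "a' * p = 0"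
    unfolding p_def by (simp add: right_diff_distrib mult.assoc[symmetric] a(3) a'D)
  have pa: "p * a = 0" unfolding p_def by (simp add: left_diff_distrib mult.assoc a(3) aD)
  have pp: "p * p = p"
    by (subst (2) p_def) (simp add: right_diff_distrib mult.assoc[symmetric] pa homsD(3)[OF p])
  obtain B b b' where B: "is_rep Q B" and b: "b \<in> rep_homs Q B M" "b' \<in> rep_homs Q M B" and
    bb': "b * b' = p" and b'b: "b' * b = iden (dimv B)" and pb: "p * b = b" "b' * p = b'"
    by (rule idempotent_splits[OF p pp])
  have "a' * b = 0" by (metis a'p pb(1) mult.assoc mult_zero_left)
  moreover have "b' * a = 0" by (metis pa pb(2) mult.assoc mult_zero_right)
  moreover have "a * a' + b * b' = iden (dimv M)" by (simp add: bb' p_def)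
  ultimately have "binary_sum Q M A B a a' b b'"
    using a b b'b by (simp add: binary_sum_def)
  then show ?thesis using that B by blast
qed

lemma binary_sum_dims:
  assumes "binary_sum Q M A B a a' b b'" "is_rep Q M" "is_rep Q A" "is_rep Q B"
  shows "dimv M = (\<lambda>i. dimv A i + dimv B i)"
proof -
  have "is_rep Q (direct_sum Q [A, B])" using biproduct_direct_sum[of "[A, B]" Q] assms by auto
  then have "dimv M = dimv (direct_sum Q [A, B])"
    by (rule rep_iso_dims[OF assms(2) _ binary_sum_rep_iso[OF assms(2-4,1)]])
  then show ?thesis by (simp add: direct_sum_def)
qed

lemma zero_rep_iden: "zero_rep M \<Longrightarrow> iden (dimv M) = 0"
  by (auto simp: zero_rep_def iden_eq_0_iff)

text \<open>The image of \<open>p\<close> and the image of the complementary idempotent form a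
  direct sum decomposition of \<open>N\<close>, so one of them is zero.\<close>

lemma no_idempotents_if_indecomposable:
  assumes "indecomposable Q N"
  shows "no_idempotents (iden (dimv N)) (rep_fmat Q N)"
  unfolding no_idempotents_def
proof (intro conjI ballI impI)
  have N: "is_rep Q N" "\<not> zero_rep N" using assms by (auto simp: indecomposable_def)
  show "iden (dimv N) \<noteq> 0" using N(2) by (auto simp: iden_eq_0_iff zero_rep_def)
  fix p assume p: "p \<in> rep_homs Q N N" and pp: "p * p = p"
  obtain A b b' where A: "is_rep Q A" and b: "b \<in> rep_homs Q A N" "b' \<in> rep_homs Q N A" and
    bb': "b * b' = p" and b'b: "b' * b = iden (dimv A)"
    by (rule idempotent_splits[OF p pp])
  obtain B c c' where B: "is_rep Q B" and s: "binary_sum Q N A B b b' c c'"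
    by (rule retract_is_summand[OF b b'b])
  have "rep_iso Q N (direct_sum Q [A, B])" by (rule binary_sum_rep_iso[OF N(1) A B s])
  then have "zero_rep A \<or> zero_rep B" using assms A B by (auto simp: indecomposable_def)
  then show "p = 0 \<or> p = iden (dimv N)"
  proof
    assume "zero_rep A"
    then have "iden (dimv A) = 0" by (rule zero_rep_iden)
    then have "b = 0" using homsD(3)[OF b(1)] by simp
    then show ?thesis using bb' by simp
  next
    assume "zero_rep B"
    then have "iden (dimv B) = 0" by (rule zero_rep_iden)
    moreover have "c * iden (dimv B) = c" using s by (simp add: binary_sum_def homs_def)
    ultimately have "c = 0" by simp
    then show ?thesis using s bb' by (simp add: binary_sum_def)
  qed
qed

lemma iden_in_rep_homs: "iden (dimv M) \<in> rep_homs Q M M"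
  using quiver_objectD[OF quiver_object_arrow_fmat[of Q "dimv M" "maps M"]] by (simp add: homs_def)

lemma total_dim_less:
  fixes M :: "'i::finite quiver_rep"
  assumes "dimv M = (\<lambda>i. dimv A i + dimv B i)" "\<not> zero_rep B"
  shows "(\<Sum>i\<in>UNIV. dimv A i) < (\<Sum>i\<in>UNIV. dimv M i)"
proof -
  obtain i where "dimv B i \<noteq> 0" using assms(2) by (auto simp: zero_rep_def)
  moreover have "dimv B i \<le> (\<Sum>i\<in>UNIV. dimv B i)" by (rule member_le_sum) auto
  ultimately show ?thesis by (simp add: assms(1) sum.distrib)
qed

text \<open>A decomposable representation has a nonzero retract of smaller total dimension, and
  retracts compose.\<close>

lemma indecomposable_retract_exists:
  fixes M :: "'i::finite quiver_rep"
  assumes "is_rep Q M" "\<not> zero_rep M"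
  shows "\<exists>A a a'. indecomposable Q A \<and> a \<in> rep_homs Q A M \<and> a' \<in> rep_homs Q M A \<and> a' * a = iden (dimv A)"
  using assms
proof (induction "\<Sum>i\<in>UNIV. dimv M i" arbitrary: M rule: less_induct)
  case less
  show ?case
  proof (cases "indecomposable Q M")
    case True
    then show ?thesis using iden_in_rep_homs[of M Q] iden_mult_iden by blast
  next
    case False
    then obtain X Y where X: "is_rep Q X" "\<not> zero_rep X" and Y: "is_rep Q Y" "\<not> zero_rep Y"
      and iso: "rep_iso Q M (direct_sum Q [X, Y])"
      using less.prems by (auto simp: indecomposable_def)
    have XY: "\<forall>N\<in>set [X, Y]. is_rep Q N" using X Y by simp
    obtain b b' where bi: "biproduct Q M [X, Y] b b'"
      using iso unfolding rep_iso_direct_sum_iff[OF less.prems(1) XY] by blast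
    have "dimv M = dimv (direct_sum Q [X, Y])"
      using rep_iso_dims[OF less.prems(1) _ iso] biproduct_direct_sum[OF XY] by blast
    then have "dimv M = (\<lambda>i. dimv X i + dimv Y i)" by (simp add: direct_sum_def)
    then have "(\<Sum>i\<in>UNIV. dimv X i) < (\<Sum>i\<in>UNIV. dimv M i)" using Y(2) by (rule total_dim_less)
    from less.hyps[OF this X] obtain A a a' where A: "indecomposable Q A" "a \<in> rep_homs Q A X"
      "a' \<in> rep_homs Q X A" "a' * a = iden (dimv A)" by blast
    have b: "b 0 \<in> rep_homs Q X M" "b' 0 \<in> rep_homs Q M X" "b' 0 * b 0 = iden (dimv X)"
      using biproductD(1-3)[OF bi, of 0] biproductD(3)[OF bi, of 0 0] by auto
    have "(a' * b' 0) * (b 0 * a) = a' * (b' 0 * b 0) * a" by (simp only: mult.assoc)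
    then have "(a' * b' 0) * (b 0 * a) = iden (dimv A)" using A(4) homsD(3)[OF A(3)] b(3) by simp
    then show ?thesis using A(1) homs_comp[OF A(2) b(1)] homs_comp[OF b(2) A(3)] by blast
  qed
qed

lemma decomposition_exists:
  fixes M :: "'i::finite quiver_rep"
  assumes "is_rep Q M"
  shows "\<exists>Ms. decomposition Q M Ms"
proof -
  have "\<exists>Ms a a'. (\<forall>N\<in>set Ms. indecomposable Q N) \<and> biproduct Q M Ms a a'"
    using assms
  proof (induction "\<Sum>i\<in>UNIV. dimv M i" arbitrary: M rule: less_induct)
    case less
    show ?case
    proof (cases "zero_rep M")
      case True
      then show ?thesis using biproduct_Nil[of M Q] by (intro exI[of _ "[]"]) auto
    next
      case False
      then obtain A a a' where A: "indecomposable Q A" and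
        a: "a \<in> rep_homs Q A M" "a' \<in> rep_homs Q M A" "a' * a = iden (dimv A)"
        using indecomposable_retract_exists[OF less.prems] by blast
      obtain B b b' where B: "is_rep Q B" and s: "binary_sum Q M A B a a' b b'"
        by (rule retract_is_summand[OF a])
      have Ar: "is_rep Q A" "\<not> zero_rep A" using A by (auto simp: indecomposable_def)
      have "dimv M = (\<lambda>i. dimv B i + dimv A i)"
        using binary_sum_dims[OF s less.prems Ar(1) B] by (simp add: add.commute)
      then have "(\<Sum>i\<in>UNIV. dimv B i) < (\<Sum>i\<in>UNIV. dimv M i)" using Ar(2) by (rule total_dim_less)
      from less.hyps[OF this B] obtain Ms c c' where
        "\<forall>N\<in>set Ms. indecomposable Q N" "biproduct Q B Ms c c'" by blast
      then show ?thesis using biproduct_Cons[OF s] A by (metis set_ConsD)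
    qed
  qed
  then obtain Ms where Ms: "\<forall>N\<in>set Ms. indecomposable Q N" "\<exists>a a'. biproduct Q M Ms a a'" by blast
  then have "\<forall>N\<in>set Ms. is_rep Q N" by (auto simp: indecomposable_def)
  then have "rep_iso Q M (direct_sum Q Ms)" using Ms(2) rep_iso_direct_sum_iff[OF assms] by blast
  then show ?thesis using Ms(1) unfolding decomposition_def by blast
qed

section \<open>Open orbits\<close>

lemma rep_iso_sym:
  fixes Q :: "('i::finite \<times> 'i) set"
  assumes "is_rep Q M" "is_rep Q N" "rep_iso Q M N"
  shows "rep_iso Q N M"
  using assms(3) unfolding rep_iso_iff[OF assms(1,2)] rep_iso_iff[OF assms(2,1)] by blast

lemma rep_iso_refl:
  fixes Q :: "('i::finite \<times> 'i) set"
  assumes "is_rep Q M"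
  shows "rep_iso Q M M"
  using iden_in_rep_homs[of M Q] iden_mult_iden unfolding rep_iso_iff[OF assms assms] by blast

lemma rep_iso_trans:
  fixes Q :: "('i::finite \<times> 'i) set"
  assumes "is_rep Q L" "is_rep Q M" "is_rep Q N" "rep_iso Q L M" "rep_iso Q M N"
  shows "rep_iso Q L N"
proof -
  obtain u v where u: "u \<in> rep_homs Q L M" "v \<in> rep_homs Q M L"
    "u * v = iden (dimv M)" "v * u = iden (dimv L)"
    using assms(4) unfolding rep_iso_iff[OF assms(1,2)] by blast
  obtain x y where x: "x \<in> rep_homs Q M N" "y \<in> rep_homs Q N M"
    "x * y = iden (dimv N)" "y * x = iden (dimv M)"
    using assms(5) unfolding rep_iso_iff[OF assms(2,3)] by blast
  have "x * u * (v * y) = x * (u * v) * y" "v * y * (x * u) = v * (y * x) * u" by (simp_all only: mult.assoc)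
  then have "x * u * (v * y) = iden (dimv N)" "v * y * (x * u) = iden (dimv L)"
    using u x homsD(3)[OF x(1)] homsD(3)[OF u(2)] by simp_all
  then show ?thesis
    using homs_comp[OF u(1) x(1)] homs_comp[OF x(2) u(2)] unfolding rep_iso_iff[OF assms(1,3)] by blast
qed

abbreviation rep_of :: "('i \<Rightarrow> nat) \<Rightarrow> ('i \<times> 'i \<Rightarrow> complex mat) \<Rightarrow> 'i quiver_rep" where
  "rep_of d m \<equiv> \<lparr>dimv = d, maps = m\<rparr>"

lemma is_rep_rep_of[simp]: "is_rep Q (rep_of d m) \<longleftrightarrow> m \<in> rep_space Q d"
  by (simp add: is_rep_def)

text \<open>The group acts by change of bases, so orbits are isomorphism classes; this moves
  questions about orbits into the matrix ring.\<close>

lemma gl_orbit_iff: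
  fixes Q :: "('i::finite \<times> 'i) set"
  assumes m: "m \<in> rep_space Q d"
  shows "m' \<in> gl_orbit Q d m \<longleftrightarrow> m' \<in> rep_space Q d \<and> rep_iso Q (rep_of d m) (rep_of d m')"
proof
  have mc: "m (i, j) \<in> carrier_mat (d j) (d i)" if "(i, j) \<in> Q" for i j
    using maps_carrier[of Q "rep_of d m"] m that by simp
  assume "m' \<in> gl_orbit Q d m"
  then obtain g g' where m': "m' = (\<lambda>(i, j)\<in>Q. g j * m (i, j) * g' i)" and
    g: "\<And>i. g i \<in> carrier_mat (d i) (d i)" "\<And>i. g' i \<in> carrier_mat (d i) (d i)"
    "\<And>i. g i * g' i = 1\<^sub>m (d i)" "\<And>i. g' i * g i = 1\<^sub>m (d i)"
    unfolding gl_orbit_def by blast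
  have m'_eq: "m' (i, j) = g j * m (i, j) * g' i" if "(i, j) \<in> Q" for i j using that by (simp add: m')
  have "m' (i, j) \<in> carrier_mat (d j) (d i)" if "(i, j) \<in> Q" for i j
    unfolding m'_eq[OF that] by (intro mult_carrier_mat[OF mult_carrier_mat[OF g(1) mc[OF that]] g(2)])
  moreover have "m' \<in> extensional Q" unfolding m' by simp
  ultimately have "m' \<in> rep_space Q d" unfolding rep_space_def by (auto simp: PiE_def)
  moreover have "g \<in> rep_hom Q (rep_of d m) (rep_of d m')"
  proof -
    have "g j * m (i, j) = m' (i, j) * g i" if "(i, j) \<in> Q" for i j
    proof -
      have c: "g j * m (i, j) \<in> carrier_mat (d j) (d i)" by (intro mult_carrier_mat[OF g(1) mc[OF that]])
      have "m' (i, j) * g i = g j * m (i, j) * (g' i * g i)"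
        unfolding m'_eq[OF that] by (rule assoc_mult_mat[OF c g(2) g(1)])
      then show ?thesis by (simp only: g(4) right_mult_one_mat[OF c])
    qed
    then show ?thesis using g(1) by (auto simp: rep_hom_def)
  qed
  moreover have "invertible_mat (g i)" for i
    using g[of i] by (auto simp: invertible_mat_def inverts_mat_def)
  ultimately show "m' \<in> rep_space Q d \<and> rep_iso Q (rep_of d m) (rep_of d m')"
    unfolding rep_iso_def by blast
next
  assume R: "m' \<in> rep_space Q d \<and> rep_iso Q (rep_of d m) (rep_of d m')"
  then obtain f where f: "f \<in> rep_hom Q (rep_of d m) (rep_of d m')" "\<And>i. invertible_mat (f i)"
    unfolding rep_iso_def by blast
  have fc: "f i \<in> carrier_mat (d i) (d i)" for i using f(1) by (auto simp: rep_hom_def)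
  have "\<exists>B. B \<in> carrier_mat (d i) (d i) \<and> f i * B = 1\<^sub>m (d i) \<and> B * f i = 1\<^sub>m (d i)" for i
    using invertible_matD[OF f(2) fc, of i] by blast
  then obtain g where g: "\<And>i. g i \<in> carrier_mat (d i) (d i)" "\<And>i. f i * g i = 1\<^sub>m (d i)"
    "\<And>i. g i * f i = 1\<^sub>m (d i)" by metis
  have "m' = (\<lambda>(i, j)\<in>Q. f j * m (i, j) * g i)"
  proof
    fix a
    show "m' a = (\<lambda>(i, j)\<in>Q. f j * m (i, j) * g i) a"
    proof (cases "a \<in> Q")
      case True
      obtain i j where a: "a = (i, j)" by (cases a)
      have m'c: "m' (i, j) \<in> carrier_mat (d j) (d i)"
        using maps_carrier[of Q "rep_of d m'"] R True a by simp
      have "f j * m (i, j) = m' (i, j) * f i" using f(1) True a by (auto simp: rep_hom_def)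
      then have "f j * m (i, j) * g i = m' (i, j) * (f i * g i)"
        using assoc_mult_mat[OF m'c fc g(1)] by simp
      then show ?thesis using m'c g(2) True a by simp
    next
      case False
      have "m' a = undefined" using R unfolding rep_space_def by (intro PiE_arb[OF _ False]) auto
      then show ?thesis using False by simp
    qed
  qed
  then show "m' \<in> gl_orbit Q d m" unfolding gl_orbit_def using fc g by blast
qed

lemma ext_vanishes_rep_iso:
  fixes Q :: "('i::finite \<times> 'i) set"
  assumes "is_rep Q M" "is_rep Q N" "rep_iso Q M N"
    and ext: "ext_vanishes Q (iden (dimv M)) (rep_fmat Q M) (iden (dimv M)) (rep_fmat Q M)"
  shows "ext_vanishes Q (iden (dimv N)) (rep_fmat Q N) (iden (dimv N)) (rep_fmat Q N)"
proof -
  obtain u v where u: "u \<in> rep_homs Q M N" "v \<in> rep_homs Q N M"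
    "u * v = iden (dimv N)" "v * u = iden (dimv M)"
    using assms(3) unfolding rep_iso_iff[OF assms(1,2)] by blast
  show ?thesis
    by (rule ext_vanishes_retract[OF quiver_object_arrow_fmat quiver_object_arrow_fmat u(2)
          homsD(1,3)[OF u(1)] u(3) u(1) homsD(1,2)[OF u(2)] u(3) ext])
qed

section \<open>Polynomial functions and neighbourhoods inside an orbit\<close>

lemma rep_polynomials_sum:
  "(\<And>s. s \<in> S \<Longrightarrow> f s \<in> rep_polynomials Q d) \<Longrightarrow> (\<lambda>m. \<Sum>s\<in>S. f s m) \<in> rep_polynomials Q d"
  by (induction S rule: infinite_finite_induct) (auto intro: rep_polynomials.intros)

lemma rep_polynomials_prod:
  "(\<And>s. s \<in> S \<Longrightarrow> f s \<in> rep_polynomials Q d) \<Longrightarrow> (\<lambda>m. \<Prod>s\<in>S. f s m) \<in> rep_polynomials Q d"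
  by (induction S rule: infinite_finite_induct) (auto intro: rep_polynomials.intros)

lemma rep_polynomials_diff:
  assumes "p \<in> rep_polynomials Q d" "q \<in> rep_polynomials Q d"
  shows "(\<lambda>m. p m - q m) \<in> rep_polynomials Q d"
proof -
  have "(\<lambda>m. p m + (- 1) * q m) \<in> rep_polynomials Q d"
    using assms by (intro rep_polynomials.intros)
  then show ?thesis by simp
qed

lemma rep_polynomials_det:
  assumes "\<And>r s. r < n \<Longrightarrow> s < n \<Longrightarrow> (\<lambda>m. A m $$ (r, s)) \<in> rep_polynomials Q d"
    and "\<And>m. A m \<in> carrier_mat n n"
  shows "(\<lambda>m. det (A m)) \<in> rep_polynomials Q d"
  unfolding det_def'[OF assms(2)]
proof (rule rep_polynomials_sum)
  fix \<pi> assume "\<pi> \<in> {\<pi>. \<pi> permutes {0..<n}}"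
  then have "\<pi> i < n" if "i < n" for i
    using that permutes_in_image[of \<pi> "{0..<n}" i] by simp
  then have "(\<lambda>m. \<Prod>i = 0..<n. A m $$ (i, \<pi> i)) \<in> rep_polynomials Q d"
    by (intro rep_polynomials_prod assms(1)) auto
  then show "(\<lambda>m. signof \<pi> * (\<Prod>i = 0..<n. A m $$ (i, \<pi> i))) \<in> rep_polynomials Q d"
    by (rule rep_polynomials.poly_mult[OF poly_const])
qed

text \<open>Entries of the adjugate are signed minors. Unlike the inverse, the adjugate depends
  polynomially on the matrix and exists everywhere.\<close>

lemma rep_polynomials_adj_mat:
  assumes "\<And>r s. r < n \<Longrightarrow> s < n \<Longrightarrow> (\<lambda>m. A m $$ (r, s)) \<in> rep_polynomials Q d"
    and A: "\<And>m. A m \<in> carrier_mat n n" and rs: "r < n" "s < n"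
  shows "(\<lambda>m. adj_mat (A m) $$ (r, s)) \<in> rep_polynomials Q d"
proof -
  have "(\<lambda>m. det (mat_delete (A m) s r)) \<in> rep_polynomials Q d"
  proof (rule rep_polynomials_det[of "n - 1"])
    show "mat_delete (A m) s r \<in> carrier_mat (n - 1) (n - 1)" for m by (rule mat_delete_carrier[OF A])
    fix a b assume ab: "a < n - 1" "b < n - 1"
    have "mat_delete (A m) s r $$ (a, b)
        = A m $$ (if a < s then a else Suc a, if b < r then b else Suc b)" for m
      using ab A[of m] by (simp add: mat_delete_def)
    then show "(\<lambda>m. mat_delete (A m) s r $$ (a, b)) \<in> rep_polynomials Q d"
      using ab by (simp add: assms(1))
  qed
  moreover have "adj_mat (A m) $$ (r, s) = (- 1) ^ (s + r) * det (mat_delete (A m) s r)" for m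
    using rs A[of m] by (simp add: adj_mat_def cofactor_def)
  ultimately show ?thesis by (auto intro: rep_polynomials.intros)
qed

lemma rep_polynomials_arrow_fmat:
  fixes Q :: "('i::finite \<times> 'i) set"
  shows "(\<lambda>m. entry (arrow_fmat Q d m) x y) \<in> rep_polynomials Q d"
proof -
  obtain j r i s where xy: "x = (j, r)" "y = (i, s)" by (cases x, cases y)
  show ?thesis
    unfolding xy entry_arrow_fmat
    by (cases "(i, j) \<in> Q \<and> r < d j \<and> s < d i") (auto intro: rep_polynomials.intros)
qed

lemma invertible_mat_if_det_nonzero:
  assumes A: "(A :: complex mat) \<in> carrier_mat n n" and "det A \<noteq> 0"
  shows "invertible_mat A"
proof -
  let ?B = "(1 / det A) \<cdot>\<^sub>m adj_mat A"
  note adj = adj_mat[OF A]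
  have "A * ?B = 1\<^sub>m n" "?B * A = 1\<^sub>m n"
    using mult_smult_distrib[OF A adj(1)] mult_smult_assoc_mat[OF adj(1) A] adj(2,3) assms(2)
    by (auto intro!: eq_matI)
  then show ?thesis
    using A adj(1) unfolding invertible_mat_def inverts_mat_def by auto
qed

text \<open>If \<open>Ext\<^sup>1\<close> vanishes at \<open>m0\<close>, Cramer's rule solves \<open>f T0 = T f\<close> for \<open>f\<close> polynomially in \<open>T\<close>, with
  \<open>f = 1\<close> at \<open>T = T0\<close>; hence \<open>f\<close> stays invertible near \<open>m0\<close>.\<close>

lemma orbit_neighbourhood:
  fixes Q :: "('i::finite \<times> 'i) set"
  assumes m0: "m0 \<in> rep_space Q d"
    and ext: "ext_vanishes Q (iden d) (arrow_fmat Q d m0) (iden d) (arrow_fmat Q d m0)"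
  shows "\<exists>p\<in>rep_polynomials Q d. p m0 \<noteq> 0 \<and>
    (\<forall>m\<in>rep_space Q d. p m \<noteq> 0 \<longrightarrow> rep_iso Q (rep_of d m0) (rep_of d m))"
proof -
  let ?T0 = "arrow_fmat Q d m0"
  let ?J = "arrow_support Q d d"
  define n where "n = card ?J"
  obtain idx where idx: "bij_betw idx {0..<n} ?J"
    using ex_bij_betw_nat_finite[OF arrow_support_card(1)] unfolding n_def by blast
  \<comment> \<open>Surjectivity of the coboundary at \<open>m0\<close> yields a preimage
    \<open>s k\<close> of every matrix unit. The map \<open>f\<close> is sought as a combination of
    \<open>iden d\<close> and these \<open>s k\<close>.\<close>
  have "\<exists>s\<in>graded. iden d * s = s \<and> s * iden d = s \<and> munit (fst (idx k)) (snd (idx k)) = s * ?T0 - ?T0 * s"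
    if "k < n" for k
  proof -
    have "idx k \<in> ?J" using idx that by (auto simp: bij_betw_def)
    then have "munit (fst (idx k)) (snd (idx k)) \<in> supported ?J" by (auto simp: supported_def split: if_splits)
    then show ?thesis using ext unfolding ext_vanishes_def supported_arrow_support by blast
  qed
  then obtain s where s: "\<And>k. k < n \<Longrightarrow> s k \<in> graded" "\<And>k. k < n \<Longrightarrow> iden d * s k = s k"
    "\<And>k. k < n \<Longrightarrow> s k * iden d = s k"
    "\<And>k. k < n \<Longrightarrow> munit (fst (idx k)) (snd (idx k)) = s k * ?T0 - ?T0 * s k" by metis
  define T where "T = arrow_fmat Q d"
  \<comment> \<open>In the coordinates \<open>idx\<close>, the equation
    \<open>f m * ?T0 = T m * f m\<close> for the \<open>f\<close> below reads
    \<open>A m x = det (A m) b m\<close>. By the choice of the \<open>s k\<close>, the matrix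
    \<open>A m0\<close> is the identity, and \<open>b m0\<close> is zero.\<close>
  define A where "A = (\<lambda>m. mat n n (\<lambda>(l, k). entry (s k * ?T0 - T m * s k) (fst (idx l)) (snd (idx l))))"
  define b where "b = (\<lambda>m. vec n (\<lambda>l. entry (?T0 - T m) (fst (idx l)) (snd (idx l))))"
  \<comment> \<open>The solution multiplied by \<open>det (A m)\<close>, so that no division is
    involved.\<close>
  define x where "x = (\<lambda>m. adj_mat (A m) *\<^sub>v b m)"
  define f where "f = (\<lambda>m. scl (det (A m)) (iden d) - (\<Sum>k<n. scl (x m $ k) (s k)))"
  have A: "A m \<in> carrier_mat n n" and b: "b m \<in> carrier_vec n" for m by (simp_all add: A_def b_def)
  have x: "x m \<in> carrier_vec n" for m unfolding x_def by (rule mult_mat_vec_carrier[OF adj_mat(1)[OF A] b])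
  have Ax: "A m *\<^sub>v x m = det (A m) \<cdot>\<^sub>v b m" for m
  proof -
    have "A m *\<^sub>v x m = (A m * adj_mat (A m)) *\<^sub>v b m"
      unfolding x_def by (rule assoc_mult_mat_vec[OF A adj_mat(1)[OF A] b, symmetric])
    moreover have "(c \<cdot>\<^sub>m 1\<^sub>m n) *\<^sub>v v = c \<cdot>\<^sub>v v" if v: "v \<in> carrier_vec n" for c :: complex and v
    proof (rule eq_vecI)
      fix l assume "l < dim_vec (c \<cdot>\<^sub>v v)"
      then have l: "l < n" using v by simp
      have "((c \<cdot>\<^sub>m 1\<^sub>m n) *\<^sub>v v) $ l = (\<Sum>k = 0..<n. c * (if k = l then 1 else 0) * v $ k)"
        using l v by (simp add: scalar_prod_def)
      also have "\<dots> = (\<Sum>k = 0..<n. if k = l then c * v $ k else 0)" by (rule sum.cong) auto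
      finally show "((c \<cdot>\<^sub>m 1\<^sub>m n) *\<^sub>v v) $ l = (c \<cdot>\<^sub>v v) $ l" using l v by simp
    qed (use v in simp)
    ultimately show ?thesis using adj_mat(2)[OF A] b[of m] by simp
  qed
  have T: "iden d * T m = T m" "T m * iden d = T m" "T m \<in> arrow_mats Q" for m
    using quiver_objectD[OF quiver_object_arrow_fmat[of Q d m]] by (simp_all add: T_def)
  have f: "f m \<in> graded" "iden d * f m = f m" "f m * iden d = f m" for m
    using s(1-3) by (auto simp: f_def left_diff_distrib right_diff_distrib sum_distrib_left sum_distrib_right
        intro!: graded_closed(3,5) graded_sum)
  have fT: "f m * ?T0 = T m * f m" for m
  proof -
    have diff: "f m * ?T0 - T m * f m
        = scl (det (A m)) (?T0 - T m) - (\<Sum>k<n. scl (x m $ k) (s k * ?T0 - T m * s k))"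
      using T[of m] T[of m0]
      by (simp add: f_def T_def left_diff_distrib right_diff_distrib sum_distrib_left sum_distrib_right
          fm.scale_right_diff_distrib sum_subtractf)
    have "f m * ?T0 - T m * f m \<in> supported ?J"
      unfolding supported_arrow_support using f[of m] T[of m] T[of m0]
      by (auto simp: T_def left_diff_distrib right_diff_distrib mult.assoc
          f(2)[THEN mult_assoc_eq] T(1)[unfolded T_def, THEN mult_assoc_eq])
    moreover have "entry (f m * ?T0 - T m * f m) y z = 0" if "(y, z) \<in> ?J" for y z
    proof -
      have "(y, z) \<in> idx ` {0..<n}" using that idx by (simp add: bij_betw_def)
      then obtain l where l: "l < n" "idx l = (y, z)" by force
      have "(A m *\<^sub>v x m) $ l = (\<Sum>k<n. x m $ k * entry (s k * ?T0 - T m * s k) y z)"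
        using l x[of m] A[of m] by (auto simp: A_def scalar_prod_def lessThan_atLeast0 mult.commute intro!: sum.cong)
      moreover have "(A m *\<^sub>v x m) $ l = det (A m) * entry (?T0 - T m) y z"
        unfolding Ax using l b[of m] by (simp add: b_def)
      ultimately show ?thesis unfolding diff by simp
    qed
    ultimately have "f m * ?T0 - T m * f m = 0" by (intro fmat_eqI) (force simp: supported_def)
    then show ?thesis by simp
  qed
  \<comment> \<open>Nonzero exactly when every vertex block of \<open>f m\<close> is
    invertible.\<close>
  define p where "p = (\<lambda>m. \<Prod>i\<in>UNIV. det (fmat_block (f m) i i (d i) (d i)))"
  have Tpoly: "(\<lambda>m. entry (T m) y z) \<in> rep_polynomials Q d" for y z
    unfolding T_def by (rule rep_polynomials_arrow_fmat)
  have Tspoly: "(\<lambda>m. entry (T m * s k) y z) \<in> rep_polynomials Q d" if "k < n" for k y z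
  proof -
    obtain i t where z: "z = (i, t)" by (cases z)
    show ?thesis
      unfolding z entry_mult_graded_right[OF s(1)[OF that] s(2)[OF that]]
      by (intro rep_polynomials_sum rep_polynomials.poly_mult poly_const Tpoly)
  qed
  have Apoly: "(\<lambda>m. A m $$ (l, k)) \<in> rep_polynomials Q d" if "l < n" "k < n" for l k
    using that by (simp add: A_def rep_polynomials_diff poly_const Tspoly)
  have bpoly: "(\<lambda>m. b m $ l) \<in> rep_polynomials Q d" if "l < n" for l
    using that by (simp add: b_def rep_polynomials_diff poly_const Tpoly)
  have xpoly: "(\<lambda>m. x m $ k) \<in> rep_polynomials Q d" if "k < n" for k
  proof -
    have "x m $ k = (\<Sum>l<n. adj_mat (A m) $$ (k, l) * b m $ l)" for m
      using that adj_mat(1)[OF A, of m] b[of m]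
      by (auto simp: x_def scalar_prod_def lessThan_atLeast0 intro!: sum.cong)
    then show ?thesis
      using that by (auto intro!: rep_polynomials_sum rep_polynomials.poly_mult rep_polynomials_adj_mat[OF Apoly A] bpoly)
  qed
  have "(\<lambda>m. entry (f m) y z) \<in> rep_polynomials Q d" for y z
    unfolding f_def entry_diff entry_sum entry_scl
    by (intro rep_polynomials_diff rep_polynomials_sum rep_polynomials.poly_mult poly_const rep_polynomials_det[OF Apoly A] xpoly)
      auto
  then have "(\<lambda>m. det (fmat_block (f m) i i (d i) (d i))) \<in> rep_polynomials Q d" for i
    by (intro rep_polynomials_det[of "d i"]) auto
  then have ppoly: "p \<in> rep_polynomials Q d"
    unfolding p_def by (intro rep_polynomials_prod)
  have "A m0 = 1\<^sub>m n"
  proof (rule eq_matI)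
    fix l k assume "l < dim_row (1\<^sub>m n :: complex mat)" "k < dim_col (1\<^sub>m n :: complex mat)"
    then have lk: "l < n" "k < n" by auto
    have "idx l = idx k \<longleftrightarrow> l = k" using idx lk by (auto simp: bij_betw_def inj_on_def)
    have "A m0 $$ (l, k) = entry (s k * ?T0 - ?T0 * s k) (fst (idx l)) (snd (idx l))"
      using lk by (simp add: A_def T_def)
    also have "\<dots> = (if idx l = idx k then 1 else 0)"
      unfolding s(4)[OF lk(2), symmetric] by (simp add: prod_eq_iff)
    finally show "A m0 $$ (l, k) = 1\<^sub>m n $$ (l, k)" using lk \<open>idx l = idx k \<longleftrightarrow> l = k\<close> by simp
  qed (use A in auto)
  moreover have "b m0 = 0\<^sub>v n" by (auto simp: b_def T_def)
  ultimately have "x m0 $ k = 0" if "k < n" for k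
    using that adj_mat(1)[OF A, of m0] by (simp add: x_def)
  then have "f m0 = iden d" using \<open>A m0 = 1\<^sub>m n\<close> by (simp add: f_def)
  then have "p m0 \<noteq> 0" by (simp add: p_def fmat_block_iden)
  moreover have "rep_iso Q (rep_of d m0) (rep_of d m)" if m: "m \<in> rep_space Q d" and "p m \<noteq> 0" for m
  proof -
    have "f m \<in> rep_homs Q (rep_of d m0) (rep_of d m)"
      using f[of m] fT[of m] by (simp add: homs_def T_def)
    then have "(\<lambda>i. fmat_block (f m) i i (d i) (d i)) \<in> rep_hom Q (rep_of d m0) (rep_of d m)"
      using fmat_block_in_rep_hom[of Q "rep_of d m0" "rep_of d m" "f m"] m m0 by simp
    moreover have "invertible_mat (fmat_block (f m) i i (d i) (d i))" for i
      using \<open>p m \<noteq> 0\<close> by (intro invertible_mat_if_det_nonzero[of _ "d i"]) (auto simp: p_def)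
    ultimately show ?thesis unfolding rep_iso_def by (intro bexI) auto
  qed
  ultimately show ?thesis using ppoly by blast
qed

text \<open>Vanishing of Ext^1 is invariant under isomorphism, so every point of the orbit, and not
  only \<open>m0\<close>, has a polynomial that is nonzero there and vanishes off the orbit. These
  polynomials cut out the complement.\<close>

theorem zariski_open_orbit:
  fixes Q :: "('i::finite \<times> 'i) set"
  assumes m0: "m0 \<in> rep_space Q d"
    and ext: "ext_vanishes Q (iden d) (arrow_fmat Q d m0) (iden d) (arrow_fmat Q d m0)"
  shows "zariski_open Q d (gl_orbit Q d m0)"
proof -
  let ?O = "gl_orbit Q d m0"
  define P where "P = {p \<in> rep_polynomials Q d. \<forall>m\<in>rep_space Q d - ?O. p m = 0}"
  have "rep_space Q d - ?O = {m \<in> rep_space Q d. \<forall>p\<in>P. p m = 0}"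
  proof
    show "{m \<in> rep_space Q d. \<forall>p\<in>P. p m = 0} \<subseteq> rep_space Q d - ?O"
    proof
      fix m assume m: "m \<in> {m \<in> rep_space Q d. \<forall>p\<in>P. p m = 0}"
      have "m \<notin> ?O"
      proof
        assume "m \<in> ?O"
        then have ms: "m \<in> rep_space Q d" "rep_iso Q (rep_of d m0) (rep_of d m)"
          unfolding gl_orbit_iff[OF m0] by auto
        have "ext_vanishes Q (iden d) (arrow_fmat Q d m) (iden d) (arrow_fmat Q d m)"
          using ext_vanishes_rep_iso[of Q "rep_of d m0" "rep_of d m"] m0 ms ext by simp
        then obtain p where p: "p \<in> rep_polynomials Q d" "p m \<noteq> 0"
          "\<And>m'. m' \<in> rep_space Q d \<Longrightarrow> p m' \<noteq> 0 \<Longrightarrow> rep_iso Q (rep_of d m) (rep_of d m')"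
          using orbit_neighbourhood[OF ms(1)] by blast
        have "p m' = 0" if m': "m' \<in> rep_space Q d - ?O" for m'
        proof (rule ccontr)
          assume "p m' \<noteq> 0"
          then have "rep_iso Q (rep_of d m0) (rep_of d m')"
            using rep_iso_trans[of Q "rep_of d m0" "rep_of d m" "rep_of d m'"] p(3)[of m'] ms m0 m' by simp
          then have "m' \<in> ?O" using m' by (simp add: gl_orbit_iff[OF m0])
          then show False using m' by blast
        qed
        then have "p \<in> P" using p(1) by (simp add: P_def)
        then show False using m p(2) by blast
      qed
      then show "m \<in> rep_space Q d - ?O" using m by blast
    qed
  qed (auto simp: P_def)
  moreover have "P \<subseteq> rep_polynomials Q d" by (auto simp: P_def)
  ultimately have "zariski_closed Q d (rep_space Q d - ?O)" unfolding zariski_closed_def by blast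
  moreover have "?O \<subseteq> rep_space Q d" using gl_orbit_iff[OF m0] by blast
  ultimately show ?thesis by (simp add: zariski_open_def)
qed

section \<open>Any two open orbits meet: restriction to a line\<close>

definition line_point :: "('i \<times> 'i) set \<Rightarrow> ('i \<Rightarrow> nat) \<Rightarrow> ('i \<times> 'i \<Rightarrow> complex mat) \<Rightarrow> ('i \<times> 'i \<Rightarrow> complex mat)
    \<Rightarrow> complex \<Rightarrow> ('i \<times> 'i \<Rightarrow> complex mat)" where
  "line_point Q d m m' t = (\<lambda>(i, j)\<in>Q. mat (d j) (d i)
     (\<lambda>z. m (i, j) $$ z + t * (m' (i, j) $$ z - m (i, j) $$ z)))"

lemma line_point_in_rep_space: "line_point Q d m m' t \<in> rep_space Q d"
  by (auto simp: line_point_def rep_space_def PiE_def extensional_def)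

lemma rep_space_eqI:
  fixes Q :: "('i \<times> 'i) set"
  assumes "m \<in> rep_space Q d" "m' \<in> rep_space Q d"
    and "\<And>i j r s. (i, j) \<in> Q \<Longrightarrow> r < d j \<Longrightarrow> s < d i \<Longrightarrow> m (i, j) $$ (r, s) = m' (i, j) $$ (r, s)"
  shows "m = m'"
proof
  fix a :: "'i \<times> 'i"
  obtain i j where a: "a = (i, j)" by (cases a)
  show "m a = m' a"
  proof (cases "a \<in> Q")
    case True
    then have "m a \<in> carrier_mat (d j) (d i)" "m' a \<in> carrier_mat (d j) (d i)"
      using assms(1,2) a by (auto simp: rep_space_def dest: PiE_mem)
    then show ?thesis using assms(3) True a by (intro eq_matI) auto
  next
    case False
    show ?thesis using assms(1,2) PiE_arb[OF _ False] unfolding rep_space_def by metis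
  qed
qed

lemma rep_polynomials_on_line:
  assumes "p \<in> rep_polynomials Q d"
  shows "\<exists>P. \<forall>t. p (line_point Q d m m' t) = poly P t"
  using assms
proof induction
  case (poly_const c)
  show ?case by (rule exI[of _ "[:c:]"]) simp
next
  case (poly_entry i j r s)
  then show ?case
    by (intro exI[of _ "[:m (i, j) $$ (r, s), m' (i, j) $$ (r, s) - m (i, j) $$ (r, s):]"])
      (simp add: line_point_def)
next
  case (poly_add p q)
  then obtain P R where "\<And>t. p (line_point Q d m m' t) = poly P t"
    "\<And>t. q (line_point Q d m m' t) = poly R t" by blast
  then show ?case by (intro exI[of _ "P + R"]) simp
next
  case (poly_mult p q)
  then obtain P R where "\<And>t. p (line_point Q d m m' t) = poly P t"
    "\<And>t. q (line_point Q d m m' t) = poly R t" by blast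
  then show ?case by (intro exI[of _ "P * R"]) simp
qed

text \<open>On the line joining the two points, the polynomials that define neighbourhoods in the
  two orbits become nonzero polynomials in one variable. Some parameter is a root of neither, and
  the corresponding point lies in both orbits.\<close>

lemma generic_rep_unique:
  fixes Q :: "('i::finite \<times> 'i) set"
  assumes "generic_rep Q d M" "generic_rep Q d N"
  shows "rep_iso Q M N"
proof -
  have open_poly: "\<exists>p\<in>rep_polynomials Q d. p (maps M) \<noteq> 0 \<and> (\<forall>m\<in>rep_space Q d. p m \<noteq> 0 \<longrightarrow> rep_iso Q M (rep_of d m))"
    and in_space: "maps M \<in> rep_space Q d" "M = rep_of d (maps M)" if "generic_rep Q d M" for M
  proof -
    have M: "is_rep Q M" "dimv M = d" "zariski_open Q d (gl_orbit Q d (maps M))"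
      using that by (simp_all add: generic_rep_def)
    show ms: "maps M \<in> rep_space Q d" using M by (simp add: is_rep_def)
    show Meq: "M = rep_of d (maps M)" using M(2) by (cases M) simp
    obtain P where P: "P \<subseteq> rep_polynomials Q d"
      "rep_space Q d - gl_orbit Q d (maps M) = {m \<in> rep_space Q d. \<forall>p\<in>P. p m = 0}"
      using M(3) by (auto simp: zariski_open_def zariski_closed_def)
    have "maps M \<in> gl_orbit Q d (maps M)"
      unfolding gl_orbit_iff[OF ms] using ms rep_iso_refl[of Q "rep_of d (maps M)"] by simp
    then obtain p where p: "p \<in> P" "p (maps M) \<noteq> 0" using P(2) ms by blast
    have "rep_iso Q M (rep_of d m)" if "m \<in> rep_space Q d" "p m \<noteq> 0" for m
    proof -
      have "m \<in> gl_orbit Q d (maps M)" using P(2) p(1) that by blast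
      then show ?thesis unfolding gl_orbit_iff[OF ms] Meq[symmetric] by blast
    qed
    then show "\<exists>p\<in>rep_polynomials Q d. p (maps M) \<noteq> 0 \<and>
        (\<forall>m\<in>rep_space Q d. p m \<noteq> 0 \<longrightarrow> rep_iso Q M (rep_of d m))"
      using p P(1) by blast
  qed
  obtain p where p: "p \<in> rep_polynomials Q d" "p (maps M) \<noteq> 0"
    "\<And>m. m \<in> rep_space Q d \<Longrightarrow> p m \<noteq> 0 \<Longrightarrow> rep_iso Q M (rep_of d m)"
    using open_poly[OF assms(1)] by blast
  obtain q where q: "q \<in> rep_polynomials Q d" "q (maps N) \<noteq> 0"
    "\<And>m. m \<in> rep_space Q d \<Longrightarrow> q m \<noteq> 0 \<Longrightarrow> rep_iso Q N (rep_of d m)"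
    using open_poly[OF assms(2)] by blast
  let ?l = "line_point Q d (maps M) (maps N)"
  obtain P where P: "\<And>t. p (?l t) = poly P t" using rep_polynomials_on_line[OF p(1)] by blast
  obtain R where R: "\<And>t. q (?l t) = poly R t" using rep_polynomials_on_line[OF q(1)] by blast
  have "?l 0 = maps M" "?l 1 = maps N"
    by (rule rep_space_eqI[OF line_point_in_rep_space]; simp add: in_space assms line_point_def)+
  then have "poly P 0 \<noteq> 0" "poly R 1 \<noteq> 0" using P[of 0] R[of 1] p(2) q(2) by auto
  then have "P * R \<noteq> 0" by auto
  then have "finite {t. poly (P * R) t = 0}" by (rule poly_roots_finite)
  then obtain t where "poly (P * R) t \<noteq> 0"
    using infinite_UNIV_char_0[where ?'a = complex] by (metis (mono_tags, lifting) UNIV_eq_I mem_Collect_eq)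
  then have "p (?l t) \<noteq> 0" "q (?l t) \<noteq> 0" by (simp_all add: P R)
  then have "rep_iso Q M (rep_of d (?l t))" "rep_iso Q N (rep_of d (?l t))"
    using p(3) q(3) line_point_in_rep_space by blast+
  moreover have "is_rep Q M" "is_rep Q N" "is_rep Q (rep_of d (?l t))"
    using assms line_point_in_rep_space[of Q d] by (simp_all add: generic_rep_def)
  ultimately show ?thesis using rep_iso_trans rep_iso_sym by blast
qed

lemma (in definite_quiver) generic_rep_exists:
  "\<exists>M. generic_rep Q d M \<and>
    ext_vanishes Q (iden d) (rep_fmat Q M) (iden d) (rep_fmat Q M)"
proof -
  obtain T where T: "quiver_object Q (iden d) T" "ext_vanishes Q (iden d) T (iden d) T"
    using object_without_self_extensions by blast
  let ?M = "fmat_rep Q d T"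
  have "arrow_fmat Q d (maps ?M) = T" by (rule arrow_fmat_fmat_rep[OF T(1)])
  moreover have "maps ?M \<in> rep_space Q d"
    using fmat_rep_simps(2)[of Q d T] by (simp add: is_rep_def)
  ultimately show ?thesis
    using zariski_open_orbit[of "maps ?M" Q d] T(2) fmat_rep_simps[of Q d T]
    by (intro exI[of _ ?M]) (simp add: generic_rep_def)
qed

section \<open>Root space decomposition\<close>

interpretation lie: vector_space "scaleL :: complex \<Rightarrow> 'g::complex_lie_algebra \<Rightarrow> 'g"
  by unfold_locales (simp_all add: scaleL_add_right scaleL_add_left scaleL_scaleL scaleL_one)

lemma lie_subspace_eq: "lie_subspace S \<longleftrightarrow> lie.subspace S"
  by (auto simp: lie_subspace_def lie.subspace_def)

lemma lie_span_eq: "lie_span B = lie.span B"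
  unfolding lie_span_def lie_subspace_eq
  using lie.span_minimal lie.span_superset lie.subspace_span by blast

lemma bracket_0[simp]: "bracket 0 x = 0" "bracket x 0 = 0"
  using bracket_add_left[of 0 0 x] bracket_add_right[of x 0 0] by simp_all

lemma bracket_minus: "bracket (- x) y = - bracket x y" "bracket x (- y) = - bracket x y"
  using minus_unique[of "bracket x y" "bracket (- x) y"] minus_unique[of "bracket x y" "bracket x (- y)"]
    bracket_add_left[of x "- x" y] bracket_add_right[of x y "- y"] by simp_all

lemma bracket_diff: "bracket (x - y) z = bracket x z - bracket y z"
  "bracket x (y - z) = bracket x y - bracket x z"
  using bracket_add_left[of x "- y" z] bracket_add_right[of x y "- z"] by (simp_all add: bracket_minus)

lemma bracket_anti: "bracket x y = - bracket y x"
proof -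
  have "bracket (x + y) (x + y) = bracket x y + bracket y x"
    unfolding bracket_add_left bracket_add_right by (simp add: bracket_self)
  then show ?thesis by (simp add: bracket_self eq_neg_iff_add_eq_0)
qed

lemma bracket_sum: "bracket x (sum f S) = (\<Sum>s\<in>S. bracket x (f s))"
  by (induction S rule: infinite_finite_induct) (simp_all add: bracket_add_right)

lemma jacobi': "bracket x (bracket y z) = bracket (bracket x y) z + bracket y (bracket x z)"
  using jacobi[of x y z] bracket_anti[of z "bracket x y"] bracket_anti[of z x]
  by (simp add: bracket_minus algebra_simps)

section \<open>Simultaneous diagonalization of commuting operators\<close>

lemma eigenvectors_independent:
  assumes "finite C" "\<And>c. c \<in> C \<Longrightarrow> bracket h (w c) = scaleL c (w c)" "(\<Sum>c\<in>C. w c) = 0"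
  shows "\<forall>c\<in>C. w c = 0"
  using assms
proof (induction C arbitrary: w rule: finite_induct)
  case (insert a C)
  have "(\<Sum>c\<in>C. scaleL (c - a) (w c))
      = bracket h (\<Sum>c\<in>insert a C. w c) - scaleL a (\<Sum>c\<in>insert a C. w c)"
    using insert.hyps insert.prems(1)
    by (simp add: bracket_sum bracket_add_right lie.scale_right_distrib lie.scale_sum_right
        lie.scale_left_diff_distrib sum_subtractf)
  also have "\<dots> = 0" using insert.prems(2) by simp
  finally have "\<forall>c\<in>C. scaleL (c - a) (w c) = 0"
    using insert.prems(1) by (intro insert.IH) (auto simp: bracket_scaleL_right scaleL_scaleL mult.commute)
  then have "\<forall>c\<in>C. w c = 0" using insert.hyps by auto
  then show ?case using insert.prems(2) insert.hyps by simp
qed simp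

lemma eigenvector_decomposition:
  assumes "x \<in> lie.span {x. \<exists>c. bracket h x = scaleL c x}"
  shows "\<exists>C w. finite C \<and> (\<forall>c. bracket h (w c) = scaleL c (w c)) \<and> (\<forall>c. c \<notin> C \<longrightarrow> w c = 0) \<and> x = sum w C"
  using assms
proof (induction rule: lie.span_induct_alt)
  case base
  show ?case by (intro exI[of _ "{}"] exI[of _ "\<lambda>_. 0"]) simp
next
  case (step r x y)
  then obtain a where a: "bracket h x = scaleL a x" by blast
  from step obtain C w where w: "finite C" "\<And>c. bracket h (w c) = scaleL c (w c)"
    "\<And>c. c \<notin> C \<Longrightarrow> w c = 0" "y = sum w C" by blast
  let ?w = "\<lambda>c. w c + (if c = a then scaleL r x else 0)"
  have "sum w (insert a C) = sum w C" using w(1,3) by (intro sum.mono_neutral_right) auto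
  then have "sum ?w (insert a C) = scaleL r x + y"
    using w(1,4) by (simp add: sum.distrib sum.delta add.commute del: sum.insert)
  moreover have "bracket h (?w c) = scaleL c (?w c)" for c
    using w(2)[of c] a
    by (simp add: bracket_add_right bracket_scaleL_right scaleL_scaleL scaleL_add_right mult.commute)
  ultimately show ?case using w(1,3) by (intro exI[of _ "insert a C"] exI[of _ ?w]) auto
qed

text \<open>Commuting operators preserve each other's eigenspaces, so the
  \<open>h\<close>-components of a joint eigenvector for \<open>F\<close> are again eigenvectors for
  \<open>F\<close>.\<close>

lemma joint_eigenvectors_span:
  assumes "finite F"
    and diag: "\<And>h. h \<in> F \<Longrightarrow> lie.span {x. \<exists>c. bracket h x = scaleL c x} = (UNIV :: 'g::complex_lie_algebra set)"
    and comm: "\<And>h h'. h \<in> F \<Longrightarrow> h' \<in> F \<Longrightarrow> bracket h h' = 0"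
  shows "lie.span {x. \<forall>h\<in>F. \<exists>c. bracket h x = scaleL c x} = (UNIV :: 'g set)"
  using assms
proof (induction F rule: finite_induct)
  case empty
  then show ?case by (simp add: lie.span_UNIV)
next
  case (insert h F)
  let ?J = "\<lambda>F. {x :: 'g. \<forall>h\<in>F. \<exists>c. bracket h x = scaleL c x}"
  have "?J F \<subseteq> lie.span (?J (insert h F))"
  proof
    fix x assume x: "x \<in> ?J F"
    have "x \<in> lie.span {x. \<exists>c. bracket h x = scaleL c x}" using insert.prems(1)[of h] by simp
    then obtain C w where w: "finite C" "\<And>c. bracket h (w c) = scaleL c (w c)" "x = sum w C"
      using eigenvector_decomposition by blast
    have "w c \<in> ?J (insert h F)" if c: "c \<in> C" for c
    proof -
      have "\<exists>a. bracket h' (w c) = scaleL a (w c)" if h': "h' \<in> F" for h'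
      proof -
        obtain a where a: "bracket h' x = scaleL a x" using x h' by blast
        \<comment> \<open>These are eigenvectors of \<open>h\<close> for distinct eigenvalues
          \<open>c\<close>, and they sum to zero, so each of them vanishes.\<close>
        let ?u = "\<lambda>c. bracket h' (w c) - scaleL a (w c)"
        have "(\<Sum>c\<in>C. ?u c) = 0"
          using a by (simp add: w(3) bracket_sum lie.scale_sum_right sum_subtractf)
        moreover have "bracket h (?u c) = scaleL c (?u c)" for c
        proof -
          have "bracket h (bracket h' (w c)) = bracket h' (bracket h (w c))"
            using jacobi'[of h h' "w c"] insert.prems(2)[of h h'] h' by simp
          then show ?thesis
            by (simp add: bracket_diff bracket_scaleL_right w(2) lie.scale_right_diff_distrib
                scaleL_scaleL mult.commute)
        qed
        ultimately have "?u c = 0" using eigenvectors_independent[of C h ?u] w(1) c by blast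
        then show ?thesis by auto
      qed
      then show ?thesis using w(2) by blast
    qed
    then show "x \<in> lie.span (?J (insert h F))" unfolding w(3) by (intro lie.span_sum lie.span_base)
  qed
  then have "lie.span (?J F) \<subseteq> lie.span (?J (insert h F))"
    by (rule lie.span_minimal[OF _ lie.subspace_span])
  moreover have "lie.span (?J F) = UNIV" using insert by auto
  ultimately show ?case by blast
qed

text \<open>Induction on \<open>F\<close>: on the kernel of \<open>f b\<close> the remaining
  functionals represent \<phi>, and the difference, vanishing there, is a multiple of
  \<open>f b\<close>. The subspace \<open>K\<close> is kept general because it shrinks to this
  kernel.\<close>

lemma functional_combination:
  fixes f :: "'b \<Rightarrow> 'g::complex_lie_algebra \<Rightarrow> complex"
  assumes "finite F" "lie.subspace K"
    and "\<And>b x y. b \<in> F \<Longrightarrow> f b (x + y) = f b x + f b y" "\<And>b c x. b \<in> F \<Longrightarrow> f b (scaleL c x) = c * f b x"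
    and "\<And>x y. x \<in> K \<Longrightarrow> y \<in> K \<Longrightarrow> \<phi> (x + y) = \<phi> x + \<phi> y" "\<And>c x. x \<in> K \<Longrightarrow> \<phi> (scaleL c x) = c * \<phi> x"
    and "\<And>x. x \<in> K \<Longrightarrow> (\<And>b. b \<in> F \<Longrightarrow> f b x = 0) \<Longrightarrow> \<phi> x = 0"
  shows "\<exists>c. \<forall>x\<in>K. \<phi> x = (\<Sum>b\<in>F. c b * f b x)"
  using assms
proof (induction F arbitrary: K rule: finite_induct)
  case empty
  then show ?case by auto
next
  case (insert b F)
  note K = insert.prems(1) and f = insert.prems(2,3) and \<phi> = insert.prems(4,5)
  let ?K = "{x \<in> K. f b x = 0}"
  have f0: "f b 0 = 0" using f(2)[of b 0 0] by simp
  have "lie.subspace ?K" using K f f0 unfolding lie.subspace_def by auto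
  then have "\<exists>c. \<forall>x\<in>?K. \<phi> x = (\<Sum>b\<in>F. c b * f b x)"
  proof (rule insert.IH)
    fix x assume "x \<in> ?K" "\<And>b. b \<in> F \<Longrightarrow> f b x = 0"
    then show "\<phi> x = 0" by (intro insert.prems(6)) auto
  qed (use insert.prems(2-5) in auto)
  then obtain c where c: "\<And>x. x \<in> K \<Longrightarrow> f b x = 0 \<Longrightarrow> \<phi> x = (\<Sum>b\<in>F. c b * f b x)" by blast
  define \<psi> where "\<psi> = (\<lambda>x. \<phi> x - (\<Sum>b\<in>F. c b * f b x))"
  have "\<exists>e. \<forall>x\<in>K. \<psi> x = e * f b x"
  proof (cases "\<exists>y\<in>K. f b y \<noteq> 0")
    case True
    then obtain y where y: "y \<in> K" "f b y \<noteq> 0" by blast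
    have "\<psi> x = \<psi> y / f b y * f b x" if x: "x \<in> K" for x
    proof -
      define r where "r = - (f b x / f b y)"
      have ry: "scaleL r y \<in> K" by (rule lie.subspace_scale[OF K y(1)])
      have "x + scaleL r y \<in> K" by (rule lie.subspace_add[OF K x ry])
      moreover have "f b (x + scaleL r y) = 0" using f y by (simp add: r_def[symmetric]) (simp add: r_def)
      ultimately have "\<psi> (x + scaleL r y) = 0" using c unfolding \<psi>_def by simp
      moreover have "\<psi> (x + scaleL r y) = \<psi> x + r * \<psi> y"
        unfolding \<psi>_def using f \<phi>(1)[OF x ry] \<phi>(2)[OF y(1), of r]
        by (simp add: sum.distrib algebra_simps sum_distrib_left sum_subtractf)
      ultimately show ?thesis by (simp add: r_def field_simps)
    qed
    then show ?thesis by blast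
  next
    case False
    then show ?thesis using c unfolding \<psi>_def by (intro exI[of _ 0]) auto
  qed
  then obtain e where e: "\<And>x. x \<in> K \<Longrightarrow> \<psi> x = e * f b x" by blast
  have "\<phi> x = (\<Sum>a\<in>insert b F. (c(b := e)) a * f a x)" if "x \<in> K" for x
  proof -
    have "(\<Sum>a\<in>F. (c(b := e)) a * f a x) = (\<Sum>a\<in>F. c a * f a x)"
      using insert.hyps by (intro sum.cong) auto
    then show ?thesis using e[OF that] insert.hyps by (simp add: \<psi>_def algebra_simps)
  qed
  then show ?case by blast
qed

section \<open>Cartan subalgebra, invariant form and products of roots\<close>

locale simply_laced_lie_algebra =
  fixes H :: "'g::complex_lie_algebra set"
    and \<kappa> :: "'g \<Rightarrow> 'g \<Rightarrow> complex"
    and \<alpha> :: "'i::finite \<Rightarrow> 'g \<Rightarrow> complex"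
  assumes simply_laced: "simply_laced_simple H \<kappa> \<alpha>"
begin

lemma
  shows simple: "simple_lie_algebra TYPE('g)"
    and cartan: "cartan_subalgebra H"
    and simple_roots: "simple_roots H \<alpha>"
    and invariant: "invariant_form \<kappa>"
    and root_norm: "\<beta> \<in> roots H \<Longrightarrow> dual_form H \<kappa> \<beta> \<beta> = 2"
  using simply_laced unfolding simply_laced_simple_def by blast+

lemma subspace_H: "lie.subspace H"
  using cartan by (simp add: cartan_subalgebra_def lie_subspace_eq)

lemma centralizer_H: "{x. \<forall>h\<in>H. bracket h x = 0} = H"
  using cartan unfolding cartan_subalgebra_def by blast

lemma H_closed: "0 \<in> H" "x \<in> H \<Longrightarrow> y \<in> H \<Longrightarrow> x + y \<in> H" "x \<in> H \<Longrightarrow> scaleL c x \<in> H"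
  using subspace_H by (auto simp: lie.subspace_def)

lemma \<kappa>_rules:
  "\<kappa> (x + y) z = \<kappa> x z + \<kappa> y z" "\<kappa> (scaleL c x) y = c * \<kappa> x y"
  "\<kappa> x (y + z) = \<kappa> x y + \<kappa> x z" "\<kappa> x (scaleL c y) = c * \<kappa> x y"
  and \<kappa>_sym: "\<kappa> x y = \<kappa> y x"
  and \<kappa>_inv: "\<kappa> (bracket x y) z = \<kappa> x (bracket y z)"
  and \<kappa>_nondegenerate: "(\<And>y. \<kappa> x y = 0) \<Longrightarrow> x = 0"
  using invariant unfolding invariant_form_def by metis+

lemma \<kappa>_0[simp]: "\<kappa> 0 x = 0" "\<kappa> x 0 = 0"
  using \<kappa>_rules(2)[of 0 0 x] \<kappa>_rules(4)[of x 0 0] by simp_all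

lemma \<kappa>_minus: "\<kappa> (- x) y = - \<kappa> x y" "\<kappa> x (- y) = - \<kappa> x y"
  using \<kappa>_rules(2)[of "-1" x y] \<kappa>_rules(4)[of x "-1" y] by simp_all

lemma cartan_dualD:
  assumes "\<phi> \<in> cartan_dual H"
  shows "\<And>x y. x \<in> H \<Longrightarrow> y \<in> H \<Longrightarrow> \<phi> (x + y) = \<phi> x + \<phi> y"
    "\<And>c x. x \<in> H \<Longrightarrow> \<phi> (scaleL c x) = c * \<phi> x" "\<And>x. x \<notin> H \<Longrightarrow> \<phi> x = 0"
  using assms by (auto simp: cartan_dual_def)

lemma cartan_dual_closed:
  "(\<lambda>_. 0) \<in> cartan_dual H"
  "\<phi> \<in> cartan_dual H \<Longrightarrow> \<psi> \<in> cartan_dual H \<Longrightarrow> (\<lambda>x. \<phi> x + \<psi> x) \<in> cartan_dual H"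
  "\<phi> \<in> cartan_dual H \<Longrightarrow> \<psi> \<in> cartan_dual H \<Longrightarrow> (\<lambda>x. \<phi> x - \<psi> x) \<in> cartan_dual H"
  "\<phi> \<in> cartan_dual H \<Longrightarrow> (\<lambda>x. c * \<phi> x) \<in> cartan_dual H"
  "\<phi> \<in> cartan_dual H \<Longrightarrow> (\<lambda>x. - \<phi> x) \<in> cartan_dual H"
  by (auto simp: cartan_dual_def algebra_simps)

lemma finite_H_spanning:
  obtains F where "finite F" "F \<subseteq> H" "H \<subseteq> lie.span F"
proof -
  obtain B :: "'g set" where "finite B" "lie.span B = UNIV"
    using simple by (auto simp: simple_lie_algebra_def lie_span_eq)
  then show ?thesis using lie.finite_basis_in_span[of H B] that by (metis top_greatest)
qed

text \<open>Being an eigenvector of \<open>h\<close> is a linear condition on \<open>h\<close>, so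
  it extends from a spanning set to \<open>H\<close>. The eigenvalue is then linear in
  \<open>h\<close>, and it is set to 0 outside \<open>H\<close> as \<open>cartan_dual\<close>
  demands.\<close>

lemma root_space_exists:
  assumes F: "F \<subseteq> H" "H \<subseteq> lie.span F" and x: "\<forall>h\<in>F. \<exists>c. bracket h x = scaleL c x"
  shows "\<exists>\<phi>\<in>cartan_dual H. x \<in> root_space H \<phi>"
proof (cases "x = 0")
  case True
  then show ?thesis using cartan_dual_closed(1) by (intro bexI[of _ "\<lambda>_. 0"]) (simp_all add: root_space_def)
next
  case False
  have "lie.subspace {h. \<exists>c. bracket h x = scaleL c x}"
    unfolding lie.subspace_def
    by (auto simp: bracket_add_left bracket_scaleL_left scaleL_scaleL intro: exI[of _ 0])
      (metis scaleL_add_left)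
  then have "lie.span F \<subseteq> {h. \<exists>c. bracket h x = scaleL c x}"
    using x by (intro lie.span_minimal) auto
  then have "\<forall>h\<in>H. \<exists>c. bracket h x = scaleL c x" using F by blast
  then obtain f where f: "\<And>h. h \<in> H \<Longrightarrow> bracket h x = scaleL (f h) x" by metis
  have uniq: "a = b" if "scaleL a x = scaleL b x" for a b using that False by simp
  define \<phi> where "\<phi> = (\<lambda>h. if h \<in> H then f h else 0)"
  have "\<phi> (h + k) = \<phi> h + \<phi> k" if "h \<in> H" "k \<in> H" for h k
    using that f[of h] f[of k] f[of "h + k"] H_closed(2)[of h k]
    by (intro uniq) (simp add: \<phi>_def bracket_add_left scaleL_add_left)
  moreover have "\<phi> (scaleL c h) = c * \<phi> h" if "h \<in> H" for c h
  proof -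
    have "scaleL (f (scaleL c h)) x = bracket (scaleL c h) x" using f H_closed(3)[OF that] by simp
    also have "\<dots> = scaleL (c * f h) x" using f[OF that] by (simp add: bracket_scaleL_left scaleL_scaleL)
    finally show ?thesis using uniq that H_closed(3)[OF that] by (simp add: \<phi>_def)
  qed
  ultimately have "\<phi> \<in> cartan_dual H" by (auto simp: cartan_dual_def \<phi>_def)
  moreover have "x \<in> root_space H \<phi>" using f by (simp add: root_space_def \<phi>_def)
  ultimately show ?thesis by blast
qed

theorem root_spaces_span: "lie.span (\<Union>\<phi>\<in>cartan_dual H. root_space H \<phi>) = UNIV"
proof -
  obtain F where F: "finite F" "F \<subseteq> H" "H \<subseteq> lie.span F" by (rule finite_H_spanning)
  have "lie.span {x. \<forall>h\<in>F. \<exists>c. bracket h x = scaleL c x} = UNIV"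
  proof (rule joint_eigenvectors_span[OF F(1)])
    show "lie.span {x. \<exists>c. bracket h x = scaleL c x} = UNIV" if "h \<in> F" for h
      using cartan that F(2) unfolding cartan_subalgebra_def lie_span_eq by blast
    show "bracket h h' = 0" if "h \<in> F" "h' \<in> F" for h h'
      using centralizer_H that F(2) by blast
  qed
  moreover have "{x. \<forall>h\<in>F. \<exists>c. bracket h x = scaleL c x} \<subseteq> (\<Union>\<phi>\<in>cartan_dual H. root_space H \<phi>)"
    using root_space_exists[OF F(2,3)] by blast
  ultimately show ?thesis using lie.span_mono by blast
qed

lemma root_spaces_orthogonal:
  assumes "x \<in> root_space H \<phi>" "y \<in> root_space H \<psi>" "h \<in> H" "\<phi> h + \<psi> h \<noteq> 0"
  shows "\<kappa> x y = 0"
proof -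
  have "\<phi> h * \<kappa> x y = \<kappa> (bracket h x) y" using assms by (simp add: root_space_def \<kappa>_rules)
  also have "\<dots> = - \<kappa> x (bracket h y)" by (simp add: bracket_anti[of h x] \<kappa>_minus \<kappa>_inv)
  also have "\<dots> = - (\<psi> h * \<kappa> x y)" using assms by (simp add: root_space_def \<kappa>_rules)
  finally have "(\<phi> h + \<psi> h) * \<kappa> x y = 0" by (simp add: algebra_simps)
  then show ?thesis using assms(4) by simp
qed

text \<open>An \<open>x\<close> that is orthogonal to the opposite space would be orthogonal to
  every root space, hence to the whole algebra. The case \<phi> = 0 gives nondegeneracy on
  \<open>H\<close>.\<close>

lemma opposite_root_space_pairing:
  assumes \<phi>: "\<phi> \<in> cartan_dual H" and x: "x \<in> root_space H \<phi>" "x \<noteq> 0"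
  shows "\<exists>y\<in>root_space H (\<lambda>h. - \<phi> h). \<kappa> x y \<noteq> 0"
proof (rule ccontr)
  assume none: "\<not> ?thesis"
  have "(\<Union>\<psi>\<in>cartan_dual H. root_space H \<psi>) \<subseteq> {y. \<kappa> x y = 0}"
  proof clarify
    fix \<psi> y assume \<psi>: "\<psi> \<in> cartan_dual H" and y: "y \<in> root_space H \<psi>"
    show "\<kappa> x y = 0"
    proof (cases "\<exists>h\<in>H. \<phi> h + \<psi> h \<noteq> 0")
      case True
      then show ?thesis using root_spaces_orthogonal[OF x(1) y] by blast
    next
      case False
      then have "\<psi> h = - \<phi> h" if "h \<in> H" for h using that by (simp add: add_eq_0_iff)
      then have "y \<in> root_space H (\<lambda>h. - \<phi> h)" using y by (simp add: root_space_def)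
      then show ?thesis using none by blast
    qed
  qed
  moreover have "lie.subspace {y. \<kappa> x y = 0}" by (simp add: lie.subspace_def \<kappa>_rules)
  ultimately have "lie.span (\<Union>\<psi>\<in>cartan_dual H. root_space H \<psi>) \<subseteq> {y. \<kappa> x y = 0}"
    by (rule lie.span_minimal)
  then have "x = 0" unfolding root_spaces_span by (intro \<kappa>_nondegenerate) blast
  then show False using x(2) by simp
qed

lemma root_space_0: "root_space H (\<lambda>_. 0) = H"
  using centralizer_H by (simp add: root_space_def)

lemma \<kappa>_nondegenerate_H:
  assumes "x \<in> H" "\<And>h. h \<in> H \<Longrightarrow> \<kappa> x h = 0"
  shows "x = 0"
  using opposite_root_space_pairing[OF cartan_dual_closed(1), of x] assms root_space_0 by auto

text \<open>By nondegeneracy on \<open>H\<close>, the functionals \<open>\<kappa> b\<close> for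
  \<open>b\<close> in a finite spanning set have no common zero other than 0, so every functional on
  \<open>H\<close> is a combination of them.\<close>

lemma dual_vector_exists:
  assumes \<phi>: "\<phi> \<in> cartan_dual H"
  shows "\<exists>!t. t \<in> H \<and> (\<forall>h\<in>H. \<kappa> t h = \<phi> h)"
proof -
  obtain F where F: "finite F" "F \<subseteq> H" "H \<subseteq> lie.span F" by (rule finite_H_spanning)
  have "\<exists>c. \<forall>h\<in>H. \<phi> h = (\<Sum>b\<in>F. c b * \<kappa> b h)"
  proof (rule functional_combination[OF F(1) subspace_H])
    fix h assume h: "h \<in> H" "\<And>b. b \<in> F \<Longrightarrow> \<kappa> b h = 0"
    have "lie.subspace {b. \<kappa> b h = 0}" by (simp add: lie.subspace_def \<kappa>_rules)
    then have "lie.span F \<subseteq> {b. \<kappa> b h = 0}" using h(2) by (intro lie.span_minimal) auto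
    then have "h = 0" using F(3) \<kappa>_sym[of h] by (intro \<kappa>_nondegenerate_H[OF h(1)]) auto
    then show "\<phi> h = 0" using cartan_dualD(2)[OF \<phi> H_closed(1), of 0] by simp
  qed (use cartan_dualD[OF \<phi>] \<kappa>_rules in auto)
  then obtain c where c: "\<And>h. h \<in> H \<Longrightarrow> \<phi> h = (\<Sum>b\<in>F. c b * \<kappa> b h)" by blast
  let ?t = "\<Sum>b\<in>F. scaleL (c b) b"
  have "\<kappa> ?t h = (\<Sum>b\<in>F. c b * \<kappa> b h)" for h
    using F(1) by (induction F rule: finite_induct) (simp_all add: \<kappa>_rules)
  moreover have "?t \<in> H" using F(2) H_closed(3) by (intro lie.subspace_sum[OF subspace_H]) auto
  ultimately have t: "?t \<in> H \<and> (\<forall>h\<in>H. \<kappa> ?t h = \<phi> h)" using c by simp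
  show ?thesis
  proof (rule ex1I[OF _ ])
    show "?t \<in> H \<and> (\<forall>h\<in>H. \<kappa> ?t h = \<phi> h)" by (rule t)
    fix s assume s: "s \<in> H \<and> (\<forall>h\<in>H. \<kappa> s h = \<phi> h)"
    have "s - ?t = 0"
    proof (rule \<kappa>_nondegenerate_H)
      show "s - ?t \<in> H" using s t lie.subspace_diff[OF subspace_H] by blast
      show "\<kappa> (s - ?t) h = 0" if "h \<in> H" for h
        using that s t \<kappa>_rules(1)[of s "- ?t" h] by (simp add: \<kappa>_minus)
    qed
    then show "s = ?t" by simp
  qed
qed

abbreviation dvec where "dvec \<equiv> dual_vector H \<kappa>"
abbreviation dform where "dform \<equiv> dual_form H \<kappa>"

lemma dvec:
  assumes "\<phi> \<in> cartan_dual H"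
  shows "dvec \<phi> \<in> H" "h \<in> H \<Longrightarrow> \<kappa> (dvec \<phi>) h = \<phi> h"
  using theI'[OF dual_vector_exists[OF assms]] by (auto simp: dual_vector_def)

lemma dvec_unique: "\<phi> \<in> cartan_dual H \<Longrightarrow> t \<in> H \<Longrightarrow> (\<And>h. h \<in> H \<Longrightarrow> \<kappa> t h = \<phi> h) \<Longrightarrow> dvec \<phi> = t"
  using dual_vector_exists[of \<phi>] dvec[of \<phi>] by blast

lemma dform_eval:
  assumes "\<phi> \<in> cartan_dual H" "\<psi> \<in> cartan_dual H"
  shows "dform \<phi> \<psi> = \<phi> (dvec \<psi>)"
  using dvec[OF assms(1)] dvec[OF assms(2)] by (simp add: dual_form_def)

lemma dform_sym: "dform \<phi> \<psi> = dform \<psi> \<phi>"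
  by (simp add: dual_form_def \<kappa>_sym)

lemma rootsD: assumes "\<beta> \<in> roots H"
  shows "\<beta> \<in> cartan_dual H" "\<beta> \<noteq> (\<lambda>_. 0)" "\<exists>x\<in>root_space H \<beta>. x \<noteq> 0"
proof -
  have "0 \<in> root_space H \<beta>" by (simp add: root_space_def)
  then show "\<beta> \<in> cartan_dual H" "\<beta> \<noteq> (\<lambda>_. 0)" "\<exists>x\<in>root_space H \<beta>. x \<noteq> 0"
    using assms by (auto simp: roots_def)
qed

lemma rootsI: "\<beta> \<in> cartan_dual H \<Longrightarrow> \<beta> \<noteq> (\<lambda>_. 0) \<Longrightarrow> x \<in> root_space H \<beta> \<Longrightarrow> x \<noteq> 0 \<Longrightarrow> \<beta> \<in> roots H"
  by (auto simp: roots_def)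

lemma minus_root:
  assumes "\<beta> \<in> roots H"
  shows "(\<lambda>x. - \<beta> x) \<in> roots H"
proof -
  obtain x where x: "x \<in> root_space H \<beta>" "x \<noteq> 0" using rootsD(3)[OF assms] by blast
  obtain y where y: "y \<in> root_space H (\<lambda>h. - \<beta> h)" "\<kappa> x y \<noteq> 0"
    using opposite_root_space_pairing[OF rootsD(1)[OF assms] x] by blast
  show ?thesis
    using rootsD(1,2)[OF assms] cartan_dual_closed(5) y
    by (intro rootsI[of _ y]) (auto simp: fun_eq_iff)
qed

lemma bracket_root_space:
  assumes "x \<in> root_space H \<phi>" "y \<in> root_space H \<psi>"
  shows "bracket x y \<in> root_space H (\<lambda>h. \<phi> h + \<psi> h)"
  using assms
  by (auto simp: root_space_def jacobi'[of _ x y] bracket_scaleL_left bracket_scaleL_right scaleL_add_left)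

text \<open>On \<open>H\<close> invariance gives
  \<open>\<kappa> (bracket x y) h = \<beta> h * \<kappa> x y\<close>, and \<open>y\<close> is scaled
  to make \<open>\<kappa> x y\<close> equal to 1.\<close>

lemma root_vectors:
  assumes "\<beta> \<in> roots H"
  obtains x y where "x \<in> root_space H \<beta>" "y \<in> root_space H (\<lambda>h. - \<beta> h)" "bracket x y = dvec \<beta>"
proof -
  note \<beta> = rootsD(1)[OF assms]
  obtain x where x: "x \<in> root_space H \<beta>" "x \<noteq> 0" using rootsD(3)[OF assms] by blast
  obtain y where y: "y \<in> root_space H (\<lambda>h. - \<beta> h)" "\<kappa> x y \<noteq> 0"
    using opposite_root_space_pairing[OF \<beta> x] by blast
  let ?y = "scaleL (1 / \<kappa> x y) y"
  have y': "?y \<in> root_space H (\<lambda>h. - \<beta> h)"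
    using y(1) by (simp add: root_space_def bracket_scaleL_right scaleL_scaleL mult.commute)
  have "\<kappa> (bracket x ?y) h = \<beta> h" if "h \<in> H" for h
  proof -
    have "\<kappa> (bracket x ?y) h = - \<kappa> x (bracket h ?y)"
      by (simp add: \<kappa>_inv bracket_anti[of ?y h] \<kappa>_minus)
    also have "\<dots> = \<beta> h * \<kappa> x ?y" using y' that by (simp add: root_space_def \<kappa>_rules \<kappa>_minus)
    also have "\<dots> = \<beta> h" using y(2) by (simp add: \<kappa>_rules)
    finally show ?thesis .
  qed
  moreover have "bracket x ?y \<in> H"
    using bracket_root_space[OF x(1) y'] root_space_0 by simp
  ultimately have "dvec \<beta> = bracket x ?y" by (intro dvec_unique[OF \<beta>]) auto
  then show ?thesis using that x(1) y' by simp
qed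

text \<open>\<open>bracket x y\<close> acts on a root vector \<open>z\<close> for \<gamma> by the
  nonzero scalar \<open>dform \<gamma> \<beta>\<close>, so by the Jacobi identity \<open>x\<close>
  and \<open>y\<close> cannot both kill \<open>z\<close>. This one step replaces the representation
  theory of sl2.\<close>

lemma root_string:
  assumes "\<beta> \<in> roots H" "\<gamma> \<in> roots H" "dform \<gamma> \<beta> \<noteq> 0" "\<gamma> \<noteq> \<beta>" "\<gamma> \<noteq> (\<lambda>x. - \<beta> x)"
  shows "(\<lambda>x. \<gamma> x + \<beta> x) \<in> roots H \<or> (\<lambda>x. \<gamma> x - \<beta> x) \<in> roots H"
proof -
  note \<beta> = rootsD(1)[OF assms(1)] and \<gamma> = rootsD(1)[OF assms(2)]
  obtain x y where xy: "x \<in> root_space H \<beta>" "y \<in> root_space H (\<lambda>h. - \<beta> h)" "bracket x y = dvec \<beta>"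
    by (rule root_vectors[OF assms(1)])
  obtain z where z: "z \<in> root_space H \<gamma>" "z \<noteq> 0" using rootsD(3)[OF assms(2)] by blast
  have "bracket (bracket x y) z = scaleL (dform \<gamma> \<beta>) z"
    using z(1) dvec(1)[OF \<beta>] by (simp add: xy(3) dform_eval[OF \<gamma> \<beta>] root_space_def)
  then have "bracket (bracket x y) z \<noteq> 0" using assms(3) z(2) by simp
  then have "bracket x z \<noteq> 0 \<or> bracket y z \<noteq> 0"
    using jacobi'[of x y z] by auto
  moreover have "bracket x z \<in> root_space H (\<lambda>h. \<gamma> h + \<beta> h)" "bracket y z \<in> root_space H (\<lambda>h. \<gamma> h - \<beta> h)"
    using bracket_root_space[OF xy(1) z(1)] bracket_root_space[OF xy(2) z(1)] by (simp_all add: add.commute)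
  moreover have "(\<lambda>h. \<gamma> h + \<beta> h) \<noteq> (\<lambda>_. 0)" "(\<lambda>h. \<gamma> h - \<beta> h) \<noteq> (\<lambda>_. 0)"
    using assms(4,5) by (auto simp: fun_eq_iff add_eq_0_iff2)
  ultimately show ?thesis using rootsI cartan_dual_closed(2,3) \<beta> \<gamma> by blast
qed

lemma dform_norm_add:
  assumes "\<phi> \<in> cartan_dual H" "\<psi> \<in> cartan_dual H"
  shows "dform (\<lambda>x. \<phi> x + c * \<psi> x) (\<lambda>x. \<phi> x + c * \<psi> x)
    = dform \<phi> \<phi> + 2 * c * dform \<phi> \<psi> + c * c * dform \<psi> \<psi>"
proof -
  let ?\<chi> = "\<lambda>x. \<phi> x + c * \<psi> x"
  have \<chi>: "?\<chi> \<in> cartan_dual H" by (intro cartan_dual_closed(2,4) assms)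
  have "dform ?\<chi> ?\<chi> = \<phi> (dvec ?\<chi>) + c * \<psi> (dvec ?\<chi>)" by (simp add: dform_eval \<chi>)
  also have "\<dots> = ?\<chi> (dvec \<phi>) + c * ?\<chi> (dvec \<psi>)"
    using dform_eval[OF assms(1) \<chi>] dform_eval[OF assms(2) \<chi>] dform_eval[OF \<chi> assms(1)]
      dform_eval[OF \<chi> assms(2)] dform_sym[of ?\<chi>] by simp
  also have "\<dots> = dform \<phi> \<phi> + 2 * c * dform \<phi> \<psi> + c * c * dform \<psi> \<psi>"
    using dform_eval[OF assms(1,1)] dform_eval[OF assms] dform_eval[OF assms(2,1)] dform_eval[OF assms(2,2)]
      dform_sym[of \<phi> \<psi>] by (simp add: algebra_simps)
  finally show ?thesis .
qed

text \<open>All roots have norm \<open>2\<close>, so the norm of \<open>\<gamma> + \<beta>\<close> or \<open>\<gamma> - \<beta>\<close> determines \<open>(\<gamma>, \<beta>)\<close>.\<close>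

lemma root_products:
  assumes "\<beta> \<in> roots H" "\<gamma> \<in> roots H" "\<gamma> \<noteq> \<beta>" "\<gamma> \<noteq> (\<lambda>x. - \<beta> x)"
  shows "dform \<gamma> \<beta> = 0 \<or> (dform \<gamma> \<beta> = - 1 \<and> (\<lambda>x. \<gamma> x + \<beta> x) \<in> roots H) \<or>
    (dform \<gamma> \<beta> = 1 \<and> (\<lambda>x. \<gamma> x - \<beta> x) \<in> roots H)"
proof (cases "dform \<gamma> \<beta> = 0")
  case False
  note \<beta> = rootsD(1)[OF assms(1)] and \<gamma> = rootsD(1)[OF assms(2)]
  have 1: "dform \<gamma> \<beta> = - 1" if "(\<lambda>x. \<gamma> x + \<beta> x) \<in> roots H"
  proof -
    have "4 + 2 * dform \<gamma> \<beta> = 2"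
      using dform_norm_add[OF \<gamma> \<beta>, of 1] root_norm[OF that] root_norm assms(1,2) by simp
    then have "2 * (dform \<gamma> \<beta> + 1) = 0" by (simp add: algebra_simps)
    then show ?thesis by (simp add: add_eq_0_iff2)
  qed
  have 2: "dform \<gamma> \<beta> = 1" if "(\<lambda>x. \<gamma> x - \<beta> x) \<in> roots H"
  proof -
    have "4 - 2 * dform \<gamma> \<beta> = 2"
      using dform_norm_add[OF \<gamma> \<beta>, of "-1"] root_norm[OF that] root_norm assms(1,2) by simp
    then have "2 * (dform \<gamma> \<beta> - 1) = 0" by (simp add: algebra_simps)
    then show ?thesis by simp
  qed
  show ?thesis using root_string[OF assms(1,2) False assms(3,4)] 1 2 by blast
qed simp

text \<open>Roots have norm 2, so the second claim says that reflections preserve the roots. The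
  cases \<gamma> = \<beta> and \<gamma> = -\<beta> supply the products 2 and -2.\<close>

lemma root_products':
  assumes "\<beta> \<in> roots H" "\<gamma> \<in> roots H"
  shows "dform \<gamma> \<beta> \<in> {2, -2, 0, 1, -1}" "(\<lambda>x. \<gamma> x - dform \<gamma> \<beta> * \<beta> x) \<in> roots H"
proof -
  have \<beta>2: "dform \<beta> \<beta> = 2" and \<beta>: "\<beta> \<in> cartan_dual H"
    using root_norm rootsD(1) assms by auto
  have neg: "dform (\<lambda>x. - \<beta> x) \<beta> = - 2"
    using dform_eval[OF cartan_dual_closed(5)[OF \<beta>] \<beta>] dform_eval[OF \<beta> \<beta>] \<beta>2 by simp
  consider "\<gamma> = \<beta>" | "\<gamma> = (\<lambda>x. - \<beta> x)" | "\<gamma> \<noteq> \<beta>" "\<gamma> \<noteq> (\<lambda>x. - \<beta> x)" by blast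
  then have "dform \<gamma> \<beta> \<in> {2, -2, 0, 1, -1} \<and> (\<lambda>x. \<gamma> x - dform \<gamma> \<beta> * \<beta> x) \<in> roots H"
  proof cases
    case 1
    then show ?thesis using \<beta>2 minus_root[OF assms(1)] by simp
  next
    case 2
    then show ?thesis using neg assms(1) by simp
  next
    case 3
    then show ?thesis using root_products[OF assms 3] assms(2) by auto
  qed
  then show "dform \<gamma> \<beta> \<in> {2, -2, 0, 1, -1}" "(\<lambda>x. \<gamma> x - dform \<gamma> \<beta> * \<beta> x) \<in> roots H" by auto
qed

lemma weyl_orbit_norm:
  assumes "\<phi> \<in> cartan_dual H" "\<mu> \<in> weyl_orbit H \<kappa> \<phi>"
  shows "\<mu> \<in> cartan_dual H" "dform \<mu> \<mu> = dform \<phi> \<phi>"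
proof -
  have "w \<phi> \<in> cartan_dual H \<and> dform (w \<phi>) (w \<phi>) = dform \<phi> \<phi>" if "w \<in> weyl_group H \<kappa>" for w
    using that
  proof induction
    case (weyl_step w \<beta>)
    note \<beta> = rootsD(1)[OF weyl_step(2)] and \<beta>2 = root_norm[OF weyl_step(2)]
    have w: "w \<phi> \<in> cartan_dual H" "dform (w \<phi>) (w \<phi>) = dform \<phi> \<phi>" using weyl_step by auto
    let ?c = "- dform (w \<phi>) \<beta>"
    have "root_reflection H \<kappa> \<beta> (w \<phi>) = (\<lambda>x. w \<phi> x + ?c * \<beta> x)"
      by (simp add: root_reflection_def \<beta>2)
    moreover have "(\<lambda>x. w \<phi> x + ?c * \<beta> x) \<in> cartan_dual H" by (intro cartan_dual_closed(2,4) w \<beta>)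
    ultimately show ?case using dform_norm_add[OF w(1) \<beta>, of ?c] w(2) \<beta>2 by simp
  qed (use assms in simp)
  then show "\<mu> \<in> cartan_dual H" "dform \<mu> \<mu> = dform \<phi> \<phi>"
    using assms(2) by (auto simp: weyl_orbit_def)
qed

section \<open>Weights of a minuscule representation\<close>

lemma weight_shift:
  assumes rep: "lie_representation n \<rho>" and \<beta>: "\<beta> \<in> cartan_dual H" "x \<in> root_space H \<beta>"
    and \<mu>: "\<mu> \<in> cartan_dual H" and v: "v \<in> carrier_vec n" "\<And>h. h \<in> H \<Longrightarrow> \<rho> h *\<^sub>v v = \<mu> h \<cdot>\<^sub>v v"
    and nz: "\<rho> x *\<^sub>v v \<noteq> 0\<^sub>v n"
  shows "(\<lambda>h. \<mu> h + \<beta> h) \<in> rep_weights H n \<rho>"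
proof -
  have c: "\<rho> x \<in> carrier_mat n n" for x using rep by (simp add: lie_representation_def)
  have "\<rho> h *\<^sub>v (\<rho> x *\<^sub>v v) = (\<mu> h + \<beta> h) \<cdot>\<^sub>v (\<rho> x *\<^sub>v v)" if h: "h \<in> H" for h
  proof -
    have "\<rho> (bracket h x) = \<beta> h \<cdot>\<^sub>m \<rho> x"
      using rep \<beta>(2) h by (simp add: lie_representation_def root_space_def)
    then have br: "\<rho> h * \<rho> x - \<rho> x * \<rho> h = \<beta> h \<cdot>\<^sub>m \<rho> x"
      using rep by (simp add: lie_representation_def)
    have "\<rho> h * \<rho> x = \<beta> h \<cdot>\<^sub>m \<rho> x + \<rho> x * \<rho> h"
    proof (rule eq_matI)
      fix i j assume "i < dim_row (\<beta> h \<cdot>\<^sub>m \<rho> x + \<rho> x * \<rho> h)" "j < dim_col (\<beta> h \<cdot>\<^sub>m \<rho> x + \<rho> x * \<rho> h)"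
      then have ij: "i < n" "j < n" using c[of x] c[of h] by auto
      have "(\<rho> h * \<rho> x - \<rho> x * \<rho> h) $$ (i, j) = (\<beta> h \<cdot>\<^sub>m \<rho> x) $$ (i, j)" by (simp only: br)
      then show "(\<rho> h * \<rho> x) $$ (i, j) = (\<beta> h \<cdot>\<^sub>m \<rho> x + \<rho> x * \<rho> h) $$ (i, j)"
        using ij c[of x] c[of h] by (simp del: index_mult_mat(1) add: diff_eq_eq)
    qed (use c[of x] c[of h] in auto)
    then have "\<rho> h *\<^sub>v (\<rho> x *\<^sub>v v) = (\<beta> h \<cdot>\<^sub>m \<rho> x + \<rho> x * \<rho> h) *\<^sub>v v"
      using assoc_mult_mat_vec[OF c c v(1), of h x] by simp
    also have "\<dots> = (\<beta> h \<cdot>\<^sub>m \<rho> x) *\<^sub>v v + \<rho> x *\<^sub>v (\<rho> h *\<^sub>v v)"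
      using c[of x] c[of h] v(1) assoc_mult_mat_vec[OF c c v(1), of x h]
      by (subst add_mult_distrib_mat_vec[of _ n n]) auto
    also have "\<rho> x *\<^sub>v (\<rho> h *\<^sub>v v) = \<mu> h \<cdot>\<^sub>v (\<rho> x *\<^sub>v v)"
      unfolding v(2)[OF h] using c[of x] v(1) by (rule mult_mat_vec)
    also have "(\<beta> h \<cdot>\<^sub>m \<rho> x) *\<^sub>v v = \<beta> h \<cdot>\<^sub>v (\<rho> x *\<^sub>v v)"
      using c[of x] v(1) by (intro eq_vecI) (auto simp: scalar_prod_def sum_distrib_left mult.assoc)
    finally show ?thesis
      using c[of x] v(1) by (simp add: add_smult_distrib_vec comm_add_vec[of _ n])
  qed
  moreover have "\<rho> x *\<^sub>v v \<in> carrier_vec n" using c v(1) by (rule mult_mat_vec_carrier)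
  ultimately show ?thesis
    using nz cartan_dual_closed(2)[OF \<mu> \<beta>(1)] unfolding rep_weights_def by blast
qed

text \<open>If \<open>(\<mu>, \<beta>) \<noteq> 0\<close>, then \<open>\<mu> + \<beta>\<close> or \<open>\<mu> - \<beta>\<close> is a weight, which has the same norm as \<open>\<mu>\<close>.\<close>

lemma minuscule_products:
  assumes min: "minuscule H \<kappa> \<alpha> lam" and \<mu>: "\<mu> \<in> weyl_orbit H \<kappa> lam" and \<beta>: "\<beta> \<in> roots H"
  shows "dform \<mu> \<beta> \<in> {0, 1, -1}"
proof -
  note \<beta>d = rootsD(1)[OF \<beta>] and \<beta>2 = root_norm[OF \<beta>]
  have lam: "lam \<in> cartan_dual H" using min by (simp add: minuscule_def dominant_weight_def)
  obtain n \<rho> where irr: "irreducible_representation n \<rho>" and wts: "rep_weights H n \<rho> = weyl_orbit H \<kappa> lam"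
    using min by (auto simp: minuscule_def)
  have rep: "lie_representation n \<rho>" using irr by (simp add: irreducible_representation_def)
  then have c: "\<rho> x \<in> carrier_mat n n" for x by (simp add: lie_representation_def)
  have \<mu>d: "\<mu> \<in> cartan_dual H" using weyl_orbit_norm[OF lam \<mu>] by simp
  obtain v where v: "v \<in> carrier_vec n" "v \<noteq> 0\<^sub>v n" "\<And>h. h \<in> H \<Longrightarrow> \<rho> h *\<^sub>v v = \<mu> h \<cdot>\<^sub>v v"
    using \<mu> unfolding wts[symmetric] rep_weights_def by blast
  obtain x y where xy: "x \<in> root_space H \<beta>" "y \<in> root_space H (\<lambda>h. - \<beta> h)" "bracket x y = dvec \<beta>"
    by (rule root_vectors[OF \<beta>])
  have norms: "dform \<mu> \<mu> = dform \<mu>' \<mu>'" if "\<mu>' \<in> rep_weights H n \<rho>" for \<mu>'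
    using weyl_orbit_norm(2)[OF lam] \<mu> that wts by simp
  show ?thesis
  proof (cases "dform \<mu> \<beta> = 0")
    case False
    \<comment> \<open>If both root vectors killed \<open>v\<close>, so would their bracket
      \<open>dvec \<beta>\<close>, which acts on \<open>v\<close> by the scalar
      \<open>dform \<mu> \<beta>\<close>.\<close>
    have "\<rho> x *\<^sub>v v \<noteq> 0\<^sub>v n \<or> \<rho> y *\<^sub>v v \<noteq> 0\<^sub>v n"
    proof (rule ccontr)
      assume "\<not> ?thesis"
      then have z: "\<rho> x *\<^sub>v v = 0\<^sub>v n" "\<rho> y *\<^sub>v v = 0\<^sub>v n" by auto
      have "\<rho> (dvec \<beta>) *\<^sub>v v = (\<rho> x * \<rho> y - \<rho> y * \<rho> x) *\<^sub>v v"
        using rep unfolding xy(3)[symmetric] by (simp add: lie_representation_def)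
      also have "\<dots> = \<rho> x *\<^sub>v (\<rho> y *\<^sub>v v) - \<rho> y *\<^sub>v (\<rho> x *\<^sub>v v)"
        using minus_mult_distrib_mat_vec[OF mult_carrier_mat[OF c c] mult_carrier_mat[OF c c] v(1), of x y y x]
          assoc_mult_mat_vec[OF c c v(1)] by simp
      also have "\<dots> = 0\<^sub>v n"
        unfolding z using c[of x] c[of y] by (intro eq_vecI) (auto simp: scalar_prod_def)
      finally have "dform \<mu> \<beta> \<cdot>\<^sub>v v = 0\<^sub>v n"
        using v(3)[OF dvec(1)[OF \<beta>d]] by (simp add: dform_eval[OF \<mu>d \<beta>d])
      then have "dform \<mu> \<beta> * v $ k = 0" if "k < n" for k
        using that v(1) by (metis carrier_vecD index_smult_vec(1) index_zero_vec(1))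
      then have "v = 0\<^sub>v n" using False v(1) by (intro eq_vecI) auto
      then show False using v(2) by simp
    qed
    then show ?thesis
    proof
      assume "\<rho> x *\<^sub>v v \<noteq> 0\<^sub>v n"
      from norms[OF weight_shift[OF rep \<beta>d xy(1) \<mu>d v(1,3) this]]
      have "2 * (dform \<mu> \<beta> + 1) = 0" using dform_norm_add[OF \<mu>d \<beta>d, of 1] \<beta>2 by (simp add: algebra_simps)
      then show ?thesis by (simp add: add_eq_0_iff2)
    next
      assume "\<rho> y *\<^sub>v v \<noteq> 0\<^sub>v n"
      from norms[OF weight_shift[OF rep cartan_dual_closed(5)[OF \<beta>d] xy(2) \<mu>d v(1,3) this]]
      have "2 * (dform \<mu> \<beta> - 1) = 0" using dform_norm_add[OF \<mu>d \<beta>d, of "-1"] \<beta>2 by (simp add: algebra_simps)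
      then show ?thesis by simp
    qed
  qed simp
qed

end

section \<open>Positivity of the root form\<close>

context simply_laced_lie_algebra
begin

definition comb :: "('i \<Rightarrow> complex) \<Rightarrow> 'g \<Rightarrow> complex" where
  "comb c = (\<lambda>x. \<Sum>i\<in>UNIV. c i * \<alpha> i x)"

lemma root_sum_eq_comb: "root_sum \<alpha> c = comb (\<lambda>i. of_nat (c i))"
  by (simp add: root_sum_def comb_def)

lemma simple_root: "\<alpha> i \<in> roots H" "\<alpha> i \<in> cartan_dual H" "dform (\<alpha> i) (\<alpha> i) = 2"
proof -
  show r: "\<alpha> i \<in> roots H" using simple_roots by (simp add: simple_roots_def)
  show "\<alpha> i \<in> cartan_dual H" "dform (\<alpha> i) (\<alpha> i) = 2" using rootsD(1)[OF r] root_norm[OF r] by auto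
qed

lemma comb_in_cartan_dual: "comb c \<in> cartan_dual H"
  using cartan_dualD[OF simple_root(2)]
  by (auto simp: cartan_dual_def comb_def distrib_left sum.distrib sum_distrib_left mult.left_commute
      intro!: sum.cong)

lemma comb_inj:
  assumes "comb b = comb c"
  shows "b = c"
proof -
  have "(\<Sum>i\<in>UNIV. (b i - c i) * \<alpha> i x) = 0" for x
    using fun_cong[OF assms, of x] by (simp add: comb_def left_diff_distrib sum_subtractf)
  then have "b i - c i = 0" for i
    using simple_roots[unfolded simple_roots_def] by (elim conjE allE[of _ "\<lambda>i. b i - c i"]) blast
  then show ?thesis by (auto simp: fun_eq_iff)
qed

lemma comb_single: "comb (\<lambda>k. if k = i then c else 0) = (\<lambda>x. c * \<alpha> i x)"
proof -
  have "(if k = i then c else 0) * \<alpha> k x = (if k = i then c * \<alpha> i x else 0)" for k x by simp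
  then show ?thesis by (simp add: comb_def)
qed

lemma comb_diff: "comb (\<lambda>k. b k - c k) = (\<lambda>x. comb b x - comb c x)"
  by (simp add: comb_def left_diff_distrib sum_subtractf)

lemma comb_0: "comb (\<lambda>_. 0) = (\<lambda>_. 0)"
  by (simp add: comb_def)

lemma dform_comb:
  assumes "\<psi> \<in> cartan_dual H"
  shows "dform (comb c) \<psi> = (\<Sum>i\<in>UNIV. c i * dform (\<alpha> i) \<psi>)"
  unfolding dform_eval[OF comb_in_cartan_dual assms] dform_eval[OF simple_root(2) assms]
  by (simp add: comb_def)

lemma root_as_comb:
  assumes "\<beta> \<in> roots H"
  obtains c where "\<beta> = comb (\<lambda>i. of_nat (c i)) \<or> \<beta> = comb (\<lambda>i. - of_nat (c i))"
proof -
  obtain c where "\<beta> = root_sum \<alpha> c \<or> \<beta> = (\<lambda>x. - root_sum \<alpha> c x)"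
    using simple_roots assms unfolding simple_roots_def by blast
  then show ?thesis using that[of c] by (simp add: root_sum_eq_comb comb_def sum_negf)
qed

definition gram :: "'i \<Rightarrow> 'i \<Rightarrow> int" where
  "gram i j = (if i = j then 2 else if dform (\<alpha> i) (\<alpha> j) = 0 then 0 else - 1)"

text \<open>Among distinct simple roots the product 1 is excluded: it would make
  \<open>\<alpha> i - \<alpha> j\<close> a root, whose coefficients have mixed signs.\<close>

lemma dform_simple: "dform (\<alpha> i) (\<alpha> j) = of_int (gram i j)"
proof (cases "i = j")
  case False
  let ?e = "\<lambda>i c k. if k = i then c else (0 :: complex)"
  have neq: "\<alpha> i \<noteq> \<alpha> j"
  proof
    assume "\<alpha> i = \<alpha> j"
    then have "comb (?e i 1) = comb (?e j 1)" by (simp add: comb_single)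
    from fun_cong[OF comb_inj[OF this], of i] show False using False by simp
  qed
  have neq': "\<alpha> i \<noteq> (\<lambda>x. - \<alpha> j x)"
  proof
    assume "\<alpha> i = (\<lambda>x. - \<alpha> j x)"
    then have "comb (?e i 1) = comb (?e j (- 1))" by (simp add: comb_single)
    from fun_cong[OF comb_inj[OF this], of i] show False using False by simp
  qed
  have "(\<lambda>x. \<alpha> i x - \<alpha> j x) \<notin> roots H"
  proof
    assume "(\<lambda>x. \<alpha> i x - \<alpha> j x) \<in> roots H"
    then obtain c where c: "(\<lambda>x. \<alpha> i x - \<alpha> j x) = comb (\<lambda>i. of_nat (c i)) \<or>
        (\<lambda>x. \<alpha> i x - \<alpha> j x) = comb (\<lambda>i. - of_nat (c i))" by (rule root_as_comb)
    have "(\<lambda>x. \<alpha> i x - \<alpha> j x) = comb (\<lambda>k. ?e i 1 k - ?e j 1 k)"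
      by (simp only: comb_diff comb_single mult_1)
    then have "comb (\<lambda>k. ?e i 1 k - ?e j 1 k) = comb (\<lambda>i. of_nat (c i)) \<or>
        comb (\<lambda>k. ?e i 1 k - ?e j 1 k) = comb (\<lambda>i. - of_nat (c i))"
      using c by (simp only:)
    then have "(\<lambda>k. ?e i 1 k - ?e j 1 k) = (\<lambda>i. of_nat (c i)) \<or>
        (\<lambda>k. ?e i 1 k - ?e j 1 k) = (\<lambda>i. - of_nat (c i))"
      using comb_inj by blast
    then show False
    proof
      assume "(\<lambda>k. ?e i 1 k - ?e j 1 k) = (\<lambda>i. of_nat (c i))"
      from arg_cong[OF fun_cong[OF this, of j], of Re] have "- 1 = real (c j)" using False by simp
      then show False using of_nat_0_le_iff[of "c j", where 'a = real] by linarith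
    next
      assume "(\<lambda>k. ?e i 1 k - ?e j 1 k) = (\<lambda>i. - of_nat (c i))"
      from arg_cong[OF fun_cong[OF this, of i], of Re] have "1 = - real (c i)" using False by simp
      then show False using of_nat_0_le_iff[of "c i", where 'a = real] by linarith
    qed
  qed
  then show ?thesis
    using root_products[OF simple_root(1) simple_root(1) neq neq'] False by (auto simp: gram_def)
qed (simp add: gram_def simple_root)

lemma gram_sym: "gram i j = gram j i"
  by (simp add: gram_def dform_sym)

lemma dform_comb_comb: "dform (comb b) (comb c) = (\<Sum>i\<in>UNIV. \<Sum>j\<in>UNIV. b i * c j * of_int (gram i j))"
proof -
  have "dform (\<alpha> i) (comb c) = (\<Sum>j\<in>UNIV. c j * of_int (gram i j))" for i
    unfolding dform_sym[of "\<alpha> i"] dform_comb[OF simple_root(2)] dform_simple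
    by (simp add: gram_sym[of i])
  then show ?thesis
    by (simp add: dform_comb comb_in_cartan_dual sum_distrib_left mult.assoc)
qed

text \<open>The dual vector of \<phi> is annihilated by the simple roots, hence by all roots, so it
  is central. The center is an ideal of a simple nonabelian algebra and therefore zero.\<close>

lemma eq_0_if_orthogonal_to_simple_roots:
  assumes \<phi>: "\<phi> \<in> cartan_dual H" and orth: "\<And>i. dform \<phi> (\<alpha> i) = 0"
  shows "\<phi> = (\<lambda>_. 0)"
proof -
  let ?t = "dvec \<phi>"
  have "\<alpha> i ?t = 0" for i
    using orth[of i] dform_sym[of \<phi>] dform_eval[OF simple_root(2) \<phi>] by simp
  then have comb0: "comb c ?t = 0" for c by (simp add: comb_def)
  have root0: "\<psi> ?t = 0" if "\<psi> \<in> roots H" for \<psi>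
    by (rule root_as_comb[OF that]) (auto simp: comb0)
  have "(\<Union>\<psi>\<in>cartan_dual H. root_space H \<psi>) \<subseteq> {y. bracket ?t y = 0}"
  proof clarify
    fix \<psi> y assume \<psi>: "\<psi> \<in> cartan_dual H" and y: "y \<in> root_space H \<psi>"
    have "y = 0 \<or> \<psi> ?t = 0" using root0 rootsI[OF \<psi> _ y] by (cases "\<psi> = (\<lambda>_. 0)") auto
    then show "bracket ?t y = 0" using y dvec(1)[OF \<phi>] by (auto simp: root_space_def)
  qed
  moreover have "lie.subspace {y. bracket ?t y = 0}"
    by (simp add: lie.subspace_def bracket_add_right bracket_scaleL_right)
  ultimately have "lie.span (\<Union>\<psi>\<in>cartan_dual H. root_space H \<psi>) \<subseteq> {y. bracket ?t y = 0}"
    by (rule lie.span_minimal)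
  then have t: "bracket ?t y = 0" for y unfolding root_spaces_span by blast
  define Z where "Z = {z :: 'g. \<forall>x. bracket z x = 0}"
  have "lie_ideal Z"
    unfolding lie_ideal_def lie_subspace_eq lie.subspace_def Z_def
    by (auto simp: bracket_add_left bracket_scaleL_left) (metis bracket_0(1) bracket_anti neg_0_equal_iff_equal)
  then have "Z = {0} \<or> Z = UNIV" and "\<exists>x y :: 'g. bracket x y \<noteq> 0"
    using simple by (auto simp: simple_lie_algebra_def)
  then have "Z = {0}" by (auto simp: Z_def)
  then have "?t = 0" using t by (auto simp: Z_def)
  then have "\<phi> h = 0" if "h \<in> H" for h using dvec(2)[OF \<phi> that] by simp
  then show ?thesis using cartan_dualD(3)[OF \<phi>] by (auto simp: fun_eq_iff)
qed

text \<open>A root is determined by its products with the simple roots, each of which takes one of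
  five values.\<close>

lemma finite_roots: "finite (roots H)"
proof (rule finite_imageD)
  let ?f = "\<lambda>\<gamma> i. dform \<gamma> (\<alpha> i)"
  have "?f ` roots H \<subseteq> (\<Pi>\<^sub>E i\<in>UNIV. {2, -2, 0, 1, -1})"
    using root_products'(1)[OF simple_root(1)] by (auto simp: PiE_def)
  then show "finite (?f ` roots H)" by (rule finite_subset) (simp add: finite_PiE)
  show "inj_on ?f (roots H)"
  proof (rule inj_onI)
    fix \<gamma> \<gamma>' assume \<gamma>: "\<gamma> \<in> roots H" "\<gamma>' \<in> roots H" and eq: "?f \<gamma> = ?f \<gamma>'"
    note d = rootsD(1)[OF \<gamma>(1)] rootsD(1)[OF \<gamma>(2)]
    have "(\<lambda>x. \<gamma> x - \<gamma>' x) = (\<lambda>_. 0)"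
    proof (rule eq_0_if_orthogonal_to_simple_roots[OF cartan_dual_closed(3)[OF d]])
      show "dform (\<lambda>x. \<gamma> x - \<gamma>' x) (\<alpha> i) = 0" for i
        using fun_cong[OF eq, of i]
        by (simp add: dform_eval cartan_dual_closed(3) d simple_root)
    qed
    then show "\<gamma> = \<gamma>'" by (simp add: fun_eq_iff)
  qed
qed

text \<open>The form \<open>B i j = (\<Sum>\<gamma>. (\<gamma>, \<alpha> i) (\<gamma>, \<alpha> j))\<close> is positive semidefinite and invariant under
  reflections. Invariance gives \<open>2 B i j = gram i j * B j j\<close>, so rescaling the simple roots turns
  \<open>gram\<close> into a multiple of \<open>B\<close>.\<close>

theorem gram_positive:
  fixes x :: "'i \<Rightarrow> real"
  assumes "x \<noteq> (\<lambda>_. 0)"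
  shows "(\<Sum>i\<in>UNIV. \<Sum>j\<in>UNIV. x i * x j * of_int (gram i j)) > 0"
proof -
  \<comment> \<open>The products are among 0, 1, -1, 2 and -2, so the real part loses nothing and
    makes sums of squares available.\<close>
  define N where "N = (\<lambda>\<gamma> i. Re (dform \<gamma> (\<alpha> i)))"
  have N: "dform \<gamma> (\<alpha> i) = of_real (N \<gamma> i)" if "\<gamma> \<in> roots H" for \<gamma> i
    using root_products'(1)[OF simple_root(1) that, of i] by (auto simp: N_def)
  define B where "B = (\<lambda>i j. \<Sum>\<gamma>\<in>roots H. N \<gamma> i * N \<gamma> j)"
  define s where "s = (\<lambda>j \<gamma> x. \<gamma> x - dform \<gamma> (\<alpha> j) * \<alpha> j x)"
  have s_apply: "s j \<gamma> = (\<lambda>x. \<gamma> x - dform \<gamma> (\<alpha> j) * \<alpha> j x)" for j \<gamma> by (simp add: s_def)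
  have s: "s j \<gamma> \<in> roots H" if "\<gamma> \<in> roots H" for j \<gamma>
    unfolding s_def by (rule root_products'(2)[OF simple_root(1) that])
  have ds: "dform (s j \<gamma>) (\<alpha> i) = dform \<gamma> (\<alpha> i) - dform \<gamma> (\<alpha> j) * of_int (gram j i)"
    if "\<gamma> \<in> roots H" for i j \<gamma>
    using dform_eval[OF rootsD(1)[OF s[OF that]] simple_root(2), of j i]
      dform_eval[OF rootsD(1)[OF that] simple_root(2), of i]
      dform_eval[OF simple_root(2) simple_root(2), of j i]
    by (simp add: s_def dform_simple)
  have Ns: "N (s j \<gamma>) i = N \<gamma> i - N \<gamma> j * of_int (gram j i)" if "\<gamma> \<in> roots H" for i j \<gamma>
  proof -
    have "complex_of_real (N (s j \<gamma>) i) = of_real (N \<gamma> i - N \<gamma> j * of_int (gram j i))"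
      using ds[OF that, of j i] N[OF that] N[OF s[OF that]] by simp
    then show ?thesis by (simp only: of_real_eq_iff)
  qed
  have gii: "gram i i = 2" for i by (simp add: gram_def)
  \<comment> \<open>A simple reflection is an involution of the set of roots, so the sum defining
    \<open>B\<close> may be taken over reflected roots.\<close>
  have bij: "bij_betw (s j) (roots H) (roots H)" for j
  proof (rule bij_betw_byWitness[where f' = "s j"])
    have "s j (s j \<gamma>) = \<gamma>" if "\<gamma> \<in> roots H" for \<gamma>
      unfolding s_apply[of j "s j \<gamma>"] ds[OF that, of j j] gii by (simp add: s_apply fun_eq_iff)
    then show "\<forall>\<gamma>\<in>roots H. s j (s j \<gamma>) = \<gamma>" "\<forall>\<gamma>\<in>roots H. s j (s j \<gamma>) = \<gamma>" by auto
  qed (use s in auto)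
  have 2: "2 * B i j = of_int (gram i j) * B j j" for i j
  proof -
    have "B i j = (\<Sum>\<gamma>\<in>roots H. N (s j \<gamma>) i * N (s j \<gamma>) j)"
      unfolding B_def by (rule sum.reindex_bij_betw[OF bij, symmetric])
    also have "\<dots> = (\<Sum>\<gamma>\<in>roots H. of_int (gram j i) * (N \<gamma> j * N \<gamma> j) - N \<gamma> i * N \<gamma> j)"
      by (rule sum.cong) (simp_all add: Ns gii algebra_simps)
    also have "\<dots> = of_int (gram j i) * B j j - B i j"
      by (simp add: B_def sum_subtractf sum_distrib_left)
    finally show ?thesis by (simp add: gram_sym[of i])
  qed
  have Bpos: "B i i > 0" for i
  proof -
    have "0 < N (\<alpha> i) i * N (\<alpha> i) i" by (simp add: N_def simple_root)
    also have "\<dots> \<le> B i i"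
      unfolding B_def by (rule member_le_sum[OF simple_root(1)]) (simp_all add: finite_roots)
    finally show ?thesis .
  qed
  \<comment> \<open>Symmetry of \<open>B\<close> equates the diagonal entries at adjacent vertices;
    for nonadjacent ones both \<open>gram i j\<close> and \<open>B i j\<close> vanish. This makes
    the vertexwise scaling \<open>y\<close> consistent.\<close>
  have Beq: "B i i = B j j" if "gram i j \<noteq> 0" for i j
  proof -
    have "B i j = B j i" by (simp add: B_def mult.commute)
    then have "of_int (gram i j) * B i i = of_int (gram i j) * B j j"
      using 2[of i j] 2[of j i] gram_sym[of i j] by simp
    then show ?thesis using that by simp
  qed
  define y where "y = (\<lambda>i. x i / sqrt (B i i))"
  have term_eq: "y i * y j * (2 * B i j) = x i * x j * of_int (gram i j)" for i j
  proof (cases "gram i j = 0")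
    case True
    then show ?thesis using 2[of i j] by simp
  next
    case False
    have "y i * y j = x i * x j / B j j"
      using Beq[OF False] Bpos[of j] by (simp add: y_def)
    then show ?thesis using 2[of i j] Bpos[of j] by simp
  qed
  have "(\<Sum>i\<in>UNIV. \<Sum>j\<in>UNIV. x i * x j * of_int (gram i j))
      = 2 * (\<Sum>i\<in>UNIV. \<Sum>j\<in>UNIV. \<Sum>\<gamma>\<in>roots H. (y i * N \<gamma> i) * (y j * N \<gamma> j))"
    unfolding term_eq[symmetric] B_def sum_distrib_left
    by (intro sum.cong refl) (simp add: algebra_simps)
  also have "(\<Sum>i\<in>UNIV. \<Sum>j\<in>UNIV. \<Sum>\<gamma>\<in>roots H. (y i * N \<gamma> i) * (y j * N \<gamma> j))
      = (\<Sum>\<gamma>\<in>roots H. (\<Sum>i\<in>UNIV. y i * N \<gamma> i)\<^sup>2)"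
  proof -
    have "(\<Sum>i\<in>UNIV. \<Sum>j\<in>UNIV. \<Sum>\<gamma>\<in>roots H. (y i * N \<gamma> i) * (y j * N \<gamma> j))
        = (\<Sum>i\<in>UNIV. \<Sum>\<gamma>\<in>roots H. \<Sum>j\<in>UNIV. (y i * N \<gamma> i) * (y j * N \<gamma> j))"
      by (intro sum.cong refl) (rule sum.swap)
    also have "\<dots> = (\<Sum>\<gamma>\<in>roots H. \<Sum>i\<in>UNIV. \<Sum>j\<in>UNIV. (y i * N \<gamma> i) * (y j * N \<gamma> j))"
      by (rule sum.swap)
    finally show ?thesis by (simp add: power2_eq_square sum_product)
  qed
  finally have eq: "(\<Sum>i\<in>UNIV. \<Sum>j\<in>UNIV. x i * x j * of_int (gram i j))
      = 2 * (\<Sum>\<gamma>\<in>roots H. (\<Sum>i\<in>UNIV. y i * N \<gamma> i)\<^sup>2)" .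
  \<comment> \<open>Strictness: if the squares for all simple roots vanished, the combination with
    coefficients \<open>y\<close> would be orthogonal to every simple root and hence zero.\<close>
  have "\<exists>k. (\<Sum>i\<in>UNIV. y i * N (\<alpha> k) i) \<noteq> 0"
  proof (rule ccontr)
    assume "\<not> ?thesis"
    then have z: "(\<Sum>i\<in>UNIV. y i * N (\<alpha> k) i) = 0" for k by blast
    have "dform (comb (\<lambda>i. of_real (y i))) (\<alpha> k) = 0" for k
    proof -
      have "dform (comb (\<lambda>i. of_real (y i))) (\<alpha> k) = (\<Sum>i\<in>UNIV. of_real (y i) * dform (\<alpha> k) (\<alpha> i))"
        by (simp add: dform_comb simple_root dform_sym[of "\<alpha> k"])
      also have "\<dots> = of_real (\<Sum>i\<in>UNIV. y i * N (\<alpha> k) i)" by (simp add: N[OF simple_root(1)])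
      finally show ?thesis by (simp add: z)
    qed
    then have "comb (\<lambda>i. of_real (y i)) = comb (\<lambda>_. 0)"
      using eq_0_if_orthogonal_to_simple_roots[OF comb_in_cartan_dual] comb_0 by simp
    then have "(\<lambda>i. complex_of_real (y i)) = (\<lambda>_. 0)" by (rule comb_inj)
    then have "y i = 0" for i by (metis of_real_eq_0_iff)
    moreover have "sqrt (B i i) \<noteq> 0" for i using Bpos[of i] by simp
    ultimately have "x = (\<lambda>_. 0)" by (auto simp: y_def fun_eq_iff)
    then show False using assms by simp
  qed
  then obtain k where "(\<Sum>i\<in>UNIV. y i * N (\<alpha> k) i) \<noteq> 0" by blast
  then have "0 < (\<Sum>i\<in>UNIV. y i * N (\<alpha> k) i)\<^sup>2" by simp
  also have "\<dots> \<le> (\<Sum>\<gamma>\<in>roots H. (\<Sum>i\<in>UNIV. y i * N \<gamma> i)\<^sup>2)"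
    by (rule member_le_sum[OF simple_root(1)]) (simp_all add: finite_roots)
  finally show ?thesis unfolding eq by simp
qed

end

section \<open>The symmetrized Euler form and its vectors of norm 2\<close>

locale simply_laced_quiver = simply_laced_lie_algebra H \<kappa> \<alpha>
  for H :: "'g::complex_lie_algebra set" and \<kappa> and \<alpha> :: "'i::finite \<Rightarrow> 'g \<Rightarrow> complex" +
  fixes Q :: "('i \<times> 'i) set"
  assumes orientation: "dynkin_orientation H \<kappa> \<alpha> Q"
begin

abbreviation euler :: "('i \<Rightarrow> nat) \<Rightarrow> ('i \<Rightarrow> nat) \<Rightarrow> int" where
  "euler b c \<equiv> euler_form Q (\<lambda>i. int (b i)) (\<lambda>i. int (c i))"

lemma gram_quiver:
  "gram i j = (if i = j then 2 else 0) - (if (i, j) \<in> Q then 1 else 0) - (if (j, i) \<in> Q then 1 else 0)"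
  using orientation unfolding dynkin_orientation_def gram_def by auto

lemma symmetrized_euler_form:
  "euler_form Q x y + euler_form Q y x = (\<Sum>i\<in>UNIV. \<Sum>j\<in>UNIV. x i * y j * gram i j)"
proof -
  have Q: "(\<Sum>(i, j)\<in>Q. f i j) = (\<Sum>i\<in>UNIV. \<Sum>j\<in>UNIV. if (i, j) \<in> Q then f i j else 0)"
    for f :: "'i \<Rightarrow> 'i \<Rightarrow> int"
  proof -
    have "(\<Sum>i\<in>UNIV. \<Sum>j\<in>UNIV. if (i, j) \<in> Q then f i j else 0)
        = (\<Sum>a\<in>UNIV. if a \<in> Q then f (fst a) (snd a) else 0)"
      by (simp add: sum.cartesian_product split_def)
    also have "\<dots> = (\<Sum>a\<in>Q. f (fst a) (snd a))" by (simp add: sum.If_cases)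
    finally show ?thesis by (simp add: split_def)
  qed
  have diag: "(\<Sum>i\<in>UNIV. \<Sum>j\<in>UNIV. if i = j then 2 * (x i * y j) else 0) = 2 * (\<Sum>i\<in>UNIV. x i * y i)"
    by (simp add: sum_distrib_left)
  have swap: "(\<Sum>i\<in>UNIV. \<Sum>j\<in>UNIV. if (i, j) \<in> Q then y i * x j else 0)
      = (\<Sum>i\<in>UNIV. \<Sum>j\<in>UNIV. if (j, i) \<in> Q then x i * y j else 0)"
    by (subst sum.swap) (intro sum.cong refl, simp add: mult.commute)
  have "x i * y j * gram i j = (if i = j then 2 * (x i * y j) else 0)
      - (if (i, j) \<in> Q then x i * y j else 0) - (if (j, i) \<in> Q then x i * y j else 0)" for i j
    by (simp add: gram_quiver algebra_simps)
  then have "(\<Sum>i\<in>UNIV. \<Sum>j\<in>UNIV. x i * y j * gram i j) = 2 * (\<Sum>i\<in>UNIV. x i * y i)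
      - (\<Sum>(i, j)\<in>Q. x i * y j) - (\<Sum>(i, j)\<in>Q. y i * x j)"
    unfolding Q swap diag[symmetric] by (simp add: sum_subtractf)
  then show ?thesis by (simp add: euler_form_def mult.commute)
qed

lemma dform_root_sum: "dform (root_sum \<alpha> b) (root_sum \<alpha> c) = of_int (euler b c + euler c b)"
  unfolding symmetrized_euler_form root_sum_eq_comb dform_comb_comb by simp

sublocale definite_quiver Q
proof
  fix d :: "'i \<Rightarrow> nat" assume d: "d \<noteq> (\<lambda>_. 0)"
  have "(\<lambda>i. real (d i)) \<noteq> (\<lambda>_. 0)"
  proof
    assume "(\<lambda>i. real (d i)) = (\<lambda>_. 0)"
    then have "d i = 0" for i by (metis of_nat_eq_0_iff)
    then show False using d by auto
  qed
  then have "0 < (\<Sum>i\<in>UNIV. \<Sum>j\<in>UNIV. real (d i) * real (d j) * of_int (gram i j))"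
    by (rule gram_positive)
  also have "\<dots> = of_int (\<Sum>i\<in>UNIV. \<Sum>j\<in>UNIV. int (d i) * int (d j) * gram i j)" by simp
  finally have "0 < (\<Sum>i\<in>UNIV. \<Sum>j\<in>UNIV. int (d i) * int (d j) * gram i j)" by (simp only: of_int_0_less_iff)
  then show "euler d d > 0" using symmetrized_euler_form[of "\<lambda>i. int (d i)" "\<lambda>i. int (d i)"] by simp
qed

text \<open>Induction on height: subtracting a suitable simple root \<open>\<alpha> i\<close> gives
  either 0 or a vector of norm 2, which is a root with product -1 with \<open>\<alpha> i\<close>; so
  adding \<open>\<alpha> i\<close> back gives a root.\<close>

theorem root_if_euler_form_1:
  assumes "euler d d = 1"
  shows "root_sum \<alpha> d \<in> roots H"
  using assms
proof (induction "\<Sum>i\<in>UNIV. d i" arbitrary: d rule: less_induct)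
  case less
  let ?\<beta> = "root_sum \<alpha> d"
  have \<beta>: "?\<beta> \<in> cartan_dual H" by (simp add: root_sum_eq_comb comb_in_cartan_dual)
  have norm: "dform ?\<beta> ?\<beta> = 2" using dform_root_sum[of d d] less.prems by simp
  define m where "m = (\<lambda>i. \<Sum>j\<in>UNIV. int (d j) * gram j i)"
  have m: "dform ?\<beta> (\<alpha> i) = of_int (m i)" for i
    by (simp add: m_def root_sum_eq_comb dform_comb simple_root dform_simple)
  have sum2: "(\<Sum>i\<in>UNIV. int (d i) * m i) = 2"
  proof -
    have "complex_of_int (\<Sum>i\<in>UNIV. int (d i) * m i) = (\<Sum>i\<in>UNIV. of_nat (d i) * dform (\<alpha> i) ?\<beta>)"
      by (simp add: m[symmetric] dform_sym[of "\<alpha> _"])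
    also have "\<dots> = dform ?\<beta> ?\<beta>" unfolding root_sum_eq_comb by (simp add: dform_comb comb_in_cartan_dual)
    finally show ?thesis using norm by (metis of_int_eq_iff of_int_numeral)
  qed
  \<comment> \<open>The weighted sum of the products \<open>m i\<close> is the norm 2, so some
    simple root occurring in \<open>d\<close> has a positive product with it.\<close>
  have "\<exists>i. int (d i) * m i > 0"
  proof (rule ccontr)
    assume "\<not> ?thesis"
    then have "(\<Sum>i\<in>UNIV. int (d i) * m i) \<le> 0" by (intro sum_nonpos) (simp add: not_less)
    then show False using sum2 by simp
  qed
  then obtain i where i: "int (d i) * m i > 0" by blast
  then have di: "d i > 0" and mi: "m i > 0" by (auto simp: zero_less_mult_iff)
  define d' where "d' = d(i := d i - 1)"
  have d: "d k = d' k + (if k = i then 1 else 0)" for k using di by (simp add: d'_def)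
  have \<beta>': "?\<beta> = (\<lambda>x. root_sum \<alpha> d' x + \<alpha> i x)"
  proof
    fix x
    have "of_nat (d k) * \<alpha> k x = of_nat (d' k) * \<alpha> k x + (if k = i then \<alpha> i x else 0)" for k
      by (simp add: d algebra_simps)
    then show "?\<beta> x = root_sum \<alpha> d' x + \<alpha> i x" by (simp add: root_sum_def sum.distrib)
  qed
  show ?case
  proof (cases "d' = (\<lambda>_. 0)")
    case True
    then have "?\<beta> = \<alpha> i" unfolding \<beta>' by (simp add: root_sum_def)
    then show ?thesis using simple_root by simp
  next
    case False
    let ?\<beta>' = "root_sum \<alpha> d'"
    have \<beta>'d: "?\<beta>' \<in> cartan_dual H" by (simp add: root_sum_eq_comb comb_in_cartan_dual)
    have \<beta>'_eq: "?\<beta>' = (\<lambda>x. ?\<beta> x + (- 1) * \<alpha> i x)" unfolding \<beta>' by simp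
    have "of_int (2 * euler d' d') = dform ?\<beta>' ?\<beta>'" by (simp add: dform_root_sum)
    also have "\<dots> = of_int (4 - 2 * m i)"
      unfolding \<beta>'_eq dform_norm_add[OF \<beta> simple_root(2)] by (simp add: norm m simple_root)
    finally have e: "2 * euler d' d' = 4 - 2 * m i" by (simp only: of_int_eq_iff)
    \<comment> \<open>The norm \<open>4 - 2 * m i\<close> of the smaller nonzero vector is positive,
      which leaves only \<open>m i = 1\<close> and norm 2.\<close>
    then have mi1: "m i = 1" using euler_form_pos[OF False] mi by simp
    have "(\<Sum>k\<in>UNIV. d' k) < (\<Sum>k\<in>UNIV. d k)" by (simp add: d sum.distrib)
    then have r: "?\<beta>' \<in> roots H" using less.hyps e mi1 by simp
    have "dform ?\<beta>' (\<alpha> i) = dform ?\<beta> (\<alpha> i) - 2"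
      using dform_eval[OF \<beta> simple_root(2), of i] dform_eval[OF \<beta>'d simple_root(2), of i]
        dform_eval[OF simple_root(2) simple_root(2), of i i] simple_root(3)[of i]
      by (simp add: \<beta>')
    then have prod: "dform ?\<beta>' (\<alpha> i) = - 1" using m[of i] mi1 by simp
    have "?\<beta>' \<noteq> \<alpha> i" using prod simple_root(3)[of i] by auto
    moreover have "?\<beta>' \<noteq> (\<lambda>x. - \<alpha> i x)"
    proof
      assume "?\<beta>' = (\<lambda>x. - \<alpha> i x)"
      then have "dform ?\<beta>' (\<alpha> i) = - dform (\<alpha> i) (\<alpha> i)"
        using dform_eval[OF \<beta>'d simple_root(2), of i] dform_eval[OF simple_root(2) simple_root(2), of i i] by simp
      then show False using prod simple_root(3)[of i] by simp
    qed
    ultimately show ?thesis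
      using root_products[OF simple_root(1)[of i] r] prod by (auto simp: \<beta>')
  qed
qed

end

section \<open>The generic representation\<close>

context definite_quiver
begin

lemma indecomposable_brick:
  assumes "indecomposable Q N"
  shows "brick (iden (dimv N)) (rep_fmat Q N)"
  using no_idempotents_imp_brick[OF quiver_object_arrow_fmat no_idempotents_if_indecomposable[OF assms]] .

text \<open>Krull-Schmidt for bricks: the identity of \<open>Ns ! l\<close> is a sum of
  endomorphisms factoring through the \<open>Ms ! k\<close>. All of them are scalars, and a nonzero
  one makes \<open>Ns ! l\<close> a retract of the indecomposable \<open>Ms ! k\<close>.\<close>

lemma summand_dims_unique:
  assumes M: "biproduct Q M Ms a a'" and N: "biproduct Q M Ns b b'"
    and indec: "\<forall>N\<in>set Ms. indecomposable Q N" "\<forall>N\<in>set Ns. indecomposable Q N" and l: "l < length Ns"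
  shows "\<exists>k<length Ms. dimv (Ns ! l) = dimv (Ms ! k)"
proof -
  note a = biproductD[OF M] and b = biproductD[OF N]
  let ?N = "Ns ! l"
  have brick: "brick (iden (dimv ?N)) (rep_fmat Q ?N)" using indec(2) l by (intro indecomposable_brick) auto
  have endo: "(b' l * a k) * (a' k * b l) \<in> rep_homs Q ?N ?N" if "k < length Ms" for k
    using homs_comp[OF homs_comp[OF b(1)[OF l] a(2)[OF that]] homs_comp[OF a(1)[OF that] b(2)[OF l]]] .
  have "iden (dimv ?N) = b' l * (\<Sum>k<length Ms. a k * a' k) * b l"
    using a(4) b(3)[OF l l] homsD(3)[OF b(2)[OF l]] by simp
  also have "\<dots> = (\<Sum>k<length Ms. (b' l * a k) * (a' k * b l))"
    by (simp add: sum_distrib_left sum_distrib_right mult.assoc)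
  finally have "(\<Sum>k<length Ms. (b' l * a k) * (a' k * b l)) \<noteq> 0" using brick by (auto simp: brick_def)
  then obtain k where k: "k < length Ms" "(b' l * a k) * (a' k * b l) \<noteq> 0"
    by (meson lessThan_iff sum.not_neutral_contains_not_neutral)
  obtain c where c: "(b' l * a k) * (a' k * b l) = scl c (iden (dimv ?N))"
    using brick endo[OF k(1)] by (auto simp: brick_def)
  have c0: "c \<noteq> 0" using c k(2) by auto
  let ?M = "Ms ! k"
  define u where "u = a' k * b l"
  define v where "v = scl (1 / c) (b' l * a k)"
  have u: "u \<in> rep_homs Q ?N ?M" unfolding u_def by (rule homs_comp[OF b(1)[OF l] a(2)[OF k(1)]])
  have v: "v \<in> rep_homs Q ?M ?N"
    unfolding v_def using homs_comp[OF a(1)[OF k(1)] b(2)[OF l]] fm.subspace_scale[OF subspace_homs] by blast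
  have vu: "v * u = iden (dimv ?N)" using c c0 by (simp add: u_def v_def)
  have "u * v \<in> rep_homs Q ?M ?M" by (rule homs_comp[OF v u])
  moreover have "(u * v) * (u * v) = u * v"
  proof -
    have "(u * v) * (u * v) = u * (v * u) * v" by (simp only: mult.assoc)
    then show ?thesis using homsD(3)[OF u] by (simp add: vu)
  qed
  moreover have "u * v \<noteq> 0"
  proof
    assume "u * v = 0"
    then have "v * (u * v) * u = 0" by simp
    then have "(v * u) * (v * u) = 0" by (simp only: mult.assoc)
    then show False using brick by (simp add: vu brick_def)
  qed
  moreover have "no_idempotents (iden (dimv ?M)) (rep_fmat Q ?M)"
    using indec(1) k(1) by (intro no_idempotents_if_indecomposable) auto
  ultimately have uv: "u * v = iden (dimv ?M)" unfolding no_idempotents_def by blast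
  have "dimv ?N = dimv ?M"
    by (rule iso_imp_dims_eq[OF homsD(1-3)[OF u] homsD(1-3)[OF v] uv vu])
  then show ?thesis using k(1) by blast
qed

text \<open>One generic representation without self-extensions has been constructed, and all generic
  ones are isomorphic to it.\<close>

lemma generic_rep_ext_vanishes:
  assumes "generic_rep Q d M"
  shows "ext_vanishes Q (iden (dimv M)) (rep_fmat Q M) (iden (dimv M)) (rep_fmat Q M)"
proof -
  obtain M0 where M0: "generic_rep Q d M0" "ext_vanishes Q (iden d) (rep_fmat Q M0) (iden d) (rep_fmat Q M0)"
    using generic_rep_exists by blast
  have "is_rep Q M0" "dimv M0 = d" "is_rep Q M" using M0 assms by (simp_all add: generic_rep_def)
  then show ?thesis
    using ext_vanishes_rep_iso[of Q M0 M] generic_rep_unique[OF M0(1) assms] M0(2) by simp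
qed

lemma decomposition_biproduct:
  assumes "is_rep Q M" "decomposition Q M Ms"
  shows "\<forall>N\<in>set Ms. is_rep Q N" "\<exists>a a'. biproduct Q M Ms a a'"
    "dimv M = (\<lambda>i. \<Sum>k<length Ms. dimv (Ms ! k) i)"
proof -
  show r: "\<forall>N\<in>set Ms. is_rep Q N" using assms(2) by (auto simp: decomposition_def indecomposable_def)
  have iso: "rep_iso Q M (direct_sum Q Ms)" using assms(2) by (simp add: decomposition_def)
  then show "\<exists>a a'. biproduct Q M Ms a a'" using rep_iso_direct_sum_iff[OF assms(1) r] by simp
  have "is_rep Q (direct_sum Q Ms)" using biproduct_direct_sum[OF r] by blast
  then have "dimv M = dimv (direct_sum Q Ms)" using rep_iso_dims[OF assms(1) _ iso] by blast
  then show "dimv M = (\<lambda>i. \<Sum>k<length Ms. dimv (Ms ! k) i)"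
    by (simp add: direct_sum_def sum_list_sum_nth lessThan_atLeast0)
qed

text \<open>\<open>generic_roots\<close> ranges over all generic representations and all their
  decompositions; by uniqueness of both it can be computed from any single decomposition.\<close>

lemma generic_roots_eq:
  assumes M: "generic_rep Q d M" "decomposition Q M Ms"
  shows "generic_roots Q d = dimv ` set Ms"
proof
  show "dimv ` set Ms \<subseteq> generic_roots Q d" unfolding generic_roots_def using M by blast
  show "generic_roots Q d \<subseteq> dimv ` set Ms"
  proof
    fix \<beta> assume "\<beta> \<in> generic_roots Q d"
    then obtain M' Ns N where N: "generic_rep Q d M'" "decomposition Q M' Ns" "N \<in> set Ns" "\<beta> = dimv N"
      unfolding generic_roots_def by blast
    have reps: "is_rep Q M" "is_rep Q M'" using M N by (simp_all add: generic_rep_def)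
    obtain a a' where a: "biproduct Q M Ms a a'" using decomposition_biproduct(2)[OF reps(1) M(2)] by blast
    obtain b b' where b: "biproduct Q M' Ns b b'" using decomposition_biproduct(2)[OF reps(2) N(2)] by blast
    obtain b2 b2' where b2: "biproduct Q M Ns b2 b2'"
      using biproduct_iso[OF reps generic_rep_unique[OF M(1) N(1)] b] by blast
    obtain l where l: "l < length Ns" "N = Ns ! l" using N(3) by (auto simp: in_set_conv_nth)
    have "\<exists>k<length Ms. dimv (Ns ! l) = dimv (Ms ! k)"
      using M(2) N(2) l(1) by (intro summand_dims_unique[OF a b2]) (auto simp: decomposition_def)
    then show "\<beta> \<in> dimv ` set Ms" using l(2) N(4) by auto
  qed
qed

end

lemma euler_form_sum_left:
  "euler_form Q (\<lambda>i. \<Sum>k\<in>S. f k i) y = (\<Sum>k\<in>S. euler_form Q (f k) y)"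
proof (induction S rule: infinite_finite_induct)
  case (insert k S)
  then show ?case by (simp add: euler_form_def distrib_right sum.distrib split_def)
qed (simp_all add: euler_form_def)

lemma euler_form_sum_right:
  "euler_form Q x (\<lambda>i. \<Sum>k\<in>S. f k i) = (\<Sum>k\<in>S. euler_form Q x (f k))"
proof (induction S rule: infinite_finite_induct)
  case (insert k S)
  then show ?case by (simp add: euler_form_def distrib_left sum.distrib split_def)
qed (simp_all add: euler_form_def)

context simply_laced_quiver
begin

text \<open>Indexing by list positions leaves open whether summands repeat; vanishing at distinct
  positions is what excludes repetitions afterwards.\<close>

theorem generic_decomposition_orthonormal:
  assumes min: "minuscule H \<kappa> \<alpha> lam" and \<mu>: "\<mu> \<in> weyl_orbit H \<kappa> lam" and \<nu>: "\<nu> \<in> weyl_orbit H \<kappa> lam"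
    and \<delta>: "root_sum \<alpha> \<delta> = (\<lambda>x. \<mu> x - \<nu> x)"
    and gen: "generic_rep Q \<delta> M" and dec: "decomposition Q M Ms"
    and k: "k < length Ms" and l: "l < length Ms"
  shows "euler (dimv (Ms ! k)) (dimv (Ms ! l)) = (if k = l then 1 else 0)"
    and "root_sum \<alpha> (dimv (Ms ! k)) \<in> roots H"
    and "ext_vanishes Q (iden (dimv (Ms ! k))) (rep_fmat Q (Ms ! k)) (iden (dimv (Ms ! l))) (rep_fmat Q (Ms ! l))"
proof -
  define d where "d = (\<lambda>k. dimv (Ms ! k))"
  let ?n = "length Ms"
  have rep: "is_rep Q M" "dimv M = \<delta>" using gen by (simp_all add: generic_rep_def)
  obtain a a' where a: "biproduct Q M Ms a a'" using decomposition_biproduct(2)[OF rep(1) dec] by blast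
  note aD = biproductD[OF a]
  \<comment> \<open>Each summand is both a subobject and a quotient of \<open>M\<close>, so
    \<open>Ext^1 = 0\<close> for \<open>M\<close> passes to every pair of summands.\<close>
  have ext: "ext_vanishes Q (iden (d k)) (rep_fmat Q (Ms ! k)) (iden (d l)) (rep_fmat Q (Ms ! l))"
    if kl: "k < ?n" "l < ?n" for k l
    unfolding d_def
  proof (rule ext_vanishes_retract[OF quiver_object_arrow_fmat quiver_object_arrow_fmat aD(1)[OF kl(1)]
        homsD(1,3)[OF aD(2)[OF kl(1)]] _ aD(2)[OF kl(2)] homsD(1,2)[OF aD(1)[OF kl(2)]] _
        generic_rep_ext_vanishes[OF gen]])
    show "a' k * a k = iden (dimv (Ms ! k))" "a' l * a l = iden (dimv (Ms ! l))"
      using aD(3)[of k k] aD(3)[of l l] kl by simp_all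
  qed
  have diag: "euler (d k) (d k) = 1" if "k < ?n" for k
  proof -
    have "indecomposable Q (Ms ! k)" using dec that by (auto simp: decomposition_def)
    then show ?thesis
      unfolding d_def by (rule brick_euler_form[OF quiver_object_arrow_fmat indecomposable_brick])
  qed
  then have root: "root_sum \<alpha> (d k) \<in> roots H" if "k < ?n" for k
    using that by (intro root_if_euler_form_1)
  have nonneg: "euler (d k) (d l) \<ge> 0" if "k < ?n" "l < ?n" for k l
    using euler_form_nonneg_if_ext_vanishes(1)[OF quiver_object_arrow_fmat quiver_object_arrow_fmat
        ext[OF that, unfolded d_def]] by (simp add: d_def)
  have \<delta>_sum: "(\<lambda>i. int (\<delta> i)) = (\<lambda>i. \<Sum>k<?n. int (d k i))"
    using decomposition_biproduct(3)[OF rep(1) dec] rep(2) by (simp add: d_def)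
  have off: "euler (d k) (d l) = 0" if kl: "k < ?n" "l < ?n" "k \<noteq> l" for k l
  proof -
    let ?s = "\<lambda>j. euler (d j) (d l) + euler (d l) (d j)"
    have lam: "lam \<in> cartan_dual H" using min by (simp add: minuscule_def dominant_weight_def)
    note \<mu>d = weyl_orbit_norm(1)[OF lam \<mu>] and \<nu>d = weyl_orbit_norm(1)[OF lam \<nu>]
    let ?\<beta> = "root_sum \<alpha> (d l)"
    note \<beta> = root[OF kl(2)]
    have "of_int (\<Sum>j<?n. ?s j) = (of_int (euler \<delta> (d l) + euler (d l) \<delta>) :: complex)"
      unfolding \<delta>_sum euler_form_sum_left euler_form_sum_right by (simp add: sum.distrib)
    also have "\<dots> = dform (\<lambda>x. \<mu> x - \<nu> x) ?\<beta>" unfolding \<delta>[symmetric] by (rule dform_root_sum[symmetric])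
    also have "\<dots> = dform \<mu> ?\<beta> - dform \<nu> ?\<beta>"
      using cartan_dual_closed(3)[OF \<mu>d \<nu>d] \<mu>d \<nu>d rootsD(1)[OF \<beta>] by (simp add: dform_eval)
    finally have "of_int (\<Sum>j<?n. ?s j) = dform \<mu> ?\<beta> - dform \<nu> ?\<beta>" .
    from arg_cong[OF this, of Re] have "real_of_int (\<Sum>j<?n. ?s j) = Re (dform \<mu> ?\<beta>) - Re (dform \<nu> ?\<beta>)"
      by simp
    also have "\<dots> \<le> 2"
      using minuscule_products[OF min \<mu> \<beta>] minuscule_products[OF min \<nu> \<beta>] by auto
    finally have "(\<Sum>j<?n. ?s j) \<le> 2" by (simp only: of_int_le_numeral_iff)
    \<comment> \<open>All terms are nonnegative and \<open>?s l = 2\<close> already exhausts the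
      bound, so both Euler products in \<open>?s k\<close> vanish.\<close>
    moreover have "?s k + ?s l \<le> (\<Sum>j<?n. ?s j)"
    proof -
      have "?s k + ?s l = (\<Sum>j\<in>{k, l}. ?s j)" using kl(3) by simp
      also have "\<dots> \<le> (\<Sum>j<?n. ?s j)" by (rule sum_mono2) (use kl nonneg in \<open>auto intro!: add_nonneg_nonneg\<close>)
      finally show ?thesis .
    qed
    ultimately show ?thesis using diag[OF kl(2)] nonneg[OF kl(1,2)] nonneg[OF kl(2,1)] by simp
  qed
  show "euler (dimv (Ms ! k)) (dimv (Ms ! l)) = (if k = l then 1 else 0)"
    using diag[OF k] off[OF k l] by (cases "k = l") (simp_all add: d_def)
  show "root_sum \<alpha> (dimv (Ms ! k)) \<in> roots H" using root[OF k] by (simp add: d_def)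
  show "ext_vanishes Q (iden (dimv (Ms ! k))) (rep_fmat Q (Ms ! k)) (iden (dimv (Ms ! l))) (rep_fmat Q (Ms ! l))"
    using ext[OF k l] by (simp add: d_def)
qed

end

theorem proposition3p1:
  fixes H :: "'g::complex_lie_algebra set"
    and \<kappa> :: "'g \<Rightarrow> 'g \<Rightarrow> complex"
    and \<alpha> :: "'i::finite \<Rightarrow> 'g \<Rightarrow> complex"
    and Q :: "('i \<times> 'i) set"
    and lam \<mu> \<nu> :: "'g \<Rightarrow> complex"
    and \<delta> :: "'i \<Rightarrow> nat"
  assumes "simply_laced_simple H \<kappa> \<alpha>"
    and "minuscule H \<kappa> \<alpha> lam"
    and "dynkin_orientation H \<kappa> \<alpha> Q"
    and "\<mu> \<in> weyl_orbit H \<kappa> lam" and "\<nu> \<in> weyl_orbit H \<kappa> lam"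
    and "root_ge \<alpha> \<mu> \<nu>"
    and "root_sum \<alpha> \<delta> = (\<lambda>x. \<mu> x - \<nu> x)"
  shows "(\<exists>M. generic_rep Q \<delta> M) \<and>
    (\<forall>M. generic_rep Q \<delta> M \<longrightarrow> (\<exists>Ms. decomposition Q M Ms)) \<and>
    (\<forall>M Ms. generic_rep Q \<delta> M \<and> decomposition Q M Ms \<longrightarrow>
       (\<forall>k < length Ms. \<forall>l < length Ms. k \<noteq> l \<longrightarrow>
          \<not> rep_iso Q (Ms ! k) (Ms ! l) \<and>
          dimv (Ms ! k) \<noteq> dimv (Ms ! l) \<and>
          hom_zero Q (Ms ! k) (Ms ! l) \<and>
          ext1_zero Q (Ms ! k) (Ms ! l)) \<and>
       dimv ` set Ms = generic_roots Q \<delta>) \<and>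
    finite (generic_roots Q \<delta>) \<and>
    (\<forall>\<beta>\<in>generic_roots Q \<delta>. root_sum \<alpha> \<beta> \<in> roots H) \<and>
    \<delta> = (\<lambda>i. \<Sum>\<beta>\<in>generic_roots Q \<delta>. \<beta> i) \<and>
    (\<forall>\<beta>\<in>generic_roots Q \<delta>. \<forall>\<gamma>\<in>generic_roots Q \<delta>.
       euler_form Q (\<lambda>i. int (\<beta> i)) (\<lambda>i. int (\<gamma> i)) = (if \<beta> = \<gamma> then 1 else 0)) \<and>
    (\<forall>\<beta>\<in>generic_roots Q \<delta>. \<forall>\<gamma>\<in>generic_roots Q \<delta>.
       \<beta> \<noteq> \<gamma> \<longrightarrow> dual_form H \<kappa> (root_sum \<alpha> \<beta>) (root_sum \<alpha> \<gamma>) = 0)"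
proof -
  interpret simply_laced_quiver H \<kappa> \<alpha> Q
    using assms(1,3) by unfold_locales
  have summands: "\<not> rep_iso Q (Ms ! k) (Ms ! l) \<and> dimv (Ms ! k) \<noteq> dimv (Ms ! l) \<and>
      hom_zero Q (Ms ! k) (Ms ! l) \<and> ext1_zero Q (Ms ! k) (Ms ! l)"
    if gen: "generic_rep Q \<delta> M" and dec: "decomposition Q M Ms"
      and kl: "k < length Ms" "l < length Ms" "k \<noteq> l" for M Ms k l
  proof -
    note on = generic_decomposition_orthonormal[OF assms(2,4,5,7) gen dec]
    have "is_rep Q M" using gen by (simp add: generic_rep_def)
    then have reps: "is_rep Q (Ms ! k)" "is_rep Q (Ms ! l)"
      using decomposition_biproduct(1)[OF _ dec] kl by auto
    have e0: "euler (dimv (Ms ! k)) (dimv (Ms ! l)) = 0" using on(1)[OF kl(1,2)] kl(3) by simp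
    \<comment> \<open>Equal dimension vectors would turn the product 0 into a diagonal one, which is
      1.\<close>
    have ne: "dimv (Ms ! k) \<noteq> dimv (Ms ! l)" using e0 on(1)[OF kl(1,1)] by auto
    have "rep_homs Q (Ms ! k) (Ms ! l) = {0}"
      by (rule euler_form_nonneg_if_ext_vanishes(2)[OF quiver_object_arrow_fmat quiver_object_arrow_fmat
            on(3)[OF kl(1,2)] e0])
    then show ?thesis
      using ne rep_iso_dims[OF reps] hom_zero_if_homs_eq_0[OF reps]
        ext1_zero_if_ext_vanishes[OF reps on(3)[OF kl(1,2)]] by blast
  qed
  obtain M where gen: "generic_rep Q \<delta> M" using generic_rep_exists by blast
  then have M: "is_rep Q M" "dimv M = \<delta>" by (simp_all add: generic_rep_def)
  obtain Ms where dec: "decomposition Q M Ms" using decomposition_exists[OF M(1)] by blast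
  note on = generic_decomposition_orthonormal[OF assms(2,4,5,7) gen dec]
  have R: "generic_roots Q \<delta> = (\<lambda>k. dimv (Ms ! k)) ` {..<length Ms}"
    unfolding generic_roots_eq[OF gen dec] by (force simp: in_set_conv_nth)
  \<comment> \<open>Distinctness of the dimension vectors turns the sum over the list of summands
    into a sum over the set of roots.\<close>
  have inj: "inj_on (\<lambda>k. dimv (Ms ! k)) {..<length Ms}"
    using summands[OF gen dec] by (auto simp: inj_on_def)
  have "\<delta> = (\<lambda>i. \<Sum>\<beta>\<in>generic_roots Q \<delta>. \<beta> i)"
    unfolding R using decomposition_biproduct(3)[OF M(1) dec] M(2) by (simp add: sum.reindex[OF inj])
  moreover have "\<forall>\<beta>\<in>generic_roots Q \<delta>. root_sum \<alpha> \<beta> \<in> roots H"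
    unfolding R using on(2) by auto
  moreover have euler: "\<forall>\<beta>\<in>generic_roots Q \<delta>. \<forall>\<gamma>\<in>generic_roots Q \<delta>.
       euler \<beta> \<gamma> = (if \<beta> = \<gamma> then 1 else 0)"
    unfolding R using on(1) by (auto simp: inj_on_eq_iff[OF inj])
  moreover have "dform (root_sum \<alpha> \<beta>) (root_sum \<alpha> \<gamma>) = 0"
    if "\<beta> \<in> generic_roots Q \<delta>" "\<gamma> \<in> generic_roots Q \<delta>" "\<beta> \<noteq> \<gamma>" for \<beta> \<gamma>
    using euler that by (simp add: dform_root_sum)
  moreover have "finite (generic_roots Q \<delta>)" unfolding R by simp
  moreover have "\<exists>Ms. decomposition Q M Ms" if "generic_rep Q \<delta> M" for M
    using decomposition_exists that by (auto simp: generic_rep_def)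
  moreover have "dimv ` set Ms = generic_roots Q \<delta>" if "generic_rep Q \<delta> M" "decomposition Q M Ms" for M Ms
    using generic_roots_eq[OF that] by simp
  ultimately show ?thesis using summands gen by blast
qed

end
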